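(* If $G$ is a finite non-solvable group with $\Pr(G) = \frac{1}{12}$, then the non-commuting graph $\mathcal{A}_G$ is L-integral.
   Context: For a finite group $G$, $\Pr(G) = |\{(x,y) \in G \times G : xy = yx\}|/|G|^2$ is the commuting probability, i.e. the probability that two randomly chosen elements of $G$ commute. For a finite non-abelian group $G$ with centre $Z(G)$, the non-commuting graph $\mathcal{A}_G$ is the simple undirected graph with vertex set $G \setminus Z(G)$ in which two vertices $x,y$ are adjacent if and only if $xy \neq yx$. A finite graph is L-integral if all eigenvalues of its Laplacian matrix $D - A$ ($D$ the degree matrix, $A$ the adjacency matrix) are integers. *)

theory Defs
  imports
    "HOL-Algebra.Solvable_Groups"
    "Graph_Theory.Graph_Theory"
    "Jordan_Normal_Form.Char_Poly"
begin

definition commuting_probability :: "('a, 'b) monoid_scheme \<Rightarrow> real" where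
  "commuting_probability G =
     real (card {(x, y). x \<in> carrier G \<and> y \<in> carrier G \<and> x \<otimes>\<^bsub>G\<^esub> y = y \<otimes>\<^bsub>G\<^esub> x})
       / real (card (carrier G)) ^ 2"

definition group_center :: "('a, 'b) monoid_scheme \<Rightarrow> 'a set" where
  "group_center G = {z \<in> carrier G. \<forall>x \<in> carrier G. z \<otimes>\<^bsub>G\<^esub> x = x \<otimes>\<^bsub>G\<^esub> z}"

text \<open>As usual in the Graph Theory library, a simple undirected graph is a finite, loop-free,
  symmetric digraph without parallel arcs (\<^locale>\<open>pair_graph\<close>): an edge is represented by the
  two arcs joining its ends.\<close>

definition non_commuting_graph :: "('a, 'b) monoid_scheme \<Rightarrow> 'a pair_pre_digraph" where
  "non_commuting_graph G =
     \<lparr> pverts = carrier G - group_center G,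
       parcs = {(x, y). x \<in> carrier G - group_center G \<and> y \<in> carrier G - group_center G \<and>
                        x \<otimes>\<^bsub>G\<^esub> y \<noteq> y \<otimes>\<^bsub>G\<^esub> x} \<rparr>"

lemma pair_graph_non_commuting_graph:
  assumes "finite (carrier G)"
  shows "pair_graph (non_commuting_graph G)"
proof
  show "finite (parcs (non_commuting_graph G))"
    by (rule finite_subset[of _ "carrier G \<times> carrier G"])
       (use assms in \<open>auto simp: non_commuting_graph_def\<close>)
qed (use assms in \<open>auto simp: non_commuting_graph_def symmetric_def sym_def arcs_ends_def
       arc_to_ends_def image_iff\<close>)

text \<open>The matrices of a graph depend on an enumeration \<open>vs\<close> of its vertices: row and column
  \<open>i\<close> belong to the vertex \<open>vs ! i\<close>. In a symmetric digraph the degree of a vertex in the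
  undirected sense is its out-degree. Eigenvalues are taken over the complex numbers.\<close>

definition adjacency_mat :: "'a pair_pre_digraph \<Rightarrow> 'a list \<Rightarrow> complex mat" where
  "adjacency_mat X vs =
     mat (length vs) (length vs) (\<lambda>(i, j). if (vs ! i, vs ! j) \<in> parcs X then 1 else 0)"

definition degree_mat :: "'a pair_pre_digraph \<Rightarrow> 'a list \<Rightarrow> complex mat" where
  "degree_mat X vs =
     mat (length vs) (length vs)
       (\<lambda>(i, j). if i = j then of_nat (out_degree X (vs ! i)) else 0)"

definition laplacian_mat :: "'a pair_pre_digraph \<Rightarrow> 'a list \<Rightarrow> complex mat" where
  "laplacian_mat X vs = degree_mat X vs - adjacency_mat X vs"

text \<open>Different enumerations give permutation-similar Laplacian matrices, so it does not matter
  that the definition asks for integral eigenvalues under every enumeration; since the vertex set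
  is finite, there is at least one.\<close>

definition L_integral :: "'a pair_pre_digraph \<Rightarrow> bool" where
  "L_integral X \<longleftrightarrow> pair_graph X \<and>
     (\<forall>vs. distinct vs \<and> set vs = pverts X \<longrightarrow>
        (\<forall>k. eigenvalue (laplacian_mat X vs) k \<longrightarrow> k \<in> \<int>))"

end

theory Submission
  imports
    Defs
    "HOL-Algebra.Sylow"
    "HOL-Algebra.Multiplicative_Group"
    "HOL-Algebra.SimpleGroups"
    "HOL-Combinatorics.Permutations"
begin

text \<open>Let \<open>M\<close> be the last term of the derived series of \<open>G\<close> and \<open>S = M / N\<close> a simple quotient of \<open>M\<close>. The
  commuting probability of \<open>G\<close> is at most that of \<open>M\<close>, and that of \<open>M\<close> at most that of \<open>S\<close>. So the class
  number of \<open>S\<close> is at least \<open>|S| / 12\<close>. A study of the action of \<open>S\<close> on a smallest class shows that all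
  nontrivial classes of a nonabelian simple group have at least 12 elements; hence the excesses
  \<open>|C| - 12\<close> over all nontrivial classes \<open>C\<close> of \<open>S\<close> add up to at most 11. Two commuting elements of
  distinct prime orders produce three classes of the same size, and this forces \<open>|S| = 60\<close>, with
  centralizers of orders 3, 4 and 5 and commuting probability \<open>1 / 12\<close>. Therefore both inequalities above
  are equalities, from which \<open>G = M Z(G)\<close>, and elements of \<open>M\<close> commute if and only if their images in
  \<open>S\<close> do. So commuting is transitive on the noncentral elements: the graph is complete multipartite.\<close>

section \<open>Conjugation and group actions\<close>

text \<open>The model is the alternating group of degree 5, with class sizes 1, 12, 12, 15 and 20.
  If \<open>S\<close> has k classes, then 1 + 12 (k - 1) plus the total excess equals |S| <= 12 k,
  whence the budget 11; the excesses 3 and 8 of classes of sizes 15 and 20 use it up.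
  \<open>S\<close> is never identified with that group: class sizes suffice, and its automorphisms
  are controlled through its six subgroups of order 5. The bound 12 needs no character theory. A
  smallest class may be taken to consist of elements of prime order \<open>p\<close>, since passing
  to a power only enlarges a centralizer; \<open>x\<close> then acts on its own class with
  \<open>f\<close> fixed points and \<open>t\<close> cycles of length \<open>p\<close>, and f + p t
  <= 11 leaves a short list of triples. Equality in the first inequality makes \<open>M\<close>
  transitive on every class of \<open>G\<close>. Hence conjugation by an element of \<open>G\<close>
  can be corrected by an element of \<open>M\<close> so as to fix an element of \<open>S\<close>
  with centralizer of order 5, and this rules out an outer automorphism of \<open>S\<close>. The
  Laplacian eigenvalues of a complete multipartite graph on n vertices can only be 0, n, or n minus
  the size of a part.\<close>

lemma involution_sign:
  assumes "finite X" "p permutes X" "\<And>z. p (p z) = z"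
  shows "even (card {z. p z \<noteq> z}) \<and> sign p = (-1) ^ (card {z. p z \<noteq> z} div 2)"
  using assms
proof (induction "card {z. p z \<noteq> z}" arbitrary: p rule: less_induct)
  case less
  have fm: "finite {z. p z \<noteq> z}"
    by (rule finite_subset[OF _ less.prems(1)]) (use less.prems(2) in \<open>auto simp: permutes_def\<close>)
  show ?case
  proof (cases "{z. p z \<noteq> z} = {}")
    case True
    then have "p = id" by auto
    then show ?thesis by simp
  next
    case False
    then obtain a where a: "p a \<noteq> a" by auto
    \<comment> \<open>Composing with this transposition turns \<open>a\<close> and
      \<open>p a\<close> into fixed points and leaves an involution, so two moved points disappear
      while the sign flips.\<close>
    define q where "q = transpose a (p a) \<circ> p"
    have aX: "a \<in> X" "p a \<in> X" using a less.prems(2) by (auto simp: permutes_def permutes_in_image)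
    have qX: "q permutes X" unfolding q_def
      by (rule permutes_compose[OF less.prems(2)]) (use aX in \<open>auto intro: permutes_swap_id\<close>)
    have inj: "p u = p v \<longleftrightarrow> u = v" for u v using less.prems(3) by metis
    have qa: "q z = (if z = a \<or> z = p a then z else p z)" for z
      using inj[of z a] inj[of z "p a"] less.prems(3)[of a] a
      by (auto simp: q_def transpose_def less.prems(3))
    have qq: "q (q z) = z" for z
      using less.prems(3) inj by (auto simp: qa)
    have mq: "{z. q z \<noteq> z} = {z. p z \<noteq> z} - {a, p a}" by (auto simp: qa)
    have sub: "{a, p a} \<subseteq> {z. p z \<noteq> z}" using a less.prems(3)[of a] by auto
    have c: "card {z. q z \<noteq> z} + 2 = card {z. p z \<noteq> z}"
      using card_Diff_subset[OF _ sub] card_mono[OF fm sub] a by (simp add: mq)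
    have IH: "even (card {z. q z \<noteq> z}) \<and> sign q = (-1) ^ (card {z. q z \<noteq> z} div 2)"
      by (rule less.hyps) (use c qX qq less.prems(1) in auto)
    have pp: "permutation p" "permutation (transpose a (p a))"
      using less.prems permutation_permutes by (auto simp: permutation_swap_id)
    have "sign q = - sign p"
      unfolding q_def using sign_compose[OF pp(2,1)] a by (simp add: sign_swap_id)
    with IH c show ?thesis by (auto simp flip: c)
  qed
qed

context group
begin

definition conj :: "'a \<Rightarrow> 'a \<Rightarrow> 'a" where "conj g x = g \<otimes> x \<otimes> inv g"
definition centr :: "'a \<Rightarrow> 'a set" where "centr x = {g \<in> carrier G. g \<otimes> x = x \<otimes> g}"
definition cls :: "'a \<Rightarrow> 'a set" where "cls x = (\<lambda>g. conj g x) ` carrier G"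

lemma conj_closed [simp, intro]: "g \<in> carrier G \<Longrightarrow> x \<in> carrier G \<Longrightarrow> conj g x \<in> carrier G"
  by (simp add: conj_def)

lemma conj_one [simp]: "x \<in> carrier G \<Longrightarrow> conj \<one> x = x"
  by (simp add: conj_def)

lemma conj_of_one [simp]: "g \<in> carrier G \<Longrightarrow> conj g \<one> = \<one>"
  by (simp add: conj_def)

lemma conj_conj:
  "g \<in> carrier G \<Longrightarrow> h \<in> carrier G \<Longrightarrow> x \<in> carrier G \<Longrightarrow> conj g (conj h x) = conj (g \<otimes> h) x"
  by (simp add: conj_def m_assoc inv_mult_group)

lemma conj_inv_conj [simp]:
  "g \<in> carrier G \<Longrightarrow> x \<in> carrier G \<Longrightarrow> conj (inv g) (conj g x) = x"
  "g \<in> carrier G \<Longrightarrow> x \<in> carrier G \<Longrightarrow> conj g (conj (inv g) x) = x"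
  by (simp_all add: conj_conj)

lemma conj_mult:
  "g \<in> carrier G \<Longrightarrow> x \<in> carrier G \<Longrightarrow> y \<in> carrier G \<Longrightarrow> conj g (x \<otimes> y) = conj g x \<otimes> conj g y"
  unfolding conj_def by (smt (verit) inv_closed inv_solve_left m_assoc m_closed)

lemma conj_inject [simp]:
  "g \<in> carrier G \<Longrightarrow> x \<in> carrier G \<Longrightarrow> y \<in> carrier G \<Longrightarrow> conj g x = conj g y \<longleftrightarrow> x = y"
  by (metis conj_inv_conj(1))

lemma conj_inv: "g \<in> carrier G \<Longrightarrow> x \<in> carrier G \<Longrightarrow> conj g (inv x) = inv (conj g x)"
  by (metis conj_closed conj_mult conj_of_one inv_closed inv_equality l_inv)

lemma conj_pow: "g \<in> carrier G \<Longrightarrow> x \<in> carrier G \<Longrightarrow> conj g (x [^] (n::nat)) = conj g x [^] n"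
  by (induction n) (simp_all add: conj_mult)

lemma conj_eq_iff:
  "g \<in> carrier G \<Longrightarrow> x \<in> carrier G \<Longrightarrow> conj g x = x \<longleftrightarrow> g \<otimes> x = x \<otimes> g"
  unfolding conj_def by (metis inv_solve_right m_closed)

lemma mem_centr: "g \<in> centr x \<longleftrightarrow> g \<in> carrier G \<and> g \<otimes> x = x \<otimes> g"
  by (simp add: centr_def)

lemma mem_centr_conj: "x \<in> carrier G \<Longrightarrow> g \<in> centr x \<longleftrightarrow> g \<in> carrier G \<and> conj g x = x"
  by (auto simp: mem_centr conj_eq_iff)

lemma centr_carrier: "centr x \<subseteq> carrier G" by (auto simp: centr_def)

lemma centr_subgroup: "x \<in> carrier G \<Longrightarrow> subgroup (centr x) G"
proof (rule subgroupI)
  assume x: "x \<in> carrier G"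
  show "centr x \<noteq> {}" using x by (auto simp: mem_centr intro!: exI[of _ \<one>])
  show "inv a \<in> centr x" if "a \<in> centr x" for a
    using that x by (metis mem_centr mem_centr_conj conj_inv_conj(1) inv_closed)
  show "a \<otimes> b \<in> centr x" if "a \<in> centr x" "b \<in> centr x" for a b
    using that x by (metis mem_centr mem_centr_conj conj_conj m_closed)
qed (rule centr_carrier)

lemma centr_conj:
  assumes g: "g \<in> carrier G" and x: "x \<in> carrier G"
  shows "centr (conj g x) = conj g ` centr x"
proof -
  have 1: "conj g h \<in> centr (conj g x)" if "h \<in> centr x" "g \<in> carrier G" "x \<in> carrier G" for g h x
    using that by (auto simp: mem_centr simp flip: conj_mult)
  show ?thesis
  proof
    show "centr (conj g x) \<subseteq> conj g ` centr x"
    proof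
      fix h assume h: "h \<in> centr (conj g x)"
      have "conj (inv g) h \<in> centr x"
        using 1[OF h, of "inv g"] g x by simp
      then show "h \<in> conj g ` centr x"
        using g h by (metis conj_inv_conj(2) image_eqI mem_centr)
    qed
  qed (use 1 g x in auto)
qed

lemma conj_mem_centr_iff:
  assumes "g \<in> carrier G" "x \<in> carrier G" "y \<in> carrier G"
  shows "conj g x \<in> centr (conj g y) \<longleftrightarrow> x \<in> centr y"
  using assms by (auto simp: mem_centr simp flip: conj_mult)

lemma cls_self: "x \<in> carrier G \<Longrightarrow> x \<in> cls x"
  by (force simp: cls_def image_iff intro: bexI[of _ \<one>])

lemma cls_carrier: "x \<in> carrier G \<Longrightarrow> cls x \<subseteq> carrier G"
  by (auto simp: cls_def)

lemma conj_mem_cls: "g \<in> carrier G \<Longrightarrow> x \<in> carrier G \<Longrightarrow> y \<in> cls x \<Longrightarrow> conj g y \<in> cls x"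
  by (auto simp: cls_def conj_conj)

lemma cls_eq:
  assumes "x \<in> carrier G" "y \<in> cls x" shows "cls y = cls x"
proof -
  obtain g where g: "g \<in> carrier G" "y = conj g x" using assms by (auto simp: cls_def)
  have "z \<in> cls x" if "z \<in> cls y" for z
    using that conj_mem_cls[OF _ assms] by (auto simp: cls_def)
  moreover have "z \<in> cls y" if "z \<in> cls x" for z
  proof -
    have "x = conj (inv g) y" using g assms by simp
    then have "x \<in> cls y" using g(1) by (auto simp: cls_def)
    then show ?thesis using that conj_mem_cls[of _ y x] g assms by (auto simp: cls_def)
  qed
  ultimately show ?thesis by auto
qed

lemma cls_one [simp]: "cls \<one> = {\<one>}"
  by (auto simp: cls_def conj_def image_iff intro: bexI[of _ \<one>])

end

section \<open>Group actions: orbits, stabilizers, fixed points of p-groups\<close>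

locale action = group G for G (structure) +
  fixes X :: "'x set" and act :: "'a \<Rightarrow> 'x \<Rightarrow> 'x"
  assumes fin: "finite (carrier G)" and finX: "finite X"
    and act_closed: "g \<in> carrier G \<Longrightarrow> z \<in> X \<Longrightarrow> act g z \<in> X"
    and act_one: "z \<in> X \<Longrightarrow> act \<one> z = z"
    and act_mult: "g \<in> carrier G \<Longrightarrow> h \<in> carrier G \<Longrightarrow> z \<in> X \<Longrightarrow> act (g \<otimes> h) z = act g (act h z)"
begin

lemma act_inv: 
  assumes "g \<in> carrier G" "z \<in> X" shows "act (inv g) (act g z) = z" "act g (act (inv g) z) = z"
  using act_mult[of "inv g" g z] act_mult[of g "inv g" z] assms by (simp_all add: act_one)

lemma act_eq_iff: "g \<in> carrier G \<Longrightarrow> y \<in> X \<Longrightarrow> z \<in> X \<Longrightarrow> act g y = act g z \<longleftrightarrow> y = z"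
  by (metis act_inv(1))

definition orb :: "'x \<Rightarrow> 'x set" where "orb z = (\<lambda>g. act g z) ` carrier G"
definition stab :: "'x \<Rightarrow> 'a set" where "stab z = {g \<in> carrier G. act g z = z}"

lemma orbit_stabilizer:
  assumes z: "z \<in> X" shows "card (orb z) * card (stab z) = card (carrier G)"
proof -
  have fib: "card {g \<in> carrier G. act g z = y} = card (stab z)" if y: "y \<in> orb z" for y
  proof -
    obtain h where h: "h \<in> carrier G" "y = act h z" using y by (auto simp: orb_def)
    have "bij_betw (\<lambda>g. h \<otimes> g) (stab z) {g \<in> carrier G. act g z = y}"
    proof (rule bij_betwI[where g = "\<lambda>g. inv h \<otimes> g"])
      show "(\<lambda>g. h \<otimes> g) \<in> stab z \<rightarrow> {g \<in> carrier G. act g z = y}"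
        using h z by (auto simp: stab_def act_mult)
      show "(\<lambda>g. inv h \<otimes> g) \<in> {g \<in> carrier G. act g z = y} \<rightarrow> stab z"
        using h z by (auto simp: stab_def act_mult act_inv)
    qed (use h in \<open>auto simp: stab_def m_assoc[symmetric]\<close>)
    from bij_betw_same_card[OF this] show ?thesis by simp
  qed
  have "card (carrier G) = card (\<Union>y\<in>orb z. {g \<in> carrier G. act g z = y})"
    by (rule arg_cong[of _ _ card]) (auto simp: orb_def)
  also have "\<dots> = (\<Sum>y\<in>orb z. card {g \<in> carrier G. act g z = y})"
    by (rule card_UN_disjoint) (use fin in \<open>auto simp: orb_def\<close>)
  also have "\<dots> = card (orb z) * card (stab z)" using fib by simp
  finally show ?thesis by simp
qed

lemma orb_self: "z \<in> X \<Longrightarrow> z \<in> orb z"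
  using act_one by (force simp: orb_def image_iff intro: bexI[of _ \<one>])

lemma orb_subset: "z \<in> X \<Longrightarrow> orb z \<subseteq> X"
  by (auto simp: orb_def act_closed)

lemma orb_eq: 
  assumes "z \<in> X" "y \<in> orb z" shows "orb y = orb z"
proof -
  obtain h where h: "h \<in> carrier G" "y = act h z" using assms by (auto simp: orb_def)
  have "act g y \<in> orb z" if "g \<in> carrier G" for g
  proof -
    have "act g y = act (g \<otimes> h) z" using that h assms(1) by (simp add: act_mult)
    then show ?thesis using that h(1) by (auto simp: orb_def)
  qed
  moreover have "act g z \<in> orb y" if "g \<in> carrier G" for g
  proof -
    have "act g z = act (g \<otimes> inv h) y" using that h assms
      by (simp add: act_mult act_inv act_closed)
    then show ?thesis using that h by (auto simp: orb_def)
  qed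
  ultimately show ?thesis by (auto simp: orb_def)
qed

lemma orb_disjoint:
  assumes "y \<in> X" "z \<in> X" "orb y \<noteq> orb z" shows "orb y \<inter> orb z = {}"
proof (rule ccontr)
  assume "orb y \<inter> orb z \<noteq> {}"
  then obtain w where "w \<in> orb y" "w \<in> orb z" by blast
  then show False using orb_eq[OF assms(1), of w] orb_eq[OF assms(2), of w] assms(3) by simp
qed

text \<open>The points outside \<open>?F\<close> form a union of orbits whose sizes are powers of
  \<open>p\<close> other than 1.\<close>

lemma p_group_fixed_points:
  assumes p: "prime p" and c: "card (carrier G) = p ^ a"
  shows "card X mod p = card {z \<in> X. \<forall>g\<in>carrier G. act g z = z} mod p"
proof -
  let ?F = "{z \<in> X. \<forall>g\<in>carrier G. act g z = z}"
  let ?O = "orb ` (X - ?F)"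
  have dv: "p dvd card (orb z)" if z: "z \<in> X - ?F" for z
  proof -
    have zX: "z \<in> X" using z by auto
    have "card (orb z) dvd p ^ a" using orbit_stabilizer[OF zX] c by (metis dvd_triv_left)
    then obtain b where b: "card (orb z) = p ^ b" "b \<le> a" using divides_primepow_nat[OF p] by blast
    obtain g where g: "g \<in> carrier G" "act g z \<noteq> z" using z by auto
    have "card (orb z) \<noteq> 1"
    proof
      assume "card (orb z) = 1"
      then obtain w where "orb z = {w}" by (auto simp: card_1_singleton_iff)
      moreover have "act g z \<in> orb z" using g by (auto simp: orb_def)
      ultimately show False using orb_self[OF zX] g by auto
    qed
    with b show ?thesis by (cases b) auto
  qed
  have un: "X - ?F = \<Union>?O"
  proof
    show "X - ?F \<subseteq> \<Union>?O" using orb_self by auto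
    show "\<Union>?O \<subseteq> X - ?F"
    proof
      fix y assume "y \<in> \<Union>?O"
      then obtain z where z: "z \<in> X" "z \<notin> ?F" "y \<in> orb z" by auto
      have "y \<in> X" using orb_subset z by auto
      moreover have "y \<notin> ?F"
      proof
        assume "y \<in> ?F"
        then have "orb y = {y}" using act_one by (auto simp: orb_def)
        then have "z = y" using orb_eq[OF z(1,3)] orb_self[OF z(1)] by auto
        with \<open>y \<in> ?F\<close> z show False by auto
      qed
      ultimately show "y \<in> X - ?F" by auto
    qed
  qed
  have "card (X - ?F) = sum card ?O"
    unfolding un[symmetric]
  proof (subst un, rule card_Union_disjoint)
    show "pairwise disjnt ?O"
      unfolding pairwise_def disjnt_def using orb_disjoint by blast
    fix A assume "A \<in> ?O"
    then obtain z where "z \<in> X" "A = orb z" by blast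
    then show "finite A" using finite_subset[OF orb_subset finX] by simp
  qed
  moreover have "p dvd sum card ?O" using dv by (auto intro!: dvd_sum)
  ultimately have "p dvd card (X - ?F)" by simp
  moreover have "card X = card ?F + card (X - ?F)"
    using card_Diff_subset[of ?F X] card_mono[OF finX, of ?F] finX by auto
  ultimately show ?thesis by (auto elim!: dvdE)
qed

end

section \<open>Finite groups\<close>

locale finite_group = group G for G (structure) +
  assumes fin: "finite (carrier G)"
begin

lemma card_pos: "card (carrier G) > 0"
  using fin by (auto simp: card_gt_0_iff)

lemma finite_cls [simp]: "x \<in> carrier G \<Longrightarrow> finite (cls x)"
  using cls_carrier fin finite_subset by metis

lemma finite_centr [simp]: "finite (centr x)"
  using centr_carrier fin finite_subset by metis

lemma subgroup_card_dvd_subgroup: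
  assumes "subgroup H G" "subgroup K G" "H \<subseteq> K" shows "card H dvd card K"
proof -
  interpret K: group "G\<lparr>carrier := K\<rparr>" using subgroup.subgroup_is_group[OF assms(2)] group_axioms by blast
  have "subgroup H (G\<lparr>carrier := K\<rparr>)" using subgroup_incl[OF assms] .
  from K.lagrange[OF this] have "card K = card (rcosets\<^bsub>G\<lparr>carrier := K\<rparr>\<^esub> H) * card H"
    by (simp add: Coset.order_def)
  then show ?thesis by simp
qed

lemma cls_centr:
  assumes x: "x \<in> carrier G" shows "card (cls x) * card (centr x) = card (carrier G)"
proof -
  interpret A: action G "carrier G" conj
    by unfold_locales (use fin in \<open>auto simp: conj_conj\<close>)
  have "A.orb x = cls x" by (simp add: A.orb_def cls_def)
  moreover have "A.stab x = centr x" using x by (auto simp: A.stab_def mem_centr_conj)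
  ultimately show ?thesis using A.orbit_stabilizer[OF x] by simp
qed

lemma cls_dvd: "x \<in> carrier G \<Longrightarrow> card (cls x) dvd card (carrier G)"
  by (metis cls_centr dvd_triv_left)

lemma card_cls_eq: "x \<in> carrier G \<Longrightarrow> y \<in> cls x \<Longrightarrow> card (centr y) = card (centr x)"
  using cls_centr[of x] cls_centr[of y] cls_eq[of x y] cls_carrier[of x] card_pos
  by (metis less_not_refl2 mult_cancel1 mult_is_0 subsetD)

lemma card_cls_pos: "x \<in> carrier G \<Longrightarrow> card (cls x) > 0"
  and card_centr_pos: "x \<in> carrier G \<Longrightarrow> card (centr x) > 0"
  using cls_centr[of x] card_pos by (metis gr0I mult_0 mult_0_right less_irrefl)+

text \<open>If no nontrivial element of \<open>H\<close> centralizes \<open>y\<close>, the orbit map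
  of \<open>y\<close> is injective on \<open>H\<close>. This bounds a centralizer by the size of a
  set that it preserves.\<close>

lemma card_semiregular_le:
  assumes H: "subgroup H G" and y: "y \<in> carrier G" "\<And>v. v \<in> H \<Longrightarrow> v \<in> centr y \<Longrightarrow> v = \<one>"
    and A: "finite A" "\<And>v. v \<in> H \<Longrightarrow> conj v y \<in> A"
  shows "card H \<le> card A"
proof (rule card_inj_on_le[OF _ _ A(1)])
  show "inj_on (\<lambda>v. conj v y) H"
  proof (rule inj_onI)
    fix u v assume uv: "u \<in> H" "v \<in> H" "conj u y = conj v y"
    have G: "u \<in> carrier G" "v \<in> carrier G" using uv subgroup.mem_carrier[OF H] by auto
    have "conj (inv v \<otimes> u) y = y" using uv G y(1) by (metis conj_conj conj_inv_conj(1) inv_closed)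
    then have "inv v \<otimes> u \<in> centr y" using G y(1) by (simp add: mem_centr_conj)
    moreover have "inv v \<otimes> u \<in> H" using uv subgroup.m_closed[OF H] subgroup.m_inv_closed[OF H] by blast
    ultimately have "inv v \<otimes> u = \<one>" by (rule y(2)[rotated])
    then show "u = v" using G by (metis inv_equality inv_inv inv_closed)
  qed
qed (use A(2) in blast)

lemma cls_mono_centr:
  assumes "x \<in> carrier G" "y \<in> carrier G" "centr x \<subseteq> centr y"
  shows "card (cls y) dvd card (cls x)"
proof -
  have "card (centr x) dvd card (centr y)"
    using subgroup_card_dvd_subgroup centr_subgroup assms by blast
  then obtain k where k: "card (centr y) = card (centr x) * k" by blast
  have "card (cls x) * card (centr x) = card (cls y) * k * card (centr x)"
    using cls_centr[of x] cls_centr[of y] assms k by (simp add: ac_simps)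
  moreover have "card (centr x) > 0" using card_centr_pos assms(1) .
  ultimately show ?thesis by auto
qed

lemma centr_pow_subset: "x \<in> carrier G \<Longrightarrow> centr x \<subseteq> centr (x [^] (n::nat))"
  by (auto simp: mem_centr_conj conj_pow)

lemma prime_power_elem:
  assumes g: "g \<in> carrier G" "g \<noteq> \<one>" and p: "prime p" "p dvd ord g"
  shows "g [^] (ord g div p) \<noteq> \<one> \<and> (g [^] (ord g div p)) [^] p = \<one>"
proof
  have o: "ord g > 0" using ord_ge_1[OF fin g(1)] by simp
  have "ord g div p < ord g" using o p prime_gt_1_nat by auto
  moreover have "ord g div p > 0" using p o by (simp add: dvd_imp_le div_greater_zero_iff prime_gt_0_nat)
  ultimately show "g [^] (ord g div p) \<noteq> \<one>" using pow_eq_id[OF g(1)] by (metis nat_dvd_not_less)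
  show "(g [^] (ord g div p)) [^] p = \<one>" using g p by (simp add: nat_pow_pow)
qed

lemma ex_prime_power:
  assumes g: "g \<in> carrier G" "g \<noteq> \<one>"
  shows "\<exists>(n::nat) p. prime p \<and> p dvd ord g \<and> g [^] n \<noteq> \<one> \<and> (g [^] n) [^] p = \<one>"
proof -
  have "ord g \<noteq> 1" using g ord_eq_1 by blast
  then obtain p where "prime p" "p dvd ord g" using prime_factor_nat by blast
  then show ?thesis using prime_power_elem[OF g] by blast
qed

lemma ord_prime:
  assumes "x \<in> carrier G" "x \<noteq> \<one>" "x [^] p = \<one>" "prime (p::nat)"
  shows "ord x = p"
proof -
  have "ord x dvd p" using assms pow_eq_id by blast
  moreover have "ord x \<noteq> 1" using assms ord_eq_1 by blast
  ultimately show ?thesis using assms prime_nat_iff by blast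
qed

lemma prime_order_unique:
  assumes "x \<in> carrier G" "x \<noteq> \<one>" "x [^] p = \<one>" "prime (p::nat)" "x [^] q = \<one>" "prime (q::nat)"
  shows "p = q"
  using assms ord_prime by metis

lemma ord_dvd_subgroup:
  assumes "subgroup H G" "g \<in> H" shows "ord g dvd card H"
proof -
  interpret H: group "G\<lparr>carrier := H\<rparr>" using subgroup.subgroup_is_group[OF assms(1)] group_axioms by blast
  have "g [^]\<^bsub>G\<lparr>carrier := H\<rparr>\<^esub> Coset.order (G\<lparr>carrier := H\<rparr>) = \<one>"
    using H.pow_order_eq_1 assms by simp
  then have "g [^] card H = \<one>" 
    by (simp add: Coset.order_def nat_pow_consistent[symmetric] flip: nat_pow_consistent)
  then show ?thesis using pow_eq_id assms subgroup.mem_carrier by metis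
qed

lemma action_subgroup:
  assumes H: "subgroup H G" and fX: "finite X"
    and 1: "\<And>g z. g \<in> H \<Longrightarrow> z \<in> X \<Longrightarrow> act g z \<in> X"
    and 2: "\<And>z. z \<in> X \<Longrightarrow> act \<one> z = z"
    and 3: "\<And>g h z. g \<in> H \<Longrightarrow> h \<in> H \<Longrightarrow> z \<in> X \<Longrightarrow> act (g \<otimes> h) z = act g (act h z)"
  shows "action (G\<lparr>carrier := H\<rparr>) X act"
proof -
  interpret H: group "G\<lparr>carrier := H\<rparr>" using subgroup.subgroup_is_group[OF H] group_axioms by blast
  show ?thesis
    by unfold_locales (use assms fin finite_subset subgroup.subset[OF H] in auto)
qed

lemma subgroup_fixed_points:
  assumes H: "subgroup H G" and p: "prime p" "card H = p ^ k"
    and A: "A \<subseteq> carrier G" "\<And>g z. g \<in> H \<Longrightarrow> z \<in> A \<Longrightarrow> conj g z \<in> A"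
  shows "card A mod p = card {z \<in> A. H \<subseteq> centr z} mod p"
proof -
  have fA: "finite A" using A fin finite_subset by blast
  have HG: "\<And>g. g \<in> H \<Longrightarrow> g \<in> carrier G" using subgroup.mem_carrier[OF H] .
  interpret A: action "G\<lparr>carrier := H\<rparr>" A conj
    by (rule action_subgroup[OF H fA]) (use A HG in \<open>auto simp: conj_conj subset_iff\<close>)
  have "{z \<in> A. \<forall>g\<in>H. conj g z = z} = {z \<in> A. H \<subseteq> centr z}"
    using A HG by (auto simp: subset_iff mem_centr_conj)
  then show ?thesis using A.p_group_fixed_points[OF p(1), of k] p by simp
qed

lemma order_p_fixed_points:
  assumes y: "y \<in> carrier G" "y [^] p = \<one>" and p: "prime (p::nat)"
    and A: "A \<subseteq> carrier G" "\<And>z. z \<in> A \<Longrightarrow> conj y z \<in> A"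
  shows "card A mod p = card (A \<inter> centr y) mod p"
proof -
  let ?H = "generate G {y}"
  have H: "subgroup ?H G" using y by (auto intro: generate_is_subgroup)
  have cH: "card ?H = ord y" using generate_pow_card[OF y(1)] by simp
  have He: "?H = {y [^] (k::nat) | k. k \<in> UNIV}"
    using generate_pow_on_finite_carrier[OF fin y(1)] by simp
  \<comment> \<open>\<open>y\<close> may be trivial, so the exponent can be 0 as well as 1.\<close>
  obtain k where k: "card ?H = p ^ k"
    using cH ord_prime[of y p] y p by (cases "y = \<one>") (auto intro: that[of 0] that[of 1])
  have "conj (y [^] (k::nat)) z \<in> A" if "z \<in> A" for k z
    using that
  proof (induction k arbitrary: z)
    case (Suc k)
    have "conj (y [^] Suc k) z = conj (y [^] k) (conj y z)"
      using y A Suc.prems by (auto simp: conj_conj)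
    then show ?case using Suc A by auto
  qed (use A in auto)
  then have "card A mod p = card {z \<in> A. ?H \<subseteq> centr z} mod p"
    by (intro subgroup_fixed_points[OF H p k A(1)]) (auto simp: He)
  moreover have "{z \<in> A. ?H \<subseteq> centr z} = A \<inter> centr y"
  proof -
    have "?H \<subseteq> centr z \<longleftrightarrow> z \<in> centr y" if "z \<in> A" for z
    proof
      assume "?H \<subseteq> centr z"
      then have "y \<in> centr z" using generate.incl[of y "{y}"] by blast
      then show "z \<in> centr y" using that A by (auto simp: mem_centr)
    next
      assume "z \<in> centr y"
      then have "z \<in> centr (y [^] (k::nat))" for k using centr_pow_subset[OF y(1)] by blast
      then show "?H \<subseteq> centr z" using y by (auto simp: He mem_centr)
    qed
    then show ?thesis by auto
  qed
  ultimately show ?thesis by simp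
qed

lemma sylow:
  assumes "prime p"
  obtains P k where "subgroup P G" "card P = p ^ k" "\<not> p dvd card (carrier G) div p ^ k"
    "p ^ k dvd card (carrier G)" "k = multiplicity p (card (carrier G))"
proof -
  let ?n = "card (carrier G)" let ?k = "multiplicity p ?n"
  have d: "p ^ ?k dvd ?n" by (rule multiplicity_dvd)
  have nd: "\<not> p dvd ?n div p ^ ?k"
    by (rule multiplicity_decompose) (use card_pos assms not_prime_unit in auto)
  have "\<exists>H. subgroup H G \<and> card H = p ^ ?k"
    using sylow_thm[OF assms group_axioms, of ?k "?n div p ^ ?k"] d fin by (auto simp: Coset.order_def)
  then show ?thesis using that d nd by blast
qed

lemma prime_dvd_sylow:
  assumes "prime p" "p dvd card (carrier G)" "card P = p ^ k" "\<not> p dvd card (carrier G) div p ^ k"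
  shows "k > 0"
  using assms by (cases k) auto

text \<open>A Sylow \<open>p\<close>-subgroup has a nontrivial centre, and a central element of
  order \<open>p\<close> has a centralizer containing the whole Sylow subgroup, so \<open>p\<close>
  does not divide its index. Most contradictions between class sizes start from such an
  element.\<close>

lemma ex_p_central:
  assumes p: "prime p" "p dvd card (carrier G)"
  obtains x where "x \<in> carrier G" "x \<noteq> \<one>" "x [^] p = \<one>" "\<not> p dvd card (cls x)"
proof -
  obtain P k where P: "subgroup P G" "card P = p ^ k" "\<not> p dvd card (carrier G) div p ^ k"
    "p ^ k dvd card (carrier G)" using sylow[OF p(1)] by metis
  have k: "k > 0" using prime_dvd_sylow[OF p P(2,3)] .
  have PG: "P \<subseteq> carrier G" using subgroup.subset[OF P(1)] .
  let ?Z = "{z \<in> P. P \<subseteq> centr z}"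
  have "card P mod p = card ?Z mod p"
    by (rule subgroup_fixed_points[OF P(1) p(1) P(2) PG])
       (use P(1) in \<open>auto simp: conj_def subgroup.m_closed subgroup.m_inv_closed\<close>)
  then have dv: "p dvd card ?Z" using P(2) k by (cases k) (simp_all add: dvd_eq_mod_eq_0)
  have one: "\<one> \<in> ?Z" using P(1) PG by (auto simp: mem_centr subgroup.one_closed subset_iff)
  have "?Z \<noteq> {\<one>}" using dv p(1) by auto
  then obtain z where z: "z \<in> ?Z" "z \<noteq> \<one>" using one by auto
  have zG: "z \<in> carrier G" using z PG by auto
  obtain n q where q: "prime q" "q dvd ord z" "z [^] n \<noteq> \<one>" "(z [^] (n::nat)) [^] q = \<one>"
    using ex_prime_power[OF zG z(2)] by blast
  have "q dvd p ^ k" using ord_dvd_subgroup[OF P(1), of z] z q(2) P(2) by (auto intro: dvd_trans)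
  then have qp: "q = p" using p q by (metis prime_dvd_power primes_dvd_imp_eq)
  let ?x = "z [^] n"
  have xG: "?x \<in> carrier G" using zG by simp
  have "P \<subseteq> centr ?x" using z centr_pow_subset[OF zG] by blast
  then have "p ^ k dvd card (centr ?x)"
    using subgroup_card_dvd_subgroup[OF P(1) centr_subgroup[OF xG]] P(2) by simp
  then obtain m where "card (centr ?x) = p ^ k * m" by blast
  then have "card (carrier G) div p ^ k = card (cls ?x) * m"
    using cls_centr[OF xG] p(1) prime_gt_0_nat[of p]
    by (metis (no_types, lifting) mult.left_commute nonzero_mult_div_cancel_left power_not_zero not_less0)
  then have "\<not> p dvd card (cls ?x)" using P(3) by auto
  with that[OF xG] q qp show ?thesis by auto
qed

lemma subgroup_finite_group:
  "subgroup H G \<Longrightarrow> finite_group (G\<lparr>carrier := H\<rparr>)"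
  using subgroup.subgroup_is_group[of H G] group_axioms fin finite_subset[OF subgroup.subset[of H G]]
  by (simp add: finite_group_def finite_group_axioms_def)

lemma cauchy:
  assumes H: "subgroup H G" and p: "prime p" "p dvd card H"
  obtains x where "x \<in> H" "x \<noteq> \<one>" "x [^] p = \<one>"
proof -
  interpret H: finite_group "G\<lparr>carrier := H\<rparr>" using subgroup_finite_group[OF H] .
  obtain x where "x \<in> H" "x \<noteq> \<one>" "x [^]\<^bsub>G\<lparr>carrier := H\<rparr>\<^esub> p = \<one>"
    using H.ex_p_central[of p] p by auto
  then show ?thesis using that by (simp flip: nat_pow_consistent)
qed

lemma dvd_card_of_order:
  assumes "subgroup H G" "x \<in> H" "x \<noteq> \<one>" "x [^] p = \<one>" "prime (p::nat)"
  shows "p dvd card H"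
  using ord_dvd_subgroup[OF assms(1,2)] ord_prime[of x p] assms subgroup.mem_carrier by metis

end

section \<open>Nonabelian simple groups\<close>

context action
begin

text \<open>All stabilizers are trivial, so every orbit is as large as the group.\<close>

lemma semiregular_card_dvd:
  assumes "\<And>g z. g \<in> carrier G \<Longrightarrow> z \<in> X \<Longrightarrow> act g z = z \<Longrightarrow> g = \<one>"
  shows "card (carrier G) dvd card X"
proof -
  have "card (carrier G) * card (orb ` X) = card (\<Union>(orb ` X))"
  proof (rule card_partition)
    show "finite (orb ` X)" using finX by simp
    show "finite (\<Union> (orb ` X))"
      using finX orb_subset finite_subset[of "\<Union>(orb ` X)" X] by blast
    show "card c = card (carrier G)" if "c \<in> orb ` X" for c
    proof -
      obtain z where z: "z \<in> X" "c = orb z" using \<open>c \<in> orb ` X\<close> by blast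
      have "stab z = {\<one>}" using assms z act_one[OF z(1)] by (auto simp: stab_def)
      then show ?thesis using orbit_stabilizer[OF z(1)] z by simp
    qed
    show "A \<inter> B = {}" if "A \<in> orb ` X" "B \<in> orb ` X" "A \<noteq> B" for A B
      using that orb_disjoint by blast
  qed
  moreover have "\<Union>(orb ` X) = X" using orb_subset orb_self by blast
  ultimately show ?thesis by (metis dvd_triv_left)
qed

text \<open>Extended by the identity outside \<open>X\<close>, since \<open>permutes\<close> and
  \<open>sign\<close> concern functions on the whole type.\<close>

definition perm :: "'a \<Rightarrow> 'x \<Rightarrow> 'x" where "perm g z = (if z \<in> X then act g z else z)"

lemma perm_permutes:
  assumes g: "g \<in> carrier G" shows "perm g permutes X"
proof (rule bij_imp_permutes)
  show "bij_betw (perm g) X X"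
    by (rule bij_betwI[where g = "perm (inv g)"]) (use g in \<open>auto simp: perm_def act_closed act_inv\<close>)
qed (simp add: perm_def)

lemma perm_mult: "g \<in> carrier G \<Longrightarrow> h \<in> carrier G \<Longrightarrow> perm (g \<otimes> h) = perm g \<circ> perm h"
  by (auto simp: perm_def act_mult act_closed fun_eq_iff)

lemma perm_one: "perm \<one> = id"
  by (auto simp: perm_def act_one)

lemma sign_perm_mult:
  assumes "g \<in> carrier G" "h \<in> carrier G"
  shows "sign (perm (g \<otimes> h)) = sign (perm g) * sign (perm h)"
  using perm_permutes[OF assms(1)] perm_permutes[OF assms(2)] finX assms
  by (auto simp: perm_mult intro!: sign_compose simp: permutation_permutes)

lemma sign_perm_inv:
  assumes "g \<in> carrier G" shows "sign (perm (inv g)) = sign (perm g)"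
proof -
  have "sign (perm g) * sign (perm (inv g)) = 1"
    using sign_perm_mult[of g "inv g"] assms by (simp add: perm_one)
  then show ?thesis by (metis mult.left_neutral mult.right_neutral sign_left_idempotent)
qed

text \<open>The group acts by left composition on the set of all permutations of \<open>X\<close>,
  and faithfulness makes this action semiregular. This replaces an embedding into a symmetric
  group.\<close>

lemma faithful_card_dvd_fact:
  assumes "\<And>g. g \<in> carrier G \<Longrightarrow> \<forall>z\<in>X. act g z = z \<Longrightarrow> g = \<one>"
  shows "card (carrier G) dvd fact (card X)"
proof -
  interpret A: action G "{p. p permutes X}" "\<lambda>g p. perm g \<circ> p"
  proof
    show "finite {p. p permutes X}" using finX by (rule finite_permutations)
  qed (use fin in \<open>auto simp: perm_mult perm_one o_assoc intro: permutes_compose perm_permutes\<close>)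
  have "card (carrier G) dvd card {p. p permutes X}"
  proof (rule A.semiregular_card_dvd)
    fix g p assume g: "g \<in> carrier G" and p: "p \<in> {p. p permutes X}" and "perm g \<circ> p = p"
    then have e: "perm g (p z) = p z" for z by (metis comp_apply)
    have "act g z = z" if z: "z \<in> X" for z
    proof -
      have "p (Hilbert_Choice.inv p z) = z" using p permutes_inverses(1)[of p X z] by simp
      with e[of "Hilbert_Choice.inv p z"] z show ?thesis by (simp add: perm_def)
    qed
    then show "g = \<one>" using assms g by blast
  qed
  then show ?thesis using card_permutations[OF refl finX] by simp
qed

end

locale nonabelian_simple = finite_group + simple_group +
  assumes nonabelian: "\<exists>x\<in>carrier G. \<exists>y\<in>carrier G. x \<otimes> y \<noteq> y \<otimes> x"
begin

lemma normal_trivial: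
  assumes "subgroup K G" "\<And>g k. g \<in> carrier G \<Longrightarrow> k \<in> K \<Longrightarrow> conj g k \<in> K"
  shows "K = {\<one>} \<or> K = carrier G"
proof -
  have "K \<lhd> G" using assms by (auto simp: normal_inv_iff conj_def)
  then show ?thesis using no_real_normal_subgroup by blast
qed

lemma center_trivial:
  assumes z: "z \<in> carrier G" "carrier G \<subseteq> centr z" shows "z = \<one>"
proof -
  let ?K = "{z \<in> carrier G. carrier G \<subseteq> centr z}"
  have c: "z \<in> ?K \<longleftrightarrow> z \<in> carrier G \<and> (\<forall>g\<in>carrier G. g \<otimes> z = z \<otimes> g)" for z
    by (auto simp: mem_centr)
  have cc: "conj g z = z" if "z \<in> ?K" "g \<in> carrier G" for g z
    using that conj_eq_iff[of g z] unfolding c by auto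
  have "subgroup ?K G"
  proof (rule subgroupI)
    show "?K \<noteq> {}" by (auto simp: mem_centr intro!: exI[of _ \<one>])
    show "inv a \<in> ?K" if a: "a \<in> ?K" for a
    proof -
      have "g \<in> centr (inv a)" if g: "g \<in> carrier G" for g
      proof -
        have "g \<in> centr a" "a \<in> carrier G" using a g by auto
        then show ?thesis by (auto simp: mem_centr_conj conj_inv)
      qed
      then show ?thesis using a by auto
    qed
    show "a \<otimes> b \<in> ?K" if a: "a \<in> ?K" "b \<in> ?K" for a b
    proof -
      have "g \<in> centr (a \<otimes> b)" if g: "g \<in> carrier G" for g
        using cc[OF a(1) g] cc[OF a(2) g] a g by (auto simp: mem_centr_conj conj_mult)
      then show ?thesis using a by auto
    qed
  qed auto
  then have "?K = {\<one>} \<or> ?K = carrier G"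
    by (rule normal_trivial) (use cc in simp)
  moreover have "?K \<noteq> carrier G"
  proof
    assume "?K = carrier G"
    then have "\<forall>x\<in>carrier G. \<forall>y\<in>carrier G. y \<otimes> x = x \<otimes> y" using c by blast
    then show False using nonabelian by metis
  qed
  ultimately show ?thesis using z by blast
qed

text \<open>Conjugation permutes the generators, so the subgroup generated by a class is normal, and
  simplicity applies.\<close>

lemma cls_generates:
  assumes x: "x \<in> carrier G" "x \<noteq> \<one>" and K: "subgroup K G" "cls x \<subseteq> K"
  shows "K = carrier G"
proof -
  have sub: "cls x \<subseteq> carrier G" using cls_carrier[OF x(1)] .
  have H: "subgroup (generate G (cls x)) G" using generate_is_subgroup[OF sub] .
  have "conj g k \<in> generate G (cls x)" if g: "g \<in> carrier G" and k: "k \<in> generate G (cls x)" for g k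
    using k
  proof induction
    case one then show ?case using g by (simp add: generate.one)
  next
    case (incl h) then show ?case using conj_mem_cls[OF g x(1)] by (simp add: generate.incl)
  next
    case (inv h)
    then have "inv (conj g h) \<in> generate G (cls x)" using conj_mem_cls[OF g x(1)] by (blast intro: generate.inv)
    then show ?case using inv sub g by (auto simp: conj_inv)
  next
    case (eng h1 h2)
    then show ?case using g generate_in_carrier[OF sub] by (simp add: conj_mult generate.eng)
  qed
  from normal_trivial[OF H this] have "generate G (cls x) = {\<one>} \<or> generate G (cls x) = carrier G" by blast
  moreover have "generate G (cls x) \<noteq> {\<one>}"
    using generate.incl[OF cls_self[OF x(1)], of G] x(2) by auto
  ultimately have "generate G (cls x) = carrier G" by blast
  moreover have "generate G (cls x) \<subseteq> K" using generate_subgroup_incl[OF K(2,1)] .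
  ultimately show ?thesis using subgroup.subset[OF K(1)] by blast
qed

lemma centralizes_cls:
  assumes x: "x \<in> carrier G" "x \<noteq> \<one>" and g: "g \<in> carrier G" "cls x \<subseteq> centr g"
  shows "g = \<one>"
  using cls_generates[OF x centr_subgroup[OF g(1)] g(2)] center_trivial[OF g(1)] by auto

lemma centralizes_cls':
  assumes x: "x \<in> carrier G" "x \<noteq> \<one>" and g: "g \<in> carrier G" "\<And>y. y \<in> cls x \<Longrightarrow> g \<in> centr y"
  shows "g = \<one>"
  using centralizes_cls[OF x g(1)] g cls_carrier[OF x(1)] by (auto simp: mem_centr subset_iff)

lemma card_cls_neq_1:
  assumes x: "x \<in> carrier G" "x \<noteq> \<one>" shows "card (cls x) \<noteq> 1"
proof
  assume "card (cls x) = 1"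
  then have "card (centr x) = card (carrier G)" using cls_centr[OF x(1)] by simp
  then have "centr x = carrier G" using centr_carrier fin card_subset_eq by metis
  then show False using center_trivial[OF x(1)] x(2) by simp
qed

text \<open>A nontrivial element whose class size is prime to \<open>p\<close> would have class size
  1 in a \<open>p\<close>-group, hence be central.\<close>

lemma not_p_group: 
  assumes p: "prime p" shows "card (carrier G) \<noteq> p ^ k"
proof
  assume c: "card (carrier G) = p ^ k"
  have "k \<noteq> 0" using c order_gt_one by (cases k) (auto simp: Coset.order_def)
  then have "p dvd card (carrier G)" using c by (cases k) auto
  then obtain x where x: "x \<in> carrier G" "x \<noteq> \<one>" "\<not> p dvd card (cls x)"
    using ex_p_central[OF p] by metis
  obtain j where "card (cls x) = p ^ j" using cls_dvd[OF x(1)] c divides_primepow_nat[OF p] by metis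
  with x(3) have "card (cls x) = 1" by (cases j) auto
  then show False using card_cls_neq_1 x by blast
qed

text \<open>A single moved point suffices, because the kernel of the action is a normal
  subgroup.\<close>

lemma action_faithful:
  assumes "action G X act" and g0: "g0 \<in> carrier G" "z0 \<in> X" "act g0 z0 \<noteq> z0"
    and g: "g \<in> carrier G" "\<forall>z\<in>X. act g z = z"
  shows "g = \<one>"
proof -
  interpret A: action G X act by fact
  let ?K = "{g \<in> carrier G. \<forall>z\<in>X. act g z = z}"
  have "subgroup ?K G"
  proof (rule subgroupI)
    show "?K \<noteq> {}" using A.act_one by (auto intro!: exI[of _ \<one>])
    show "inv a \<in> ?K" if a: "a \<in> ?K" for a
    proof -
      have "act (inv a) z = z" if "z \<in> X" for z
        using A.act_inv(1)[of a z] a that by auto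
      then show ?thesis using a by auto
    qed
  qed (auto simp: A.act_mult)
  then have "?K = {\<one>} \<or> ?K = carrier G"
  proof (rule normal_trivial)
    fix h k assume h: "h \<in> carrier G" and k: "k \<in> ?K"
    have "act (conj h k) z = z" if "z \<in> X" for z
      using h k that A.act_inv(2)[of h z] by (simp add: conj_def A.act_mult A.act_closed)
    then show "conj h k \<in> ?K" using h k by auto
  qed
  then show ?thesis using g0 g by blast
qed

lemma action_card_dvd_fact:
  assumes "action G X act" and g0: "g0 \<in> carrier G" "z0 \<in> X" "act g0 z0 \<noteq> z0"
  shows "card (carrier G) dvd fact (card X)"
  using action.faithful_card_dvd_fact[OF assms(1)] action_faithful[OF assms] by blast

text \<open>The elements that act as even permutations form a normal subgroup containing all
  commutators, so in a nonabelian simple group every element acts evenly. An element of square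
  \<open>\<one>\<close> then has an even number of 2-cycles.\<close>

lemma involution_moves_four:
  assumes "action G X act" and w: "w \<in> carrier G" "w \<otimes> w = \<one>"
  shows "4 dvd card {z \<in> X. act w z \<noteq> z}"
proof -
  interpret A: action G X act by fact
  let ?K = "{g \<in> carrier G. sign (A.perm g) = 1}"
  have "subgroup ?K G"
  proof (rule subgroupI)
    show "?K \<noteq> {}" using A.perm_one by (auto intro!: exI[of _ \<one>])
  qed (auto simp: A.sign_perm_mult A.sign_perm_inv)
  then have "?K = {\<one>} \<or> ?K = carrier G"
    by (rule normal_trivial) (auto simp: conj_def A.sign_perm_mult A.sign_perm_inv)
  moreover have "?K \<noteq> {\<one>}"
  proof
    assume K: "?K = {\<one>}"
    obtain x y where xy: "x \<in> carrier G" "y \<in> carrier G" "x \<otimes> y \<noteq> y \<otimes> x" using nonabelian by blast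
    have "x \<otimes> y \<otimes> inv (y \<otimes> x) \<in> ?K"
      using xy by (simp add: A.sign_perm_mult A.sign_perm_inv inv_mult_group) (metis mult.left_commute mult.right_neutral sign_idempotent)
    then have "x \<otimes> y \<otimes> inv (y \<otimes> x) = \<one>" using K by blast
    then show False using xy by (metis inv_equality inv_inv inv_closed m_closed)
  qed
  ultimately have s: "sign (A.perm w) = 1" using w by blast
  have pp: "A.perm w (A.perm w z) = z" for z
    using A.perm_mult[OF w(1) w(1)] w A.perm_one by (metis comp_apply id_apply)
  have e: "{z. A.perm w z \<noteq> z} = {z \<in> X. act w z \<noteq> z}" by (auto simp: A.perm_def)
  from involution_sign[OF A.finX A.perm_permutes[OF w(1)] pp] s
  have ev: "even (card {z \<in> X. act w z \<noteq> z})" and "(-1) ^ (card {z \<in> X. act w z \<noteq> z} div 2) = (1::int)"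
    by (simp_all add: e)
  then have "even (card {z \<in> X. act w z \<noteq> z} div 2)" 
    by (metis one_neq_neg_one power_minus_odd power_one)
  with ev show ?thesis by presburger
qed

lemma cls_action: "x \<in> carrier G \<Longrightarrow> action G (cls x) conj"
proof unfold_locales
  assume x: "x \<in> carrier G"
  show "conj (g \<otimes> h) z = conj g (conj h z)" if "g \<in> carrier G" "h \<in> carrier G" "z \<in> cls x" for g h z
    using that cls_carrier[OF x] by (auto simp: conj_conj)
  show "conj \<one> z = z" if "z \<in> cls x" for z
    using that cls_carrier[OF x] by auto
qed (use fin in \<open>auto simp: conj_mem_cls\<close>)

lemma involution_moves_four_cls:
  assumes x: "x \<in> carrier G" and w: "w \<in> carrier G" "w \<otimes> w = \<one>"
  shows "4 dvd card (cls x - centr w)"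
proof -
  have "{z \<in> cls x. conj w z \<noteq> z} = cls x - centr w"
    using w cls_carrier[OF x] by (auto simp: mem_centr conj_eq_iff)
  then show ?thesis using involution_moves_four[OF cls_action[OF x] w] by simp
qed

lemma card_dvd_fact_cls:
  assumes x: "x \<in> carrier G" "x \<noteq> \<one>"
  shows "card (carrier G) dvd fact (card (cls x))"
proof -
  obtain g where g: "g \<in> carrier G" "g \<notin> centr x" using center_trivial x by blast
  then have "conj g x \<noteq> x" using x by (simp add: mem_centr_conj)
  then show ?thesis using action_card_dvd_fact[OF cls_action[OF x(1)] g(1) cls_self[OF x(1)]] by blast
qed

text \<open>If \<open>V\<close> and its complement in a class commute elementwise, then the subgroup centralizing
  the complement is normalized by the whole class.\<close>

lemma cls_connected:
  assumes x: "x \<in> carrier G" "x \<noteq> \<one>" and V: "V \<subseteq> cls x" "V \<noteq> {}"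
    and c: "\<And>v w. v \<in> V \<Longrightarrow> w \<in> cls x - V \<Longrightarrow> v \<in> centr w"
  shows "V = cls x"
proof (rule ccontr)
  assume ne: "V \<noteq> cls x"
  then obtain w where w: "w \<in> cls x - V" using V by blast
  obtain v where v: "v \<in> V" using V by blast
  have D: "cls x \<subseteq> carrier G" using cls_carrier[OF x(1)] .
  define A where "A = {g \<in> carrier G. \<forall>u\<in>cls x - V. g \<in> centr u}"
  \<comment> \<open>Requiring the condition for \<open>inv g\<close> too makes closure under
    inverses immediate.\<close>
  define N where "N = {g \<in> carrier G. (\<forall>a\<in>A. conj g a \<in> A) \<and> (\<forall>a\<in>A. conj (inv g) a \<in> A)}"
  have AG: "A \<subseteq> carrier G" by (auto simp: A_def)
  have A: "subgroup A G"
  proof (rule subgroupI)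
    show "A \<noteq> {}" using D by (auto simp: A_def mem_centr subset_iff intro!: exI[of _ \<one>])
    show "inv a \<in> A" if a: "a \<in> A" for a
    proof -
      have "inv a \<in> centr u" if u: "u \<in> cls x - V" for u
        by (rule subgroup.m_inv_closed[OF centr_subgroup]) (use a u D in \<open>auto simp: A_def\<close>)
      then show ?thesis using a by (auto simp: A_def)
    qed
    show "a \<otimes> b \<in> A" if a: "a \<in> A" "b \<in> A" for a b
    proof -
      have "a \<otimes> b \<in> centr u" if u: "u \<in> cls x - V" for u
        by (rule subgroup.m_closed[OF centr_subgroup]) (use a u D in \<open>auto simp: A_def\<close>)
      then show ?thesis using a by (auto simp: A_def)
    qed
  qed (rule AG)
  have N: "subgroup N G"
  proof (rule subgroupI)
    show "N \<noteq> {}" using AG by (auto simp: N_def subset_iff intro!: exI[of _ \<one>])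
    show "g \<otimes> h \<in> N" if gh: "g \<in> N" "h \<in> N" for g h
    proof -
      have G: "g \<in> carrier G" "h \<in> carrier G" using gh by (auto simp: N_def)
      have "conj (g \<otimes> h) a \<in> A \<and> conj (inv (g \<otimes> h)) a \<in> A" if a: "a \<in> A" for a
      proof -
        have aG: "a \<in> carrier G" using a AG by blast
        have "conj (g \<otimes> h) a = conj g (conj h a)"
          "conj (inv (g \<otimes> h)) a = conj (inv h) (conj (inv g) a)"
          using G aG by (simp_all add: conj_conj inv_mult_group)
        then show ?thesis using gh a unfolding N_def by simp
      qed
      then show ?thesis using G by (simp add: N_def)
    qed
  qed (auto simp: N_def)
  \<comment> \<open>A point of \<open>V\<close> normalizes \<open>A\<close> because it belongs to
    \<open>A\<close>; any other point of the class does so because it centralizes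
    \<open>A\<close>.\<close>
  have "u \<in> N" if u: "u \<in> cls x" for u
  proof (cases "u \<in> V")
    case True
    have uG: "u \<in> carrier G" using u D by blast
    have uA: "u \<in> A" using c[OF True] uG by (simp add: A_def)
    have iA: "inv u \<in> A" using subgroup.m_inv_closed[OF A uA] .
    show ?thesis using uG uA iA subgroup.m_closed[OF A] by (simp add: N_def conj_def)
  next
    case False
    have uG: "u \<in> carrier G" using u D by blast
    have "conj u a = a" if "a \<in> A" for a
      using that False u uG by (auto simp: A_def mem_centr conj_eq_iff)
    moreover from this have "conj (inv u) a = a" if "a \<in> A" for a
      using that conj_inv_conj(1)[OF uG, of a] AG by auto
    ultimately show ?thesis using uG by (simp add: N_def)
  qed
  then have "N = carrier G" using cls_generates[OF x N] by blast
  then have "conj g a \<in> A" if "g \<in> carrier G" "a \<in> A" for g a using that by (auto simp: N_def)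
  with normal_trivial[OF A] have "A = {\<one>} \<or> A = carrier G" by blast
  moreover have "v \<in> A" using c[OF v] v V D by (auto simp: A_def)
  moreover have "v \<noteq> \<one>"
  proof
    assume "v = \<one>"
    then have "cls x = {\<one>}" using cls_eq[OF x(1), of v] v V by auto
    then show False using cls_self[OF x(1)] x(2) by simp
  qed
  ultimately have "A = carrier G" by blast
  then have "carrier G \<subseteq> centr w" using w by (auto simp: A_def)
  then have "w = \<one>" using center_trivial w D by blast
  then have "cls x = {\<one>}" using cls_eq[OF x(1), of w] w by auto
  then show False using cls_self[OF x(1)] x(2) by simp
qed

lemma cls_not_one: "x \<in> carrier G \<Longrightarrow> x \<noteq> \<one> \<Longrightarrow> y \<in> cls x \<Longrightarrow> y \<noteq> \<one>"
  using cls_eq[of x y] cls_self[of x] by auto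

text \<open>The fibres of \<open>h\<close> are blocks for the transitive action by conjugation on
  the class, so they all have the size of the fibre through \<open>x\<close>.\<close>

lemma invariant_partition:
  assumes x: "x \<in> carrier G"
    and h: "\<And>g y z. g \<in> carrier G \<Longrightarrow> y \<in> cls x \<Longrightarrow> z \<in> cls x \<Longrightarrow> h y = h z \<Longrightarrow> h (conj g y) = h (conj g z)"
  shows "card {z \<in> cls x. h z = h x} * card (h ` cls x) = card (cls x)"
proof -
  let ?B = "\<lambda>v. {z \<in> cls x. h z = v}"
  have D: "cls x \<subseteq> carrier G" using cls_carrier[OF x] .
  have inj: "inj_on ?B (h ` cls x)"
    by (rule inj_onI) blast
  have "card (?B (h x)) * card (?B ` h ` cls x) = card (\<Union>(?B ` h ` cls x))"
  proof (rule card_partition)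
    show "card c = card (?B (h x))" if cc: "c \<in> ?B ` h ` cls x" for c
    proof -
      obtain y where y: "y \<in> cls x" "c = ?B (h y)" using cc by auto
      obtain g where g: "g \<in> carrier G" "y = conj g x" using y by (auto simp: cls_def)
      have "bij_betw (conj g) (?B (h x)) (?B (h y))"
      proof (rule bij_betwI[where g = "conj (inv g)"])
        show "conj g \<in> ?B (h x) \<rightarrow> ?B (h y)"
          using g h[OF g(1) _ cls_self[OF x]] x by (auto simp: conj_mem_cls)
        show "conj (inv g) \<in> ?B (h y) \<rightarrow> ?B (h x)"
          using g h[OF _ _ y(1), of "inv g"] x by (auto simp: conj_mem_cls)
      qed (use g D in auto)
      then show ?thesis using y bij_betw_same_card by metis
    qed
  qed (use x in auto)
  moreover have "\<Union>(?B ` h ` cls x) = cls x" by auto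
  ultimately show ?thesis using card_image[OF inj] by simp
qed

end

section \<open>Conjugacy classes of elements of prime order\<close>

lemma prime_power_of_unique_prime:
  assumes "(m::nat) > 0" "prime q" "\<And>r. prime r \<Longrightarrow> r dvd m \<Longrightarrow> r = q"
  obtains k where "m = q ^ k"
proof -
  let ?k = "multiplicity q m"
  have d: "q ^ ?k dvd m" by (rule multiplicity_dvd)
  have nd: "\<not> q dvd m div q ^ ?k"
    by (rule multiplicity_decompose) (use assms not_prime_unit in auto)
  have "m div q ^ ?k = 1"
  proof (rule ccontr)
    assume "m div q ^ ?k \<noteq> 1"
    then obtain r where r: "prime r" "r dvd m div q ^ ?k" using prime_factor_nat by blast
    then have "r dvd m" using d by (metis dvd_div_mult_self dvd_mult2)
    then show False using assms(3) r nd by blast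
  qed
  then have "m = q ^ ?k" using d by (metis dvd_div_mult_self mult_1)
  then show ?thesis using that by blast
qed

locale prime_class = nonabelian_simple +
  fixes x :: 'a and p :: nat
  assumes x [simp]: "x \<in> carrier G" "x \<noteq> \<one>" and xp: "x [^] p = \<one>" and p: "prime p"
begin

abbreviation D where "D \<equiv> cls x"
text \<open>Acting on its class \<open>D\<close> by conjugation, \<open>x\<close> has \<open>f\<close> fixed points and \<open>t\<close> cycles of length \<open>p\<close>.\<close>

definition F where "F y = D \<inter> centr y"
definition N where "N y = D - centr y"
definition f where "f = card (F x)"
definition t where "t = card (N x) div p"

lemma DG: "y \<in> D \<Longrightarrow> y \<in> carrier G"
  using cls_carrier[OF x(1)] by blast

lemma D_facts:
  assumes "y \<in> D" shows "y \<noteq> \<one>" "y [^] p = \<one>" "cls y = D"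
  using cls_not_one[OF x assms] cls_eq[OF x(1) assms] assms xp by (auto simp: cls_def simp flip: conj_pow)

lemma finD [simp]: "finite D" "finite (F y)" "finite (N y)"
  by (simp_all add: F_def N_def)

lemma self_D [simp]: "x \<in> D" by (simp add: cls_self)

lemma D_conj: "g \<in> carrier G \<Longrightarrow> y \<in> D \<Longrightarrow> conj g y \<in> D"
  using conj_mem_cls x(1) by blast

lemma F_sym: "y \<in> D \<Longrightarrow> z \<in> F y \<Longrightarrow> y \<in> F z"
  by (auto simp: F_def mem_centr DG)

lemma F_self: "y \<in> D \<Longrightarrow> y \<in> F y"
  by (auto simp: F_def mem_centr DG)

lemma FD: "F y \<subseteq> D" and ND: "N y \<subseteq> D" and FN: "F y \<union> N y = D" and FNd: "F y \<inter> N y = {}"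
  by (auto simp: F_def N_def)

lemma N_iff: "z \<in> D \<Longrightarrow> z \<in> N y \<longleftrightarrow> z \<notin> F y" 
  by (auto simp: F_def N_def)

lemma N_sym: "y \<in> D \<Longrightarrow> z \<in> N y \<Longrightarrow> y \<in> N z"
  by (auto simp: N_def mem_centr DG)

lemma F_conj:
  assumes g: "g \<in> carrier G" and y: "y \<in> D" shows "F (conj g y) = conj g ` F y"
proof -
  have "conj g ` D = D"
    using D_conj[OF g] D_conj[of "inv g"] g conj_inv_conj(2)[OF g DG] by (force simp: image_iff)
  then have "F (conj g y) = conj g ` D \<inter> conj g ` centr y"
    using centr_conj[OF g DG[OF y]] by (simp add: F_def)
  also have "\<dots> = conj g ` (D \<inter> centr y)"
    by (rule inj_on_image_Int[symmetric, of _ "carrier G"])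
       (use g DG centr_carrier in \<open>auto intro!: inj_onI\<close>)
  finally show ?thesis by (simp add: F_def)
qed

lemma conj_F_iff: "g \<in> carrier G \<Longrightarrow> y \<in> D \<Longrightarrow> z \<in> D \<Longrightarrow> conj g z \<in> F (conj g y) \<longleftrightarrow> z \<in> F y"
  using D_conj conj_mem_centr_iff DG by (simp add: F_def)

lemma D_obtain: 
  assumes "y \<in> D" obtains g where "g \<in> carrier G" "y = conj g x"
  using assms by (auto simp: cls_def)

lemma card_F: "y \<in> D \<Longrightarrow> card (F y) = f"
proof -
  assume y: "y \<in> D"
  obtain g where g: "g \<in> carrier G" "y = conj g x" using D_obtain[OF y] .
  have "F x \<subseteq> carrier G" using FD DG by blast
  then have "inj_on (conj g) (F x)" using g by (auto intro!: inj_onI simp: subset_iff)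
  then show ?thesis using g F_conj[OF g(1) self_D] by (simp add: f_def card_image)
qed

lemma card_FN: "card (F y) + card (N y) = card D"
  using card_Un_disjoint[of "F y" "N y"] FN FNd by simp

text \<open>Conjugation by \<open>y\<close> permutes \<open>A - centr y\<close> without fixed
  points, hence in cycles of length \<open>q\<close>.\<close>

lemma moved_dvd:
  assumes y: "y \<in> carrier G" "y [^] q = \<one>" "prime q"
    and A: "A \<subseteq> carrier G" "\<And>z. z \<in> A \<Longrightarrow> conj y z \<in> A"
  shows "q dvd card (A - centr y)"
proof -
  have inv: "conj y z \<in> A - centr y" if "z \<in> A - centr y" for z
  proof -
    have "conj y z \<in> centr y \<longleftrightarrow> z \<in> centr y"
      using conj_mem_centr_iff[of y z y] y that A by (auto simp: conj_eq_iff[THEN iffD2])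
    then show ?thesis using that A by blast
  qed
  have "card (A - centr y) mod q = card ((A - centr y) \<inter> centr y) mod q"
    by (rule order_p_fixed_points[OF y]) (use A inv in auto)
  moreover have "(A - centr y) \<inter> centr y = {}" by blast
  ultimately show ?thesis by (simp add: dvd_eq_mod_eq_0)
qed

lemma card_N: "y \<in> D \<Longrightarrow> card (N y) = p * t"
proof -
  assume y: "y \<in> D"
  have "p dvd card (N x)"
    unfolding N_def by (rule moved_dvd[OF x(1) xp p]) (use DG D_conj in auto)
  then have "card (N x) = p * t" by (simp add: t_def)
  then show ?thesis using card_FN[of x] card_FN[of y] card_F[OF y] card_F[OF self_D] by simp
qed

lemma card_D: "card D = f + p * t"
  using card_FN[of x] card_N card_F by simp

lemma f_pos: "f > 0"
  using F_self[OF self_D] by (auto simp: f_def card_gt_0_iff)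

lemma centr_invariant:
  assumes "g \<in> centr y" "y \<in> D" "z \<in> F y" shows "conj g z \<in> F y"
proof -
  have g: "g \<in> carrier G" "conj g y = y" using assms DG by (auto simp: mem_centr_conj)
  then show ?thesis using conj_F_iff[OF g(1) assms(2), of z] assms FD by auto
qed

lemma centr_invariant_N:
  assumes "g \<in> centr y" "y \<in> D" "z \<in> N y" shows "conj g z \<in> N y"
proof -
  have g: "g \<in> carrier G" "conj g y = y" using assms DG by (auto simp: mem_centr_conj)
  have z: "z \<in> D" using assms ND by auto
  then show ?thesis using conj_F_iff[OF g(1) assms(2) z] assms g N_iff D_conj by auto
qed

text \<open>\<open>V\<close> is closed under passing to noncommuting elements of \<open>D\<close>.
  By \<open>cls_connected\<close> the noncommuting relation on \<open>D\<close> is connected, so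
  \<open>V = D\<close>, and \<open>v\<close> centralizes a whole class.\<close>

lemma commutant_propagates:
  assumes v: "v \<in> carrier G" and V: "V \<subseteq> D" "V \<noteq> {}" "\<And>y. y \<in> V \<Longrightarrow> v \<in> centr y"
    and N: "\<And>y z. y \<in> V \<Longrightarrow> z \<in> N y \<Longrightarrow> z \<in> V"
  shows "v = \<one>"
proof -
  have "V = D"
  proof (rule cls_connected[OF x V(1,2)])
    fix y w assume "y \<in> V" "w \<in> D - V"
    then have "y \<in> V" "w \<in> centr y" using N[of y w] by (auto simp: N_def)
    then show "y \<in> centr w" using V(1) DG by (auto simp: mem_centr)
  qed
  then show ?thesis using centralizes_cls'[OF x v] V(3) by blast
qed

text \<open>\<open>y\<close> and \<open>v\<close> commute, so both permute the points of
  \<open>N y\<close> that \<open>v\<close> moves. Neither fixes such a point: \<open>y\<close> fixes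
  nothing in \<open>N y\<close>, and \<open>v\<close> moves these points by choice.\<close>

lemma moved_N_dvd:
  assumes y: "y \<in> D" and v: "v \<in> centr y" and q: "v [^] q = \<one>" "prime q"
  shows "p dvd card (N y - centr v)" "q dvd card (N y - centr v)"
proof -
  have G: "v \<in> carrier G" "y \<in> carrier G" using v y DG by (auto simp: mem_centr)
  have NG: "N y \<subseteq> carrier G" using ND DG by blast
  show "q dvd card (N y - centr v)"
    by (rule moved_dvd[OF G(1) q NG]) (use centr_invariant_N v y in auto)
  have "conj y z \<in> N y - centr v" if z: "z \<in> N y - centr v" for z
  proof -
    have "conj y v = v" using v G by (auto simp: mem_centr conj_eq_iff)
    then have "conj y z \<in> centr v \<longleftrightarrow> z \<in> centr v"
      using conj_mem_centr_iff[of y z v] G z NG by auto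
    moreover have "conj y z \<in> N y" using centr_invariant_N[OF _ y] z G by (auto simp: mem_centr)
    ultimately show ?thesis using z by blast
  qed
  then have "p dvd card (N y - centr v - centr y)"
    by (intro moved_dvd[OF G(2) D_facts(2)[OF y] p]) (use NG in auto)
  moreover have "N y - centr v - centr y = N y - centr v" by (auto simp: N_def)
  ultimately show "p dvd card (N y - centr v)" by simp
qed

text \<open>An element of \<open>centr x\<close> of prime order \<open>q \<noteq> p\<close> permutes the \<open>t\<close> cycles of \<open>x\<close>.\<close>

lemma prime_dvd_centr:
  assumes q: "prime q" "q dvd card (centr x)" shows "q = p \<or> q \<le> t"
proof (rule ccontr)
  assume c: "\<not> (q = p \<or> q \<le> t)"
  obtain v where v: "v \<in> centr x" "v \<noteq> \<one>" "v [^] q = \<one>"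
    using cauchy[OF centr_subgroup[OF x(1)] q] by metis
  have "v = \<one>"
  proof (rule commutant_propagates[where V = "{y \<in> D. v \<in> centr y}"])
    fix y z assume y: "y \<in> {y \<in> D. v \<in> centr y}" and z: "z \<in> N y"
    have vG: "v \<in> carrier G" using v by (simp add: mem_centr)
    \<comment> \<open>The number of moved points is a multiple of \<open>p * q\<close> but at most
      \<open>p * t\<close>, which is smaller. So \<open>v\<close> centralizes all of
      \<open>N y\<close>, and the property spreads through \<open>D\<close>.\<close>
    have "p * q dvd card (N y - centr v)"
      using moved_N_dvd[of y v q] y v q c p by (intro divides_mult) (auto simp: primes_coprime)
    moreover have "card (N y - centr v) < p * q"
    proof -
      have "card (N y - centr v) \<le> p * t" using card_mono[OF finD(3)[of y], of "N y - centr v"] card_N[of y] y by auto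
      also have "\<dots> < p * q" using c p prime_gt_0_nat by auto
      finally show ?thesis .
    qed
    ultimately have "card (N y - centr v) = 0" by (meson nat_dvd_not_less not_gr0)
    then have "z \<in> centr v" using z by auto
    then show "z \<in> {y \<in> D. v \<in> centr y}" using z ND vG by (auto simp: mem_centr)
  next
    show "{y \<in> D. v \<in> centr y} \<noteq> {}" using v(1) self_D by blast
  qed (use v in \<open>auto simp: mem_centr\<close>)
  then show False using v by blast
qed

lemma t_pos: "t > 0"
proof (rule ccontr)
  assume "\<not> t > 0"
  then have "N x = {}" using card_N[OF self_D] by auto
  then have "D \<subseteq> centr x" by (auto simp: N_def)
  then show False using centralizes_cls[OF x x(1)] by simp
qed

lemma p_dvd_centr: "p dvd card (centr x)"
  using dvd_card_of_order[OF centr_subgroup[OF x(1)] _ x(2) xp p] by (simp add: mem_centr)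

text \<open>\<open>x\<close> acts as an even permutation and moves exactly the \<open>2 * t\<close>
  points of \<open>N x\<close>.\<close>

lemma involution_t_even: assumes "p = 2" shows "even t"
proof -
  have "x \<otimes> x = \<one>" using xp assms by (simp add: numeral_2_eq_2)
  then have "4 dvd card (N x)" using involution_moves_four_cls[OF x(1) x(1)] by (simp add: N_def)
  then show ?thesis using card_N[OF self_D] assms by (auto elim!: dvdE)
qed

text \<open>\<open>a\<close> permutes \<open>F y\<close> and fixes both \<open>a\<close> and
  \<open>y\<close>; the other \<open>f - 2 < p\<close> points leave no room for a cycle of length
  \<open>p\<close>. So for small \<open>f\<close> commuting is an equivalence relation on
  \<open>D\<close>.\<close>

lemma F_blocks:
  assumes "f < p + 2" "y \<in> D" "a \<in> F y" shows "F a = F y"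
proof -
  have aD: "a \<in> D" using assms FD by blast
  have "F y \<subseteq> F a"
  proof (cases "a = y")
    case False
    have "p dvd card (F y - centr a)"
    proof (rule moved_dvd[OF DG[OF aD] D_facts(2)[OF aD] p])
      show "F y \<subseteq> carrier G" using FD DG by blast
      show "conj a z \<in> F y" if "z \<in> F y" for z
        using centr_invariant[OF _ assms(2) that] assms(3) by (auto simp: F_def)
    qed
    moreover have "card (F y - centr a) < p"
    proof -
      have sub: "{a, y} \<subseteq> F y" using assms F_self by auto
      have "F y - centr a \<subseteq> F y - {a, y}" using aD assms DG by (auto simp: F_def mem_centr)
      then have "card (F y - centr a) \<le> card (F y - {a, y})" by (intro card_mono) auto
      also have "\<dots> = f - 2" using card_Diff_subset[OF _ sub] card_F[OF assms(2)] False by simp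
      finally show ?thesis using assms(1) prime_gt_1_nat[OF p] by linarith
    qed
    ultimately have "card (F y - centr a) = 0" by (meson nat_dvd_not_less not_gr0)
    then show ?thesis using FD by (auto simp: F_def)
  qed simp
  then show ?thesis using card_F[OF aD] card_F[OF assms(2)] by (metis card_subset_eq finD(2))
qed

lemma F_image: 
  assumes "g \<in> carrier G" "y \<in> D" "z \<in> D" "F y = F z" shows "F (conj g y) = F (conj g z)"
  using F_conj assms by simp

lemma card_blocks:
  assumes "f < p + 2" shows "f * card (F ` D) = card D"
proof -
  have e: "{z \<in> D. F z = F x} = F x"
  proof
    show "{z \<in> D. F z = F x} \<subseteq> F x" using F_self by blast
    show "F x \<subseteq> {z \<in> D. F z = F x}" using F_blocks[OF assms self_D] FD by blast
  qed
  have "card {z \<in> D. F z = F x} * card (F ` D) = card D"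
    by (rule invariant_partition[OF x(1)]) (rule F_image)
  then show ?thesis unfolding e f_def .
qed

text \<open>\<open>G\<close> permutes the blocks \<open>F y\<close>. As \<open>t > 0\<close> there
  is a second block, so the action is not trivial and hence faithful.\<close>

lemma blocks_fact:
  assumes "f < p + 2"
  shows "card (carrier G) dvd fact (card (F ` D))"
proof -
  have act: "action G (F ` D) (\<lambda>g A. conj g ` A)"
  proof unfold_locales
    fix g h z assume "g \<in> carrier G" "z \<in> F ` D"
    then obtain y where y: "y \<in> D" "z = F y" by blast
    then have "conj g ` z = F (conj g y)" using F_conj \<open>g \<in> carrier G\<close> by simp
    then show "conj g ` z \<in> F ` D" using D_conj[OF \<open>g \<in> carrier G\<close> y(1)] by blast
    assume "h \<in> carrier G"
    moreover have "z \<subseteq> carrier G" using \<open>z \<in> F ` D\<close> FD DG by auto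
    ultimately show "conj (g \<otimes> h) ` z = conj g ` conj h ` z"
      using \<open>g \<in> carrier G\<close> by (auto simp: image_image conj_conj subset_iff intro!: image_cong)
  next
    fix z assume "z \<in> F ` D"
    then have "z \<subseteq> carrier G" using FD DG by auto
    then show "conj \<one> ` z = z" by (auto simp: subset_iff image_iff) 
  qed (use fin in auto)
  have "card (N x) > 0" using t_pos card_N[OF self_D] prime_gt_0_nat[OF p] by simp
  then obtain y where y: "y \<in> N x" by (metis all_not_in_conv card.empty less_irrefl)
  then have yD: "y \<in> D" using ND by auto
  obtain g where g: "g \<in> carrier G" "y = conj g x" using D_obtain[OF yD] .
  have "F y \<noteq> F x" using y F_self[OF yD] FNd by auto
  then have "conj g ` F x \<noteq> F x" using F_conj[OF g(1) self_D] g by simp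
  then show ?thesis using action_card_dvd_fact[OF act g(1), of "F x"] by simp
qed

text \<open>If \<open>F x = {x, y}\<close>, then \<open>x \<otimes> y\<close> is centralized by \<open>centr x\<close> and by an element that swaps \<open>x\<close> and \<open>y\<close>.\<close>

lemma involution_pair:
  assumes "p = 2" "f = 2"
  shows "\<exists>w\<in>carrier G. w \<noteq> \<one> \<and> card (cls w) < card D"
proof -
  have xx: "x \<otimes> x = \<one>" using xp assms by (simp add: numeral_2_eq_2)
  have "card (F x - {x}) = 1" using assms F_self[OF self_D] by (simp add: f_def)
  then obtain y where y: "F x - {x} = {y}" by (auto simp: card_1_singleton_iff)
  then have Fx: "F x = {x, y}" "y \<noteq> x" using F_self[OF self_D] by auto
  have yD: "y \<in> D" using Fx FD by auto
  have yG: "y \<in> carrier G" using DG[OF yD] .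
  have com: "x \<otimes> y = y \<otimes> x" using Fx by (auto simp: F_def mem_centr)
  have Fy: "F y = {x, y}" using F_blocks[of x y] assms Fx by auto
  let ?w = "x \<otimes> y"
  have wG: "?w \<in> carrier G" using yG by simp
  have sub: "centr x \<subseteq> centr ?w"
  proof
    fix g assume g: "g \<in> centr x"
    have gG: "g \<in> carrier G" "conj g x = x" using g by (auto simp: mem_centr_conj)
    have "conj g y \<in> {x, y}" using centr_invariant[OF g self_D, of y] Fx by auto
    moreover have "conj g y \<noteq> x" using conj_inject[OF gG(1) yG x(1)] gG Fx by auto
    ultimately have "conj g ?w = ?w" using gG yG by (simp add: conj_mult)
    then show "g \<in> centr ?w" using gG wG by (simp add: mem_centr_conj)
  qed
  obtain g where g: "g \<in> carrier G" "y = conj g x" using D_obtain[OF yD] .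
  have "conj g y \<in> F (conj g x)" using F_conj[OF g(1) self_D] Fx by auto
  then have "conj g y \<in> {x, y}" using g Fy by simp
  moreover have "conj g y \<noteq> y" using conj_inject[OF g(1) yG x(1)] g Fx by auto
  ultimately have "conj g y = x" by blast
  then have "conj g ?w = ?w" using g yG com by (simp add: conj_mult)
  then have "g \<in> centr ?w" using g wG by (simp add: mem_centr_conj)
  moreover have "g \<notin> centr x" using g Fx by (auto simp: mem_centr_conj)
  ultimately have "card (centr x) < card (centr ?w)" using sub by (intro psubset_card_mono) auto
  then have "card (cls ?w) < card D"
    using cls_centr[OF wG] cls_centr[OF x(1)] card_cls_pos[OF wG]
      mult_le_less_imp_less[of "card D" "card (cls ?w)" "card (centr x)" "card (centr ?w)"]
      card_cls_pos[OF x(1)] by fastforce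
  moreover have "?w \<noteq> \<one>"
  proof
    assume "?w = \<one>"
    then have "y = x" using xx yG by (metis Units_eq Units_l_cancel x(1))
    then show False using Fx by simp
  qed
  ultimately show ?thesis using wG by blast
qed

text \<open>As \<open>F y = {y}\<close>, all points moved by \<open>w\<close> lie in
  \<open>N y\<close>. Their number is divisible by \<open>p\<close> because of the cycles of
  \<open>y\<close> and by 4 by parity, but it is at most \<open>3 * p\<close>.\<close>

lemma involution_no_fixed:
  assumes "odd p" "f = 1" "t \<le> 3" and w: "w \<in> carrier G" "w \<otimes> w = \<one>" and y: "y \<in> D" "w \<in> centr y"
  shows "w = \<one>"
proof -
  have Fy: "F y = {y}" using card_F[OF y(1)] F_self[OF y(1)] assms by (auto simp: card_1_singleton_iff)
  have wy: "y \<in> centr w" using y w DG by (auto simp: mem_centr)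
  have e: "D - centr w = N y - centr w" using Fy FN[of y] wy by auto
  have 2: "w [^] (2::nat) = \<one>" using w by (simp add: numeral_2_eq_2)
  have "p dvd card (N y - centr w)" using moved_N_dvd(1)[OF y 2] by simp
  moreover have "4 dvd card (N y - centr w)" using involution_moves_four_cls[OF x(1) w] e by simp
  moreover have "coprime p 4" using assms(1) coprime_power_right_iff[of p 2 2] by simp
  ultimately have "p * 4 dvd card (N y - centr w)" by (intro divides_mult) auto
  moreover have "card (N y - centr w) < p * 4"
  proof -
    have "card (N y - centr w) \<le> p * t" using card_mono[OF finD(3)[of y], of "N y - centr w"] card_N[of y] y by auto
    also have "\<dots> \<le> p * 3" using assms by simp
    finally show ?thesis using prime_gt_0_nat[OF p] by linarith
  qed
  ultimately have "card (N y - centr w) = 0" by (meson nat_dvd_not_less not_gr0)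
  then have "D \<subseteq> centr w" using e by auto
  then show ?thesis using centralizes_cls[OF x w(1)] by blast
qed

text \<open>\<open>y\<close> permutes \<open>N y\<close> in one cycle, so whatever commutes with
  \<open>y\<close> and one point of \<open>N y\<close> commutes with all of \<open>N y\<close>, and
  propagation makes it trivial. Then \<open>centr x\<close> acts regularly on \<open>N x\<close>,
  and \<open>G\<close> is sharply 2-transitive on \<open>D\<close>. The set in the last claim
  consists of the elements that fix no point of \<open>D\<close>, the nontrivial part of a would-be
  Frobenius kernel.\<close>

lemma one_cycle:
  assumes t1: "t = 1"
  shows "card (centr x) = p" "f = 1" "card D = p + 1" "card (carrier G) = p * (p + 1)"
    "\<exists>W\<subseteq>carrier G. card W = p \<and> (\<forall>w\<in>W. w \<noteq> \<one> \<and> cls w \<subseteq> W) \<and>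
      (\<forall>w\<in>carrier G. w [^] p \<noteq> \<one> \<longrightarrow> w \<in> W)"
proof -
  have all: "N y \<subseteq> centr v" if y: "y \<in> D" and v: "v \<in> centr y" "z \<in> N y" "v \<in> centr z" for y v z
  proof -
    have vG: "v \<in> carrier G" using v by (simp add: mem_centr)
    have zv: "z \<in> N y \<inter> centr v" using v ND DG by (auto simp: mem_centr)
    have "p dvd card (N y - centr v - centr y)"
    proof (rule moved_dvd[OF DG[OF y] D_facts(2)[OF y] p])
      show "N y - centr v \<subseteq> carrier G" using ND DG by blast
      fix u assume u: "u \<in> N y - centr v"
      have "conj y v = v" using v y DG by (auto simp: mem_centr conj_eq_iff)
      then have "conj y u \<in> centr v \<longleftrightarrow> u \<in> centr v"
        using conj_mem_centr_iff[of y u v] vG DG y u ND by (metis Diff_iff subsetD)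
      moreover have "conj y u \<in> N y" using centr_invariant_N[OF _ y] u DG[OF y] by (auto simp: mem_centr)
      ultimately show "conj y u \<in> N y - centr v" using u by blast
    qed
    moreover have "N y - centr v - centr y = N y - centr v" by (auto simp: N_def)
    moreover have "card (N y - centr v) < p"
    proof -
      have "card (N y - centr v) < card (N y)" using zv by (intro psubset_card_mono) auto
      then show ?thesis using card_N[OF y] t1 by simp
    qed
    ultimately have "card (N y - centr v) = 0" by (metis nat_dvd_not_less not_gr0)
    then show ?thesis by auto
  qed
  have triv: "v = \<one>" if v: "v \<in> centr x" "z \<in> N x" "v \<in> centr z" for v z
  proof -
    have vG: "v \<in> carrier G" using v by (simp add: mem_centr)
    show ?thesis
    proof (rule commutant_propagates[OF vG, where V = "{y \<in> D. v \<in> centr y \<and> N y \<subseteq> centr v}"])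
      show "{y \<in> D. v \<in> centr y \<and> N y \<subseteq> centr v} \<noteq> {}" using all[OF self_D v] v by auto
      fix y w assume y: "y \<in> {y \<in> D. v \<in> centr y \<and> N y \<subseteq> centr v}" and w: "w \<in> N y"
      have wD: "w \<in> D" using w ND by auto
      have vw: "v \<in> centr w" using y w vG by (auto simp: mem_centr)
      have "N w \<subseteq> centr v" using all[OF wD vw N_sym[of y w]] y w by auto
      then show "w \<in> {y \<in> D. v \<in> centr y \<and> N y \<subseteq> centr v}" using wD vw by auto
    qed auto
  qed
  have "card (N x) > 0" using t1 card_N[OF self_D] prime_gt_0_nat[OF p] by simp
  then obtain z where z: "z \<in> N x" by (metis all_not_in_conv card.empty less_irrefl)
  have zG: "z \<in> carrier G" using z ND DG by auto
  have "card (centr x) \<le> card (N x)"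
  proof (rule card_semiregular_le[OF centr_subgroup[OF x(1)] zG])
    show "v = \<one>" if "v \<in> centr x" "v \<in> centr z" for v using triv[OF that(1) z that(2)] .
    show "conj v z \<in> N x" if "v \<in> centr x" for v using centr_invariant_N[OF that self_D z] .
  qed simp
  then have "card (centr x) \<le> p" using card_N[OF self_D] t1 by simp
  moreover have "card (centr x) > 0" using card_centr_pos[OF x(1)] .
  ultimately show cp: "card (centr x) = p" using p_dvd_centr by (meson dvd_imp_le le_antisym)
  have "F x \<subseteq> centr x - {\<one>}" using D_facts(1) by (simp add: F_def) blast
  then have "card (F x) \<le> card (centr x - {\<one>})" by (intro card_mono) auto
  then have "f \<le> p - 1" using cp by (simp add: f_def mem_centr)
  then have fp: "f < p" using prime_gt_0_nat[OF p] by linarith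
  \<comment> \<open>Below the threshold of \<open>F_blocks\<close>, \<open>D\<close> is a union of
    blocks of size \<open>f\<close>; so \<open>f\<close> divides \<open>f + p\<close>, hence the
    prime \<open>p\<close>.\<close>
  then have "f dvd card D" using card_blocks by (metis dvd_triv_left less_add_same_cancel1 trans_less_add1 zero_less_numeral)
  then have "f dvd p" using card_D t1 by (simp add: dvd_add_right_iff)
  then show f1: "f = 1" using p fp prime_nat_iff by blast
  show cD: "card D = p + 1" using card_D f1 t1 by simp
  show cG: "card (carrier G) = p * (p + 1)" using cls_centr[OF x(1)] cp cD by simp
  have cpy: "card (centr y) = p" if "y \<in> D" for y using card_cls_eq[OF x(1) that] cp by simp
  let ?U = "\<Union>y\<in>D. centr y - {\<one>}"
  let ?W = "carrier G - {\<one>} - ?U"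
  have "card ?U = (\<Sum>y\<in>D. card (centr y - {\<one>}))"
  proof (rule card_UN_disjoint)
    show "\<forall>y\<in>D. \<forall>z\<in>D. y \<noteq> z \<longrightarrow> (centr y - {\<one>}) \<inter> (centr z - {\<one>}) = {}"
    proof (intro ballI impI, rule ccontr)
      \<comment> \<open>Two centralizers of prime order that meet nontrivially coincide, which would
        put \<open>y\<close> into \<open>F z = {z}\<close>.\<close>
      fix y z assume yz: "y \<in> D" "z \<in> D" "y \<noteq> z" "(centr y - {\<one>}) \<inter> (centr z - {\<one>}) \<noteq> {}"
      have s: "subgroup (centr y \<inter> centr z) G" 
        using subgroups_Inter_pair centr_subgroup DG yz by blast
      have "card (centr y \<inter> centr z) dvd p"
        using subgroup_card_dvd_subgroup[OF s centr_subgroup[OF DG[OF yz(1)]]] cpy yz by simp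
      moreover have "card (centr y \<inter> centr z) \<noteq> 1"
      proof
        assume "card (centr y \<inter> centr z) = 1"
        then obtain a where a: "centr y \<inter> centr z = {a}" using card_1_singletonE by blast
        obtain u where "u \<in> centr y \<inter> centr z" "u \<noteq> \<one>" using yz(4) by blast
        then show False using a subgroup.one_closed[OF s] by simp
      qed
      ultimately have "card (centr y \<inter> centr z) = p" using p prime_nat_iff by blast
      then have "centr y \<inter> centr z = centr y" using cpy[OF yz(1)] by (intro card_subset_eq) auto
      then have "y \<in> F z" using F_self[OF yz(1)] by (auto simp: F_def)
      moreover have "F z = {z}" using card_F[OF yz(2)] F_self[OF yz(2)] f1 by (auto simp: card_1_singleton_iff)
      ultimately show False using yz by auto
    qed
  qed auto
  also have "\<dots> = (\<Sum>y\<in>D. p - 1)" using cpy DG by (intro sum.cong) (auto simp: mem_centr card_Diff_singleton)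
  finally have cU: "card ?U = (p + 1) * (p - 1)" using cD by simp
  have "card ?W = card (carrier G - {\<one>}) - card ?U"
    by (rule card_Diff_subset) (use fin centr_carrier in \<open>auto intro: finite_subset\<close>)
  also have "\<dots> = p * (p + 1) - 1 - (p + 1) * (p - 1)" using cU cG fin by simp
  also have "\<dots> = p"
  proof -
    obtain k where "p = Suc k" using prime_gt_0_nat[OF p] gr0_implies_Suc by blast
    then show ?thesis by (simp add: algebra_simps)
  qed
  finally have cW: "card ?W = p" .
  have "cls w \<subseteq> ?W" if w: "w \<in> ?W" for w
  proof
    fix u assume "u \<in> cls w"
    then obtain g where g: "g \<in> carrier G" "u = conj g w" by (auto simp: cls_def)
    have "u \<in> carrier G" "u \<noteq> \<one>" using g w conj_inject[OF g(1), of w \<one>] by auto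
    moreover have "u \<notin> centr y" if y: "y \<in> D" for y
    proof
      assume "u \<in> centr y"
      then have "conj (inv g) u \<in> centr (conj (inv g) y)"
        using conj_mem_centr_iff[of "inv g" u y] g DG[OF y] w by auto
      then have "w \<in> centr (conj (inv g) y)" using g w by simp
      then show False using w D_conj[of "inv g" y] g y by auto
    qed
    ultimately show "u \<in> ?W" by auto
  qed
  moreover have "w \<in> ?W" if w: "w \<in> carrier G" "w [^] p \<noteq> \<one>" for w
  proof -
    have "w \<notin> centr y" if "y \<in> D" for y
    proof
      assume "w \<in> centr y"
      then have "ord w dvd p" using ord_dvd_subgroup[OF centr_subgroup[OF DG[OF that]]] cpy[OF that] by simp
      then show False using w pow_eq_id by blast
    qed
    moreover have "w \<noteq> \<one>" using w by auto
    ultimately show ?thesis using w by auto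
  qed
  ultimately show "\<exists>W\<subseteq>carrier G. card W = p \<and> (\<forall>w\<in>W. w \<noteq> \<one> \<and> cls w \<subseteq> W) \<and>
      (\<forall>w\<in>carrier G. w [^] p \<noteq> \<one> \<longrightarrow> w \<in> W)" using cW by (intro exI[of _ ?W]) blast
qed


text \<open>An element \<open>u\<close> of order \<open>r\<close> acts regularly on \<open>D\<close>, so \<open>centr u\<close> has order \<open>r\<close>. The class of \<open>u\<close>, of
  size \<open>q ^ b\<close>, is partitioned into \<open>q ^ j\<close> blocks of size \<open>e < r\<close>, and counting the fixed points of
  \<open>u\<close> on it gives \<open>q ^ b \<equiv> e\<close> modulo \<open>r\<close>.\<close>

lemma prime_size:
  assumes r: "prime r" "card D = r" and cG: "card (carrier G) = r * q ^ b" and q: "prime q" "q \<noteq> r"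
    and mn: "\<And>w. w \<in> carrier G \<Longrightarrow> w \<noteq> \<one> \<Longrightarrow> r \<le> card (cls w)"
  obtains j where "j > 0" "q ^ j mod r = 1" "q ^ j dvd fact (r - 1)"
proof -
  obtain u where u: "u \<in> carrier G" "u \<noteq> \<one>" "u [^] r = \<one>"
    using cauchy[OF subgroup_self r(1)] cG by auto
  have DC: "D \<subseteq> carrier G" using DG by blast
  have "r dvd card (D - centr u)"
    by (rule moved_dvd[OF u(1,3) r(1) DC]) (use D_conj u in auto)
  moreover have "card (D - centr u) > 0"
    using centralizes_cls[OF x u(1)] u(2) by (auto simp: card_gt_0_iff)
  moreover have "card (D - centr u) \<le> r" using card_mono[of D "D - centr u"] r by simp
  ultimately have "card (D - centr u) = card D" using r(2) by (simp add: dvd_imp_le le_antisym)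
  then have "D - centr u = D" by (intro card_subset_eq) auto
  then have Du: "D \<inter> centr u = {}" by blast
  \<comment> \<open>\<open>u\<close> permutes the points of \<open>D\<close> centralized by
    \<open>g\<close> and fixes none of them, so a single such point produces \<open>r\<close> of
    them, all of \<open>D\<close>.\<close>
  have semi: "g = \<one>" if g: "g \<in> centr u" "y \<in> D" "g \<in> centr y" for g y
  proof -
    have gG: "g \<in> carrier G" using g by (simp add: mem_centr)
    have com: "conj u g = g" using g u by (auto simp: mem_centr conj_eq_iff)
    have "r dvd card (D \<inter> centr g - centr u)"
    proof (rule moved_dvd[OF u(1,3) r(1)])
      show "D \<inter> centr g \<subseteq> carrier G" using DG by blast
      fix z assume z: "z \<in> D \<inter> centr g"
      then have "conj u z \<in> centr (conj u g)" using conj_mem_centr_iff[OF u(1) DG gG] by blast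
      then show "conj u z \<in> D \<inter> centr g" using z D_conj u com by auto
    qed
    moreover have "D \<inter> centr g - centr u = D \<inter> centr g" using Du by blast
    moreover have "card (D \<inter> centr g) > 0"
      using g gG DG by (auto simp: card_gt_0_iff mem_centr)
    ultimately have "card D \<le> card (D \<inter> centr g)" using r(2) by (simp add: dvd_imp_le)
    then have "D \<inter> centr g = D" using card_seteq[of D "D \<inter> centr g"] by auto
    then show ?thesis using centralizes_cls[OF x gG] by blast
  qed
  have "card (centr u) \<le> card D"
  proof (rule card_semiregular_le[OF centr_subgroup[OF u(1)] x(1)])
    show "v = \<one>" if "v \<in> centr u" "v \<in> centr x" for v using semi[OF that(1) self_D that(2)] .
    show "conj v x \<in> D" if "v \<in> centr u" for v using that D_conj by (simp add: mem_centr)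
  qed simp
  then have "card (centr u) \<le> r" using r(2) by simp
  moreover have "r dvd card (centr u)"
    using dvd_card_of_order[OF centr_subgroup[OF u(1)] _ u(2,3) r(1)] u(1) by (simp add: mem_centr)
  moreover have "card (centr u) > 0" using card_centr_pos[OF u(1)] .
  ultimately have cu: "card (centr u) = r" by (simp add: dvd_imp_le le_antisym)
  have clu: "card (cls u) = q ^ b" using cls_centr[OF u(1)] cG cu prime_gt_0_nat[OF r(1)] by simp
  have uC: "cls u \<subseteq> carrier G" using cls_carrier[OF u(1)] .
  let ?E = "cls u \<inter> centr u"
  let ?m = "card (centr ` cls u)"
  \<comment> \<open>The blocks are the fibres of \<open>centr\<close> on the class of
    \<open>u\<close>. Centralizers of prime order that share a nontrivial element agree, so the
    fibre of \<open>u\<close> is what commutes with \<open>u\<close>.\<close>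
  have eq: "{z \<in> cls u. centr z = centr u} = ?E"
  proof
    have "z \<in> centr z" if "z \<in> cls u" for z using that uC by (auto simp: mem_centr)
    then show "{z \<in> cls u. centr z = centr u} \<subseteq> ?E" by auto
    show "?E \<subseteq> {z \<in> cls u. centr z = centr u}"
    proof
      fix z assume z: "z \<in> ?E"
      then have zG: "z \<in> carrier G" "z \<noteq> \<one>" using uC cls_not_one[OF u(1,2)] by auto
      have cz: "card (centr z) = r" using card_cls_eq[OF u(1)] z cu by auto
      have s: "subgroup (centr u \<inter> centr z) G"
        using subgroups_Inter_pair centr_subgroup u(1) zG(1) by blast
      have "z \<in> centr u \<inter> centr z" using z zG by (auto simp: mem_centr)
      then have "ord z dvd card (centr u \<inter> centr z)" using ord_dvd_subgroup[OF s] by blast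
      moreover have "z [^] r = \<one>" using z u by (auto simp: cls_def simp flip: conj_pow)
      then have "ord z = r" using ord_prime[OF zG _ r(1)] by blast
      ultimately have "r \<le> card (centr u \<inter> centr z)"
        using subgroup.one_closed[OF s] by (intro dvd_imp_le) (auto simp: card_gt_0_iff)
      then have "centr u \<inter> centr z = centr u" "centr u \<inter> centr z = centr z"
        using card_seteq[of "centr u" "centr u \<inter> centr z"] card_seteq[of "centr z" "centr u \<inter> centr z"] cu cz by auto
      then show "z \<in> {z \<in> cls u. centr z = centr u}" using z by auto
    qed
  qed
  have "card {z \<in> cls u. centr z = centr u} * ?m = card (cls u)"
  proof (rule invariant_partition[OF u(1)])
    fix g y z assume "g \<in> carrier G" "y \<in> cls u" "z \<in> cls u" "centr y = centr z"
    then show "centr (conj g y) = centr (conj g z)" using centr_conj uC by (metis subsetD)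
  qed
  then have em: "card ?E * ?m = q ^ b" using eq clu by simp
  have "?E \<subseteq> centr u - {\<one>}" using cls_not_one[OF u(1,2)] by auto
  then have "card ?E \<le> card (centr u - {\<one>})" by (intro card_mono) auto
  then have er: "card ?E < r" using cu u(1) prime_gt_0_nat[OF r(1)] by (simp add: mem_centr)
  have "u \<in> ?E" using cls_self[OF u(1)] u(1) by (simp add: mem_centr)
  then have e0: "card ?E > 0" using u(1) by (auto simp: card_gt_0_iff)
  have "card (cls u) mod r = card ?E mod r"
    by (rule order_p_fixed_points[OF u(1,3) r(1) uC]) (use conj_mem_cls u in auto)
  then have "card ?E * ?m mod r = card ?E mod r" using em clu by simp
  moreover have m0: "?m \<ge> 1" using em q(1) by (metis Suc_leI gr0I One_nat_def mult_0_right power_not_zero not_prime_0)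
  ultimately have "r dvd card ?E * ?m - card ?E" using mod_eq_dvd_iff_nat[of "card ?E" "card ?E * ?m" r] by simp
  then have "r dvd card ?E * (?m - 1)" by (simp add: diff_mult_distrib2)
  moreover have "\<not> r dvd card ?E" using er e0 by (metis nat_dvd_not_less)
  ultimately have "r dvd ?m - 1" using r(1) prime_dvd_mult_iff by blast
  then have "?m mod r = 1 mod r" using m0 mod_eq_dvd_iff_nat by blast
  then have m1: "?m mod r = 1" using prime_gt_1_nat[OF r(1)] by simp
  have mq: "?m dvd q ^ b" using em by (metis dvd_triv_right)
  then obtain j where j: "?m = q ^ j" using divides_primepow_nat[OF q(1)] by blast
  \<comment> \<open>With a single block the class of \<open>u\<close> would have fewer than
    \<open>r\<close> elements, against the minimality assumption \<open>mn\<close>.\<close>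
  have "j \<noteq> 0"
  proof
    assume "j = 0"
    then have "card (cls u) < r" using em clu j er by simp
    then show False using mn[OF u(1,2)] by simp
  qed
  moreover have "q ^ j dvd fact (r - 1)"
  proof -
    \<comment> \<open>The action on the \<open>r\<close> points of \<open>D\<close> is
      faithful.\<close>
    have "r * q ^ b dvd fact r" using card_dvd_fact_cls[OF x] r(2) cG by simp
    moreover have "fact r = r * (fact (r - 1) :: nat)" using prime_gt_0_nat[OF r(1)] by (simp add: fact_reduce)
    ultimately have "q ^ b dvd fact (r - 1)" using prime_gt_0_nat[OF r(1)] by simp
    then show ?thesis using mq j dvd_trans by metis
  qed
  ultimately show ?thesis using that m1 j by simp
qed

section \<open>Commuting patterns inside a class, and three excluded parameter triples\<close>

lemma F_in_D: "z \<in> F y \<Longrightarrow> z \<in> D" and N_in_D: "z \<in> N y \<Longrightarrow> z \<in> D"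
  by (simp_all add: F_def N_def)

lemma F_split: "card (F u \<inter> F y) + card (F u \<inter> N y) = card (F u)"
proof -
  have "F u = F u \<inter> F y \<union> F u \<inter> N y" using FN[of y] FD[of u] by blast
  moreover have "F u \<inter> F y \<inter> (F u \<inter> N y) = {}" using FNd[of y] by blast
  ultimately show ?thesis by (metis card_Un_disjoint finD(2) finite_Int)
qed

text \<open>\<open>y\<close> commutes with \<open>u\<close> and \<open>w\<close>, so it permutes
  these intersections; they lie in \<open>N y\<close>, where \<open>y\<close> fixes nothing.\<close>

lemma F_Int_N_dvd:
  assumes y: "y \<in> D" and u: "u \<in> F y" "w \<in> F y"
  shows "p dvd card (F u \<inter> N y)" "p dvd card (F u \<inter> F w \<inter> N y)"
proof -
  have yG: "y \<in> carrier G" using DG[OF y] .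
  have inv: "conj y z \<in> F v" if z: "z \<in> F v" and v: "v \<in> F y" for z v
  proof -
    have vD: "v \<in> D" using v FD by auto
    have "y \<in> centr v" using v yG by (auto simp: F_def mem_centr)
    then show ?thesis using centr_invariant vD z by blast
  qed
  have invN: "conj y z \<in> N y" if "z \<in> N y" for z
    using centr_invariant_N[OF _ y that] yG by (auto simp: mem_centr)
  have NG: "z \<in> carrier G" if "z \<in> N y" for z using that ND DG by blast
  have e: "A \<inter> N y - centr y = A \<inter> N y" for A by (auto simp: N_def)
  have "p dvd card (F u \<inter> N y - centr y)"
    by (rule moved_dvd[OF yG D_facts(2)[OF y] p]) (use inv invN u NG in auto)
  then show "p dvd card (F u \<inter> N y)" by (simp add: e)
  have "p dvd card (F u \<inter> F w \<inter> N y - centr y)"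
    by (rule moved_dvd[OF yG D_facts(2)[OF y] p]) (use inv invN u NG in auto)
  then show "p dvd card (F u \<inter> F w \<inter> N y)" by (simp add: e)
qed

lemma F_partition:
  assumes "y \<in> D" shows "card {z \<in> D. F z = F y} dvd card D"
proof -
  have "card {z \<in> cls y. F z = F y} * card (F ` cls y) = card (cls y)"
    by (rule invariant_partition[OF DG[OF assms]]) (unfold D_facts(3)[OF assms], rule F_image)
  then show ?thesis using D_facts(3)[OF assms] by (metis dvd_triv_left)
qed

text \<open>Two commuting elements of \<open>D\<close> lie in a unique triple of pairwise commuting elements; the four
  triples through the elements of \<open>F x - {x}\<close> that leave \<open>F x\<close> do not fit into \<open>N x\<close>.\<close>

lemma no_class_2_5_2:
  assumes ptf: "p = 2" and f5: "f = 5" and t2: "t = 2"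
  shows False
proof -
  have "card D = f + p * 2" "card (N x) = p * 2" using card_D card_N[OF self_D] t2 by simp_all
  then have cD: "card D = 9" and cN: "card (N x) = 4" using ptf f5 by simp_all
  have cF: "card (F y) = 5" if "y \<in> D" for y using card_F[OF that] f5 by simp
  \<comment> \<open>An even number of the five elements of \<open>F u\<close> leave
    \<open>F y\<close>, and \<open>u\<close> and \<open>y\<close> both stay.\<close>
  have three_five: "card (F u \<inter> F y) = 3 \<or> F u = F y" if y: "y \<in> D" and u: "u \<in> F y" "u \<noteq> y" for u y
  proof -
    have uD: "u \<in> D" using u FD by auto
    have "even (card (F u \<inter> N y))" using F_Int_N_dvd(1)[OF y u(1) u(1)] ptf by simp
    then have "odd (card (F u \<inter> F y))" using F_split[of u y] cF[OF uD] by presburger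
    moreover have "card {u, y} \<le> card (F u \<inter> F y)"
      using F_self F_sym[OF y u(1)] u y uD by (intro card_mono) auto
    moreover have le: "card (F u \<inter> F y) \<le> 5" using card_mono[of "F u" "F u \<inter> F y"] cF[OF uD] by simp
    ultimately have "card (F u \<inter> F y) = 3 \<or> card (F u \<inter> F y) = 5" using u(2) by (auto; presburger)
    moreover have "F u = F y" if "card (F u \<inter> F y) = 5"
      using card_seteq[of "F u" "F u \<inter> F y"] card_seteq[of "F y" "F u \<inter> F y"] that cF y uD by auto
    ultimately show ?thesis by blast
  qed
  have three: "card (F u \<inter> F y) = 3" if y: "y \<in> D" and u: "u \<in> F y" "u \<noteq> y" for u y
  proof (rule ccontr)
    assume "card (F u \<inter> F y) \<noteq> 3"
    then have uy: "F u = F y" using three_five[OF y u] by blast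
    \<comment> \<open>\<open>?B\<close> is a block, so its size divides 9; lying between 2 and 5 it
      is 3. A further point \<open>c\<close> of \<open>F y\<close> commutes with itself and all of
      \<open>?B\<close>, hence shares four neighbours with \<open>y\<close>, which forces
      \<open>F c = F y\<close> and puts \<open>c\<close> into \<open>?B\<close>.\<close>
    let ?B = "{z \<in> D. F z = F y}"
    have BF: "?B \<subseteq> F y" using F_self by blast
    have "card ?B dvd 9" using F_partition[OF y] cD by simp
    moreover have "card ?B \<le> 5" using card_mono[OF _ BF] cF[OF y] by simp
    moreover have "card {u, y} \<le> card ?B" using y u uy FD by (intro card_mono) auto
    then have "card ?B \<ge> 2" using u by simp
    moreover have "n = 3" if "n dvd 9" "n \<le> 5" "2 \<le> n" for n :: nat
    proof -
      have "n = 2 \<or> n = 3 \<or> n = 4 \<or> n = 5" using that by auto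
      then show ?thesis using that(1) by auto
    qed
    ultimately have cB: "card ?B = 3" by blast
    have "\<not> F y \<subseteq> ?B" using card_mono[of ?B "F y"] cB cF[OF y] by auto
    then obtain c where c: "c \<in> F y" "c \<notin> ?B" by blast
    have cD': "c \<in> D" using c FD by auto
    have "insert c ?B \<subseteq> F c \<inter> F y" using c BF F_self cD' F_sym by auto
    then have "card (insert c ?B) \<le> card (F c \<inter> F y)" by (intro card_mono) auto
    then have "card (F c \<inter> F y) \<noteq> 3" using cB c by simp
    moreover have "c \<noteq> y" using c y by auto
    ultimately have "F c = F y" using three_five[OF y c(1)] by blast
    then show False using c cD' by auto
  qed
  have four: "A \<subseteq> F u \<inter> F y \<Longrightarrow> card A \<le> 3" if "y \<in> D" "u \<in> F y" "u \<noteq> y" for A u y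
    using card_mono[of "F u \<inter> F y" A] three[OF that] by simp
  let ?X = "F x - {x}"
  have cX: "card ?X = 4" using cF[OF self_D] F_self[OF self_D] by simp
  have two: "card (F u \<inter> N x) = 2" if u: "u \<in> ?X" for u
    using F_split[of u x] three[OF self_D, of u] u cF[of u] F_in_D by auto
  have disj: "F u \<inter> N x \<inter> (F v \<inter> N x) = {}" if uv: "u \<in> ?X" "v \<in> ?X" "u \<noteq> v" for u v
  proof (rule ccontr)
    assume "F u \<inter> N x \<inter> (F v \<inter> N x) \<noteq> {}"
    then obtain z where z: "z \<in> F u" "z \<in> F v" "z \<in> N x" by blast
    have uvD: "u \<in> D" "v \<in> D" "z \<in> D" using uv z FD ND by auto
    have "card (F u \<inter> F v \<inter> N x) > 0" using z by (auto simp: card_gt_0_iff)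
    moreover have "even (card (F u \<inter> F v \<inter> N x))" using F_Int_N_dvd(2)[OF self_D, of u v] uv ptf by simp
    ultimately have "card (F u \<inter> F v \<inter> N x) \<ge> 2" by presburger
    then have eq: "F u \<inter> F v \<inter> N x = F u \<inter> N x"
      using two[OF uv(1)] by (intro card_seteq) auto
    have uz: "u \<in> F z" "v \<in> F z" using F_sym uvD z by auto
    have zx: "z \<notin> F x" using z(3) N_iff uvD by blast
    have zu: "z \<noteq> u" "z \<noteq> v" "z \<noteq> x" using zx uv F_self[OF self_D] by auto
    have xz: "x \<notin> F z" using z(3) N_iff N_sym self_D uvD by blast
    have "card (F u \<inter> F z) = 3" using three[OF uvD(3) uz(1)] zu by auto
    \<comment> \<open>The triple through \<open>u\<close> and \<open>z\<close> has a third member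
      \<open>w\<close>. If \<open>w\<close> commutes with \<open>x\<close>, then \<open>u\<close>
      and \<open>w\<close> have four common neighbours; otherwise \<open>w\<close> lies in
      \<open>N x\<close>, hence also in \<open>F v\<close>, and \<open>w\<close> and
      \<open>z\<close> have four.\<close>
    then have "\<not> F u \<inter> F z \<subseteq> {u, z}"
      using card_mono[of "{u, z}" "F u \<inter> F z"] by (auto simp: card_insert_if split: if_splits)
    then obtain w where w: "w \<in> F u" "w \<in> F z" "w \<noteq> u" "w \<noteq> z" by blast
    have wD: "w \<in> D" using w FD by auto
    show False
    proof (cases "w \<in> F x")
      case True
      have "w \<noteq> x" using w xz by auto
      have uFx: "u \<in> F x" using uv by simp
      note m = F_sym[OF self_D True] F_sym[OF self_D uFx] F_sym[OF uvD(3) w(2)]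
        F_sym[OF uvD(1) w(1)] F_self[OF uvD(1)] F_self[OF wD]
      have sub: "{x, z, u, w} \<subseteq> F w \<inter> F u"
        by (intro insert_subsetI IntI empty_subsetI m z w)
      have "x \<noteq> z" "x \<noteq> u" "x \<noteq> w" "z \<noteq> u" "z \<noteq> w" "u \<noteq> w"
        using \<open>w \<noteq> x\<close> w(3,4) zu uv(1) by blast+
      then have "card {x, z, u, w} = 4" by simp
      with four[OF uvD(1) w(1,3) sub] show False by linarith
    next
      case False
      then have "w \<in> N x" using N_iff wD by blast
      then have "w \<in> F v" using eq w by blast
      note m = F_sym[OF uvD(2) this] F_sym[OF uvD(1) w(1)] F_sym[OF uvD(3) w(2)]
        F_self[OF uvD(3)] F_self[OF wD]
      have sub: "{u, v, w, z} \<subseteq> F w \<inter> F z"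
        by (intro insert_subsetI IntI empty_subsetI m uz w)
      have "w \<noteq> v" using uv(2) \<open>w \<notin> F x\<close> by blast
      then have "u \<noteq> v" "u \<noteq> w" "u \<noteq> z" "v \<noteq> w" "v \<noteq> z" "w \<noteq> z"
        using w(3,4) zu uv(3) by blast+
      then have "card {u, v, w, z} = 4" by simp
      with four[OF uvD(3) w(2,4) sub] show False by linarith
    qed
  qed
  have "card (\<Union>u\<in>?X. F u \<inter> N x) = (\<Sum>u\<in>?X. card (F u \<inter> N x))"
    by (rule card_UN_disjoint) (use disj in auto)
  also have "\<dots> = 8" using two cX by simp
  finally have "8 \<le> card (N x)" using card_mono[of "N x" "\<Union>u\<in>?X. F u \<inter> N x"] by auto
  then show False using cN by simp
qed

text \<open>The elements of \<open>F x - {x}\<close> do not commute with each other but have the same neighbours in \<open>N x\<close>,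
  so the commuting graph on \<open>D\<close> is a union of complete bipartite graphs on \<open>4 + 4\<close> vertices.\<close>

lemma no_class_3_5_2:
  assumes ptf: "p = 3" and f5: "f = 5" and t2: "t = 2"
  shows False
proof -
  have "card D = f + p * 2" "card (N x) = p * 2" using card_D card_N[OF self_D] t2 by simp_all
  then have cD: "card D = 11" and cN: "card (N x) = 6" using ptf f5 by simp_all
  have cF: "card (F y) = 5" if "y \<in> D" for y using card_F[OF that] f5 by simp
  have d5: "\<not> (n dvd 11 \<and> 2 \<le> n \<and> n \<le> 5)" for n :: nat
  proof
    assume n: "n dvd 11 \<and> 2 \<le> n \<and> n \<le> 5"
    then have "n = 2 \<or> n = 3 \<or> n = 4 \<or> n = 5" by auto
    then show False using n by auto
  qed
  \<comment> \<open>Elements with equal neighbourhoods form a block, and the prime 11 has no divisor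
    from 2 to 5.\<close>
  have F_eq: "\<not> (a \<in> F y \<and> a \<noteq> y \<and> F a = F y)" if y: "y \<in> D" for a y
  proof
    assume a: "a \<in> F y \<and> a \<noteq> y \<and> F a = F y"
    let ?B = "{z \<in> D. F z = F y}"
    have "?B \<subseteq> F y" using F_self by blast
    then have "card ?B \<le> 5" using card_mono[of "F y" ?B] cF[OF y] by simp
    moreover have "card {a, y} \<le> card ?B" using y a FD by (intro card_mono) auto
    then have "card ?B \<ge> 2" using a by simp
    moreover have "card ?B dvd 11" using F_partition[OF y] cD by simp
    ultimately show False using d5 by blast
  qed
  \<comment> \<open>\<open>a\<close> permutes \<open>F y\<close>, fixing \<open>a\<close> and
    \<open>y\<close>. It cannot centralize all of \<open>F y\<close>, so it moves the other three
    points in a 3-cycle.\<close>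
  have moved: "F y - centr a = F y - {a, y} \<and> F y \<inter> F a = {a, y}" if y: "y \<in> D" and a: "a \<in> F y" "a \<noteq> y" for a y
  proof -
    have aD: "a \<in> D" using a FD by auto
    have sub: "F y - centr a \<subseteq> F y - {a, y}" using aD a DG by (auto simp: F_def mem_centr)
    have "card (F y - {a, y}) = 3" using card_Diff_subset[of "{a, y}" "F y"] a F_self[OF y] cF[OF y] by simp
    have "p dvd card (F y - centr a)"
    proof (rule moved_dvd[OF DG[OF aD] D_facts(2)[OF aD] p])
      show "F y \<subseteq> carrier G" using FD DG by blast
      show "conj a z \<in> F y" if "z \<in> F y" for z
        using centr_invariant[OF _ y that] a by (auto simp: F_def)
    qed
    moreover have "card (F y - centr a) \<noteq> 0"
    proof
      assume "card (F y - centr a) = 0"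
      then have "F y \<subseteq> F a" using FD by (auto simp: F_def)
      then have "F y = F a" using cF y aD by (intro card_subset_eq) auto
      then show False using F_eq[OF y, of a] a by simp
    qed
    ultimately have "3 \<le> card (F y - centr a)" using ptf by (metis dvd_imp_le gr0I)
    then have e: "F y - centr a = F y - {a, y}"
      using card_seteq[OF _ sub] \<open>card (F y - {a, y}) = 3\<close> by simp
    have "F y \<inter> F a = F y - (F y - centr a)" using FD by (auto simp: F_def)
    also have "\<dots> = {a, y}" unfolding e using a F_self[OF y] by auto
    finally show ?thesis using e by blast
  qed
  let ?X = "F x - {x}"
  define Y where "Y a = F a \<inter> N x" for a
  have cY: "card (Y a) = 3" if a: "a \<in> ?X" for a
  proof -
    have "F a \<inter> F x = {a, x}" using moved[OF self_D, of a] a by auto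
    then show ?thesis using F_split[of a x] cF[of a] a F_in_D by (auto simp: Y_def)
  qed
  \<comment> \<open>\<open>Y a\<close> and \<open>Y b\<close> meet in 0 or 3 points, so they are
    equal or complementary in \<open>N x\<close>. As \<open>b\<close> preserves \<open>Y b\<close>
    and \<open>N x\<close>, it preserves \<open>Y a\<close> in either case.\<close>
  have Y_conj: "Y (conj b a) = Y a" if ab: "a \<in> ?X" "b \<in> ?X" for a b
  proof -
    have G: "a \<in> D" "b \<in> D" using ab FD by auto
    have bG: "b \<in> carrier G" using DG G by auto
    have bx: "b \<in> centr x" using ab by (auto simp: F_def)
    have fb: "conj b ` F b = F b" "conj b ` N x = N x"
    proof -
      have inj: "inj_on (conj b) (F b)" "inj_on (conj b) (N x)"
        using bG FD ND DG by (auto intro!: inj_onI simp: subset_iff)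
      have "conj b ` F b \<subseteq> F b"
        using centr_invariant[of b b] G bG by (auto simp: mem_centr)
      then show "conj b ` F b = F b" by (rule endo_inj_surj[OF finD(2) _ inj(1)])
      have "conj b ` N x \<subseteq> N x"
        using centr_invariant_N[OF bx self_D] by auto
      then show "conj b ` N x = N x" by (rule endo_inj_surj[OF finD(3) _ inj(2)])
    qed
    have im: "conj b ` (A \<inter> B) = conj b ` A \<inter> conj b ` B" if "A \<subseteq> D" "B \<subseteq> D" for A B
      by (rule inj_on_image_Int[of _ "carrier G"]) (use that DG bG in \<open>auto intro!: inj_onI\<close>)
    have "Y (conj b a) = conj b ` (Y a)"
      unfolding Y_def im[OF FD ND] using F_conj[OF bG G(1)] fb by simp
    moreover have "Y a = Y b \<or> Y a = N x - Y b"
    proof -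
      have "p dvd card (Y a \<inter> Y b)"
        using F_Int_N_dvd(2)[OF self_D, of a b] ab by (simp add: Y_def Int_ac)
      then have "card (Y a \<inter> Y b) = 0 \<or> 3 \<le> card (Y a \<inter> Y b)" using ptf by (auto simp: dvd_imp_le)
      then show ?thesis
      proof
        assume "card (Y a \<inter> Y b) = 0"
        then have "Y a \<subseteq> N x - Y b" by (auto simp: Y_def)
        moreover have "card (N x - Y b) = 3"
          using card_Diff_subset[of "Y b" "N x"] cN cY[OF ab(2)] by (auto simp: Y_def)
        ultimately show ?thesis using card_seteq[of "N x - Y b" "Y a"] cY[OF ab(1)] by auto
      next
        assume "3 \<le> card (Y a \<inter> Y b)"
        then have "Y a \<inter> Y b = Y a" "Y a \<inter> Y b = Y b"
          using card_seteq[of "Y a" "Y a \<inter> Y b"] card_seteq[of "Y b" "Y a \<inter> Y b"] cY ab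
          by (auto simp: Y_def)
        then show ?thesis by blast
      qed
    qed
    moreover have "conj b ` Y b = Y b" unfolding Y_def im[OF FD ND] using fb by simp
    moreover have "conj b ` (N x - Y b) = conj b ` N x - conj b ` Y b"
      by (rule inj_on_image_set_diff[of _ "carrier G"])
         (use ND DG bG in \<open>auto intro!: inj_onI simp: Y_def subset_iff\<close>)
    ultimately show ?thesis using fb by metis
  qed
  \<comment> \<open>A further point \<open>b\<close> of \<open>F x - {x}\<close> permutes the other
    three points of this set, \<open>a\<close> and \<open>c\<close> among them, in one
    cycle.\<close>
  have Y_eq: "Y a = Y c" if ac: "a \<in> ?X" "c \<in> ?X" for a c
  proof (cases "a = c")
    case False
    have "card ({x, a, c}) < card (F x)" using cF[OF self_D] by (auto simp: card_insert_if)
    then have "\<not> F x \<subseteq> {x, a, c}" using card_mono[of "{x, a, c}" "F x"] by auto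
    then obtain b where b: "b \<in> F x" "b \<noteq> x" "b \<noteq> a" "b \<noteq> c" by blast
    have bX: "b \<in> ?X" using b by auto
    have bD: "b \<in> D" "a \<in> D" using b ac FD by auto
    have bG: "b \<in> carrier G" "a \<in> carrier G" using DG bD by auto
    have bx: "b \<in> centr x" using b by (auto simp: F_def)
    have bxx: "conj b x = x" using bx x by (simp add: mem_centr_conj)
    have mv: "conj b z \<noteq> z" "conj b z \<in> F x - {b, x}" if "z \<in> F x - {b, x}" for z
    proof -
      have zG: "z \<in> carrier G" using that FD DG by auto
      have "z \<in> F x - centr b" using moved[OF self_D b(1,2)] that by auto
      then show "conj b z \<noteq> z" using zG bG by (auto simp: mem_centr conj_eq_iff)
      have "conj b z \<noteq> x" using conj_inject[OF bG(1) zG x(1)] bxx that by auto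
      moreover have "conj b z \<noteq> b"
        using conj_inject[OF bG(1) zG bG(1)] conj_eq_iff[OF bG(1) bG(1)] that by auto
      ultimately show "conj b z \<in> F x - {b, x}" using centr_invariant[OF bx self_D] that by auto
    qed
    let ?a1 = "conj b a" let ?a2 = "conj b (conj b a)"
    have a: "a \<in> F x - {b, x}" using ac b by auto
    have "b [^] (3::nat) = \<one>" using D_facts(2)[OF bD(1)] ptf by simp
    then have "b \<otimes> b \<otimes> b = \<one>" using bG by (simp add: numeral_3_eq_3)
    then have "conj b ?a2 = a" using bG by (simp add: conj_conj m_assoc)
    then have n: "?a2 \<noteq> a" using mv(1)[OF a] by auto
    have m1: "?a1 \<in> F x - {b, x}" "?a1 \<noteq> a" using mv[OF a] by auto
    have m2: "?a2 \<in> F x - {b, x}" "?a2 \<noteq> ?a1" using mv[OF m1(1)] by auto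
    have "card (F x - {b, x}) = 3" using card_Diff_subset[of "{b, x}" "F x"] b F_self[OF self_D] cF[OF self_D] by simp
    moreover have "card {a, ?a1, ?a2} = 3" using n m1 m2 by auto
    ultimately have e: "{a, ?a1, ?a2} = F x - {b, x}" using a m1 m2 by (intro card_subset_eq) auto
    have "c \<in> F x - {b, x}" using ac b by auto
    then have "c \<in> {a, ?a1, ?a2}" unfolding e .
    then have "c = ?a1 \<or> c = ?a2" using False by blast
    moreover have "Y ?a1 = Y a" using Y_conj[OF ac(1) bX] .
    moreover have "Y ?a2 = Y ?a1" using Y_conj[OF _ bX, of ?a1] m1 by auto
    ultimately show ?thesis by auto
  qed simp
  obtain a where a: "a \<in> ?X"
  proof -
    have "card ?X = 4" using cF[OF self_D] F_self[OF self_D] by simp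
    then show ?thesis using that by (metis all_not_in_conv card.empty zero_neq_numeral)
  qed
  \<comment> \<open>\<open>x\<close> and \<open>Y a\<close> make up one side of a complete bipartite
    piece: four points with the same punctured neighbourhood. Such sets are blocks, but 4 does not
    divide 11.\<close>
  define h where "h y = F y - {y}" for y
  have ch: "card (h y) = 4" if "y \<in> D" for y using cF[OF that] F_self[OF that] by (simp add: h_def)
  have "{z \<in> D. h z = h x} = insert x (Y a)"
  proof
    show "{z \<in> D. h z = h x} \<subseteq> insert x (Y a)"
    proof
      fix z assume z: "z \<in> {z \<in> D. h z = h x}"
      show "z \<in> insert x (Y a)"
      proof (cases "z = x")
        case False
        have "a \<in> F z" using a z by (auto simp: h_def)
        moreover have "z \<notin> F x" using z False by (auto simp: h_def)
        ultimately show ?thesis using z N_iff F_sym by (auto simp: Y_def)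
      qed simp
    qed
    have "h z = h x" if z: "z \<in> Y a" for z
    proof -
      have zD: "z \<in> D" using z ND by (auto simp: Y_def)
      have "u \<in> h z" if u: "u \<in> h x" for u
      proof -
        have "z \<in> Y u" using Y_eq[of u a] a z u by (auto simp: h_def)
        then show ?thesis using u F_sym[of u z] FD FNd by (auto simp: Y_def h_def)
      qed
      then have "h x \<subseteq> h z" by blast
      then show ?thesis using ch zD card_subset_eq[of "h z" "h x"] by (auto simp: h_def)
    qed
    then show "insert x (Y a) \<subseteq> {z \<in> D. h z = h x}" using ND by (auto simp: Y_def)
  qed
  moreover have "card (insert x (Y a)) = 4" using cY[OF a] FNd F_self[OF self_D] by (auto simp: Y_def card_insert_if)
  ultimately have "card {z \<in> D. h z = h x} = 4" by simp
  moreover have "card {z \<in> D. h z = h x} * card (h ` D) = card D"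
  proof (rule invariant_partition[OF x(1)])
    fix g y z assume g: "g \<in> carrier G" "y \<in> D" "z \<in> D" "h y = h z"
    have "h (conj g y) = conj g ` h y" if "y \<in> D" for y
    proof -
      have "conj g ` (F y - {y}) = conj g ` F y - conj g ` {y}"
        by (rule inj_on_image_set_diff[of _ "carrier G"])
           (use FD DG that g in \<open>auto intro!: inj_onI simp: subset_iff\<close>)
      then show ?thesis using F_conj[OF g(1) that] by (simp add: h_def)
    qed
    then show "h (conj g y) = h (conj g z)" using g by simp
  qed
  ultimately have "4 dvd (11::nat)" using cD by (metis dvd_triv_left)
  then show False by simp
qed


text \<open>Any two elements of \<open>D\<close> generate a dihedral group of order 6, which makes \<open>D\<close> a Steiner triple
  system. As there is no subsystem of size 5, no involution centralizes two elements of \<open>D\<close>, and a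
  Sylow 2-subgroup acts semiregularly on 8 points.\<close>

lemma no_class_2_1_4:
  assumes p2: "p = 2" and f1: "f = 1" and t4: "t = 4"
    and mn: "\<And>w. w \<in> carrier G \<Longrightarrow> w \<noteq> \<one> \<Longrightarrow> card D \<le> card (cls w)"
  shows False
proof -
  have "card D = f + p * 4" using card_D t4 by simp
  then have cD: "card D = 9" using p2 f1 by simp
  have F1: "F y = {y}" if "y \<in> D" for y
    using card_F[OF that] F_self[OF that] f1 by (auto simp: card_1_singleton_iff)
  have inv: "y \<otimes> y = \<one>" if "y \<in> D" for y
    using D_facts(2)[OF that] p2 DG[OF that] by (simp add: numeral_2_eq_2)
  have cG: "card (carrier G) = 9 * card (centr x)" using cls_centr[OF x(1)] cD by simp
  have primes: "q = 2 \<or> q = 3" if q: "prime q" "q dvd card (carrier G)" for q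
  proof -
    have "q dvd 9 \<or> q dvd card (centr x)" using q cG prime_dvd_mult_iff by metis
    moreover have "q = 3" if "q dvd 9"
    proof -
      have "q dvd 3 ^ 2" using that by simp
      then show ?thesis using q(1) prime_dvd_power[of q 3 2] primes_dvd_imp_eq[of q 3] by simp
    qed
    moreover have "q \<le> 4 \<Longrightarrow> q = 2 \<or> q = 3"
    proof -
      assume "q \<le> 4"
      moreover have "q \<noteq> 4" using q(1) by auto
      ultimately show ?thesis using prime_ge_2_nat[OF q(1)] by auto
    qed
    ultimately show ?thesis using prime_dvd_centr[OF q(1)] p2 t4 by auto
  qed
  have cinv: "conj y z = y \<otimes> z \<otimes> y" if "y \<in> D" "z \<in> D" for y z
    using inv_unique'[of y y] inv[OF that(1)] DG[OF that(1)] by (simp add: conj_def)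
  have nc: "conj y z \<noteq> z" if "y \<in> D" "z \<in> D" "y \<noteq> z" for y z
    using F1[OF that(2)] that DG conj_eq_iff by (auto simp: F_def mem_centr)
  \<comment> \<open>The elements \<open>y \<otimes> c [^] n\<close> are the reflections of the
    dihedral group generated by \<open>y\<close> and \<open>z\<close>. If \<open>c\<close> had even
    order, its power of order 2 times \<open>y\<close> would be a second reflection commuting with
    \<open>y\<close>, against \<open>f = 1\<close>. Only the orders 3 and 9 remain, and order 3 is
    the asserted relation.\<close>
  have braid: "conj y z = conj z y" if yz: "y \<in> D" "z \<in> D" for y z
  proof (cases "y = z")
    case False
    have G: "y \<in> carrier G" "z \<in> carrier G" using yz DG by auto
    define c where "c = y \<otimes> z"
    have cG': "c \<in> carrier G" using G by (simp add: c_def)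
    have ci: "inv y = y" "inv z = z" "y \<otimes> y = \<one>" "z \<otimes> z = \<one>" 
      using inv_unique'[of y y] inv_unique'[of z z] inv yz G by auto
    have yc: "conj y c = inv c" using G ci
      by (simp add: conj_def c_def inv_mult_group m_assoc[symmetric])
    have ycn: "conj y (c [^] n) = inv c [^] n" for n :: nat using yc G cG' by (simp add: conj_pow)
    have mem: "y \<otimes> c [^] n \<in> D \<and> y \<otimes> c [^] Suc n \<in> D" for n :: nat
    proof (induction n)
      case 0
      have "y \<otimes> c [^] Suc 0 = z" using G ci by (simp add: c_def m_assoc[symmetric])
      then show ?case using yz G by simp
    next
      case (Suc n)
      let ?d = "y \<otimes> c [^] n" and ?e = "y \<otimes> c [^] Suc n"
      have dG: "?d \<in> carrier G" "?e \<in> carrier G" using G cG' by auto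
      have ye: "y \<otimes> (c [^] k \<otimes> y) = inv c [^] k" for k :: nat
        using ycn[of k] ci G cG' by (simp add: conj_def m_assoc)
      \<comment> \<open>Conjugating one reflection by the next gives the one after it, so all of
        them stay in \<open>D\<close>.\<close>
      have "conj ?e ?d = ?e \<otimes> ?d \<otimes> ?e" using cinv Suc by blast
      also have "\<dots> = (y \<otimes> (c [^] Suc n \<otimes> y)) \<otimes> c [^] n \<otimes> (y \<otimes> c [^] Suc n)"
        using G cG' by (simp add: m_assoc del: nat_pow_Suc)
      also have "\<dots> = inv c \<otimes> (inv c [^] n \<otimes> c [^] n) \<otimes> (y \<otimes> c [^] Suc n)"
        using G cG' ye[of "Suc n"] nat_pow_Suc2[of "inv c" n] by (simp add: m_assoc del: nat_pow_Suc)
      also have "\<dots> = inv c \<otimes> y \<otimes> c [^] Suc n"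
        using G cG' by (simp add: nat_pow_inv m_assoc del: nat_pow_Suc)
      also have "inv c \<otimes> y = y \<otimes> c" using yc ci G cG' by (simp add: conj_def m_assoc flip: yc)
      also have "y \<otimes> c \<otimes> c [^] Suc n = y \<otimes> c [^] Suc (Suc n)"
        using G cG' nat_pow_Suc2[of c "Suc n"] by (simp add: m_assoc del: nat_pow_Suc)
      finally have "y \<otimes> c [^] Suc (Suc n) \<in> D" using D_conj[OF dG(2), of ?d] Suc by metis
      then show ?case using Suc by blast
    qed
    let ?m = "ord c"
    have c1: "c \<noteq> \<one>" using False G ci inv_unique'[of y z] by (metis c_def inv_equality)
    have m0: "?m > 0" using ord_ge_1[OF fin cG'] by simp
    have "odd ?m"
    proof
      assume "even ?m"
      then have pe: "c [^] (?m div 2) \<noteq> \<one>" "(c [^] (?m div 2)) [^] (2::nat) = \<one>"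
        using prime_power_elem[OF cG' c1 two_is_prime_nat] by auto
      let ?v = "c [^] (?m div 2)"
      have vG: "?v \<in> carrier G" using cG' by simp
      have "?v \<otimes> ?v = \<one>" using pe(2) vG by (simp add: numeral_2_eq_2)
      then have "inv ?v = ?v" using inv_unique'[OF vG vG] by simp
      then have "conj y ?v = ?v" using ycn cG' by (simp add: nat_pow_inv)
      then have "y \<otimes> ?v = ?v \<otimes> y" using conj_eq_iff G vG by simp
      then have "y \<otimes> (y \<otimes> ?v) = (y \<otimes> ?v) \<otimes> y" using G vG by (metis m_assoc)
      then have "y \<otimes> ?v \<in> F y" using mem G vG by (simp add: F_def mem_centr)
      then have "y \<otimes> ?v = y" using F1[OF yz(1)] by blast
      then have "y \<otimes> ?v = y \<otimes> \<one>" using G by simp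
      then show False using pe(1) G vG by (metis Units_eq Units_l_cancel one_closed)
    qed
    have inj: "inj_on (\<lambda>n. y \<otimes> c [^] n) {..<?m}"
    proof (rule inj_onI)
      fix i j assume ij: "i \<in> {..<?m}" "j \<in> {..<?m}" "y \<otimes> c [^] i = y \<otimes> c [^] j"
      then have "c [^] i = c [^] j" using G cG' by (metis Units_eq Units_l_cancel nat_pow_closed)
      then show "i = j" using ord_inj[OF cG'] ij by (auto simp: inj_on_def)
    qed
    have sub: "(\<lambda>n. y \<otimes> c [^] n) ` {..<?m} \<subseteq> D" using mem by blast
    have m9: "?m \<le> 9" using card_inj_on_le[OF inj sub finD(1)] cD by simp
    have mG: "?m dvd card (carrier G)" using ord_dvd_group_order[OF cG'] by (simp add: Coset.order_def)
    have n57: "?m \<noteq> 5" "?m \<noteq> 7" using primes[of 5] primes[of 7] mG by auto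
    have "?m \<noteq> 1" using c1 ord_eq_1[OF cG'] by simp
    then have "?m = 3 \<or> ?m = 9" using m0 m9 n57 \<open>odd ?m\<close> by (cases "?m \<in> {0,2,4,6,8}") auto
    moreover have "?m \<noteq> 9"
    proof
      assume m: "?m = 9"
      \<comment> \<open>Nine reflections exhaust \<open>D\<close>, and each inverts
        \<open>c\<close>. As \<open>D\<close> generates \<open>G\<close>, the class of
        \<open>c\<close> lies in \<open>{c, inv c}\<close>, too small for \<open>mn\<close>.\<close>
      have De: "(\<lambda>n. y \<otimes> c [^] n) ` {..<?m} = D"
        by (rule card_subset_eq[OF finD(1) sub]) (simp add: card_image[OF inj] cD, simp add: m)
      let ?K = "{g \<in> carrier G. conj g c \<in> {c, inv c}}"
      have K: "subgroup ?K G"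
      proof (rule subgroupI)
        show "?K \<noteq> {}" using cG' by (auto intro!: exI[of _ \<one>])
        show "inv a \<in> ?K" if a: "a \<in> ?K" for a
        proof -
          have aG: "a \<in> carrier G" and "conj a c = c \<or> conj a c = inv c" using a by auto
          then have "c = conj (inv a) c \<or> c = conj (inv a) (inv c)" using cG' by (metis conj_inv_conj(1))
          then show ?thesis using aG cG' by (auto simp: conj_inv) (metis inv_inv conj_closed inv_closed)
        qed
        show "a \<otimes> b \<in> ?K" if a: "a \<in> ?K" "b \<in> ?K" for a b
          using a cG' by (auto simp: conj_inv simp flip: conj_conj)
      qed auto
      have "D \<subseteq> ?K"
      proof
        fix d assume d: "d \<in> D"
        then obtain n :: nat where n: "d = y \<otimes> c [^] n" using De by blast
        have "conj (c [^] n) c = c" using cG' by (simp add: conj_eq_iff nat_pow_comm[of c n 1, simplified])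
        then have "conj d c = inv c" unfolding n using yc G cG' by (simp flip: conj_conj)
        then show "d \<in> ?K" using DG[OF d] by blast
      qed
      then have "?K = carrier G" using cls_generates[OF x K] by blast
      then have "cls c \<subseteq> {c, inv c}" unfolding cls_def by blast
      then have "card (cls c) \<le> card {c, inv c}" by (intro card_mono) auto
      also have "\<dots> \<le> 2" by (simp add: card_insert_if)
      finally show False using mn[OF cG' c1] cD by simp
    qed
    ultimately have "c [^] (3::nat) = \<one>" using pow_ord_eq_1[OF cG'] by metis
    then have "y \<otimes> z \<otimes> (y \<otimes> z) \<otimes> (y \<otimes> z) = \<one>" using cG' by (simp add: numeral_3_eq_3 c_def)
    then have "(y \<otimes> z \<otimes> y) \<otimes> (z \<otimes> y \<otimes> z) = \<one>" using G by (simp add: m_assoc)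
    then have "inv (z \<otimes> y \<otimes> z) = y \<otimes> z \<otimes> y" using G by (intro inv_equality) auto
    moreover have "inv (z \<otimes> y \<otimes> z) = z \<otimes> y \<otimes> z" using G ci by (simp add: inv_mult_group m_assoc)
    ultimately show ?thesis using cinv yz by simp
  qed simp
  have two: "w = \<one>" if w: "w \<in> carrier G" "w \<otimes> w = \<one>" "w \<in> centr y" "w \<in> centr z" and yz: "y \<in> D" "z \<in> D" "y \<noteq> z" for w y z
  proof (rule ccontr)
    assume w1: "w \<noteq> \<one>"
    let ?X = "D \<inter> centr w"
    have X: "u \<in> ?X \<longleftrightarrow> u \<in> D \<and> w \<in> centr u" for u using w(1) DG by (auto simp: mem_centr)
    \<comment> \<open>The involution moves a multiple of 4 points out of 9, not all points are
      fixed, and at least two are: exactly five are.\<close>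
    have "card ?X + card (D - centr w) = card D"
      using card_Un_disjoint[of ?X "D - centr w"] by (simp add: Int_Diff_Un Int_Diff_disjoint)
    moreover have "4 dvd card (D - centr w)" using involution_moves_four_cls[OF x(1) w(1,2)] .
    moreover have "card ?X \<noteq> 9"
      using centralizes_cls[OF x w(1)] w1 card_subset_eq[of D ?X] cD by auto
    moreover have "card {y, z} \<le> card ?X" using X yz w by (intro card_mono) auto
    then have "card ?X \<ge> 2" using yz by simp
    ultimately have cX: "card ?X = 5" using cD by presburger
    have cl: "conj a b \<in> ?X" if "a \<in> ?X" "b \<in> ?X" for a b
    proof -
      have G: "a \<in> carrier G" "b \<in> carrier G" using that DG by auto
      have "conj a w = w" using that(1) w(1) G by (auto simp: mem_centr conj_eq_iff)
      then have "conj a b \<in> centr w" using conj_mem_centr_iff[OF G w(1)] that by auto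
      then show ?thesis using that D_conj G by auto
    qed
    let ?e = "conj y z"
    have yzX: "y \<in> ?X" "z \<in> ?X" using X yz w by auto
    have inj: "conj a b = conj a d \<longleftrightarrow> b = d" if "a \<in> D" "b \<in> D" "d \<in> D" for a b d
      using that DG by simp
    have fixs: "conj a a = a" if "a \<in> D" for a using that DG by (simp add: conj_eq_iff)
    have "\<not> ?X \<subseteq> {y, z, ?e}" using card_mono[of "{y, z, ?e}" ?X] cX by (auto simp: card_insert_if split: if_splits)
    then obtain u where u: "u \<in> ?X" "u \<noteq> y" "u \<noteq> z" "u \<noteq> ?e" by blast
    let ?v = "conj y u"
    have in_D: "u \<in> D" "?e \<in> D" "?v \<in> D" using u yzX cl by auto
    have e: "?e \<noteq> y" "?e \<noteq> z" using nc[OF yz] inj[OF yz(1,2,1)] fixs[OF yz(1)] yz by auto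
    have ii: "conj y (conj y z) = z" using inv yz DG by (simp add: conj_conj)
    have v: "?v \<noteq> y" "?v \<noteq> u" "?v \<noteq> z" "?v \<noteq> ?e"
      using inj[OF yz(1) in_D(1) yz(1)] fixs[OF yz(1)] u nc[OF yz(1) in_D(1)]
        inj[OF yz(1) in_D(1,2)] ii inj[OF yz(1) in_D(1) yz(2)] by auto
    have "card {y, z, ?e, u, ?v} = 5" using e u v yz(3) by (auto simp: card_insert_if)
    then have Xe: "{y, z, ?e, u, ?v} = ?X" 
      using cX yzX u cl by (intro card_subset_eq) auto
    \<comment> \<open>\<open>?k\<close> completes \<open>z\<close> and \<open>u\<close> to a triple
      inside the five points. Every place but \<open>?v\<close> is taken, and \<open>?k = ?v\<close>
      would make \<open>u\<close> complete with \<open>y\<close> and with \<open>z\<close> to the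
      same triple.\<close>
    let ?k = "conj z u"
    have "?k \<in> ?X" using cl yzX u by blast
    then have "?k \<in> {y, z, ?e, u, ?v}" unfolding Xe .
    moreover have "?k \<noteq> z" using inj[OF yz(2) in_D(1) yz(2)] fixs[OF yz(2)] u by auto
    moreover have "?k \<noteq> u" using nc[OF yz(2) in_D(1)] u by auto
    moreover have "?k \<noteq> ?e" using braid[OF yz(1,2)] inj[OF yz(2) in_D(1) yz(1)] u by auto
    moreover have "?k \<noteq> y"
    proof
      assume "?k = y"
      then have "conj z ?k = conj z y" by simp
      moreover have "conj z ?k = u" using inv yz DG in_D by (simp add: conj_conj)
      ultimately show False using braid[OF yz(1,2)] u by auto
    qed
    ultimately have "conj z u = conj y u" by blast
    then have "conj u z = conj u y" using braid in_D yz by metis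
    then show False using inj[OF in_D(1) yz(2,1)] yz by auto
  qed
  obtain P k where P: "subgroup P G" "card P = 2 ^ k" "\<not> 2 dvd card (carrier G) div 2 ^ k"
    "2 ^ k dvd card (carrier G)" using sylow[OF two_is_prime_nat] by metis
  have PG: "P \<subseteq> carrier G" using subgroup.subset[OF P(1)] .
  \<comment> \<open>The 2-group \<open>P\<close> must fix a point, as 9 is odd.\<close>
  have "card D mod 2 = card {z \<in> D. P \<subseteq> centr z} mod 2"
    by (rule subgroup_fixed_points[OF P(1) two_is_prime_nat P(2)]) (use DG D_conj PG in auto)
  then have ne: "card {z \<in> D. P \<subseteq> centr z} \<noteq> 0" using cD by (intro notI) simp
  have "{z \<in> D. P \<subseteq> centr z} \<noteq> {}"
  proof
    assume "{z \<in> D. P \<subseteq> centr z} = {}"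
    then show False using ne by (metis card.empty)
  qed
  then obtain y where y: "y \<in> D" "P \<subseteq> centr y" by blast
  have "2 ^ k dvd (8::nat)"
  proof -
    have cl: "conj g z \<in> D - {y}" if "g \<in> P" "z \<in> D - {y}" for g z
    proof -
      have "g \<in> carrier G" "conj g y = y" using that y PG DG by (auto simp: mem_centr_conj subset_iff)
      then show ?thesis using that conj_inject[of g z y] D_conj[of g z] DG y by auto
    qed
    interpret A: action "G\<lparr>carrier := P\<rparr>" "D - {y}" conj
      by (rule action_subgroup[OF P(1)]) (use cl PG DG in \<open>auto simp: conj_conj subset_iff\<close>)
    \<comment> \<open>An element of \<open>P\<close> that fixes \<open>y\<close> and a second point
      has an involution among its powers if it is nontrivial, and this involution contradicts
      \<open>two\<close>.\<close>
    have "card P dvd card (D - {y})"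
    proof (rule A.semiregular_card_dvd[simplified])
      fix g z assume g: "g \<in> P" and z: "z \<in> D \<and> z \<noteq> y" "conj g z = z"
      show "g = \<one>"
      proof (rule ccontr)
        assume g1: "g \<noteq> \<one>"
        have gG: "g \<in> carrier G" using g PG by blast
        obtain n :: nat and q where q: "prime q" "q dvd ord g" "g [^] n \<noteq> \<one>" "(g [^] n) [^] q = \<one>"
          using ex_prime_power[OF gG g1] by blast
        have "q dvd 2 ^ k" using ord_dvd_subgroup[OF P(1) g] q(2) P(2) by (auto intro: dvd_trans)
        then have "q = 2" using q(1) by (meson prime_dvd_power primes_dvd_imp_eq two_is_prime_nat)
        then have sq: "g [^] n \<otimes> g [^] n = \<one>" using q(4) gG by (simp add: numeral_2_eq_2)
        have "g \<in> centr y" "g \<in> centr z" using g y z gG DG by (auto simp: mem_centr_conj)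
        then have "g [^] n \<in> centr y" "g [^] n \<in> centr z"
          using centr_pow_subset[OF gG, of n] y z DG gG by (auto simp: mem_centr subset_iff)
        then show False using two[OF _ sq _ _ y(1)] z q(3) gG by auto
      qed
    qed
    then show ?thesis using P(2) cD y by simp
  qed
  then have k8: "2 ^ k \<le> (8::nat)" by (rule dvd_imp_le) simp
  \<comment> \<open>A class of size prime to 3 has a power of 2 as its size, at most the order of
    \<open>P\<close>, hence at most 8 and below the minimum 9.\<close>
  have "3 dvd card (carrier G)" using cG by simp
  then obtain w where w: "w \<in> carrier G" "w \<noteq> \<one>" "\<not> 3 dvd card (cls w)"
    using ex_p_central[of 3] by auto
  obtain j where j: "card (cls w) = 2 ^ j"
    by (rule prime_power_of_unique_prime[of "card (cls w)" 2])
       (use card_cls_pos[OF w(1)] primes w cls_dvd[OF w(1)] in \<open>auto dest: dvd_trans\<close>)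
  have "j \<le> k"
  proof (rule ccontr)
    assume "\<not> j \<le> k"
    then have "2 ^ Suc k dvd (2::nat) ^ j" by (intro le_imp_power_dvd) simp
    then have "2 ^ Suc k dvd card (carrier G)" using cls_dvd[OF w(1)] j by (metis dvd_trans)
    then have "2 dvd card (carrier G) div 2 ^ k" using P(4) by (auto elim!: dvdE)
    then show False using P(3) by blast
  qed
  then have "(2::nat) ^ j \<le> 2 ^ k" by (rule power_increasing) simp
  moreover have "9 \<le> (2::nat) ^ j" using mn[OF w(1,2)] j cD by simp
  ultimately show False using k8 by linarith
qed

end

section \<open>The lower bound 12 for nontrivial class sizes\<close>

context nonabelian_simple
begin

text \<open>A power of prime order of an element with smallest class again has a smallest class, so
  the machinery of \<open>prime_class\<close> applies with \<open>f + p * t \<le> 11\<close>. A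
  single cycle is impossible, since \<open>one_cycle\<close> gives a union of classes with only
  \<open>p\<close> elements; so \<open>t \<ge> 2\<close> and \<open>p \<le> 5\<close>, and the
  triples are excluded one by one.\<close>

lemma card_cls_ge_12:
  assumes w: "w \<in> carrier G" "w \<noteq> \<one>"
  shows "12 \<le> card (cls w)"
proof (rule ccontr)
  assume c12: "\<not> 12 \<le> card (cls w)"
  obtain g where g: "g \<in> carrier G" "g \<noteq> \<one>"
    and gm: "\<And>v. v \<in> carrier G \<Longrightarrow> v \<noteq> \<one> \<Longrightarrow> card (cls g) \<le> card (cls v)"
    using ex_has_least_nat[of "\<lambda>g. g \<in> carrier G \<and> g \<noteq> \<one>" w "\<lambda>g. card (cls g)"] w by blast
  obtain n :: nat and p :: nat where np: "prime p" "g [^] n \<noteq> \<one>" "(g [^] n) [^] p = \<one>"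
    using ex_prime_power[OF g] by blast
  define x where "x = g [^] n"
  have xG: "x \<in> carrier G" "x \<noteq> \<one>" using g np by (auto simp: x_def)
  interpret prime_class G x p
    by unfold_locales (use xG np in \<open>auto simp: x_def\<close>)
  have "card D \<le> card (cls g)"
    using cls_mono_centr[OF g(1) xG(1)] centr_pow_subset[OF g(1)] card_cls_pos[OF g(1)]
    by (simp add: x_def dvd_imp_le)
  then have mn: "card D \<le> card (cls v)" if "v \<in> carrier G" "v \<noteq> \<one>" for v
    using gm[OF that] by simp
  define T where "T = t"
  have cDT: "card D = f + p * T" using card_D by (simp add: T_def)
  have d11: "f + p * T \<le> 11" using mn[OF w] c12 cDT by simp
  have cG: "card (carrier G) = card D * card (centr x)" using cls_centr[OF xG(1)] by simp
  have cpos: "card (centr x) > 0" using card_centr_pos[OF xG(1)] .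
  have "t \<noteq> 1"
  proof
    assume t1: "t = 1"
    obtain W where W: "W \<subseteq> carrier G" "card W = p" "\<forall>w\<in>W. w \<noteq> \<one> \<and> cls w \<subseteq> W"
      using one_cycle(5)[OF t1] by blast
    have fW: "finite W" using W(1) fin finite_subset by blast
    obtain v where v: "v \<in> W" using W(2) prime_gt_0_nat[OF p] by (metis all_not_in_conv card.empty less_irrefl)
    then have "card (cls v) \<le> p" using card_mono[OF fW, of "cls v"] W by auto
    then show False using mn[of v] v W one_cycle(3)[OF t1] by auto
  qed
  then have t2: "T \<ge> 2" using t_pos by (simp add: T_def)
  have blk: "f dvd f + p * T" "card (carrier G) dvd fact ((f + p * T) div f)" if "f < p + 2"
  proof -
    have "f * card (F ` D) = f + p * T" using card_blocks[OF that] cDT by simp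
    then show "f dvd f + p * T" by (metis dvd_triv_left)
    have "card (F ` D) = (f + p * T) div f" using \<open>f * card (F ` D) = f + p * T\<close> f_pos by (metis nonzero_mult_div_cancel_left less_irrefl)
    then show "card (carrier G) dvd fact ((f + p * T) div f)" using blocks_fact[OF that] by simp
  qed
  have dvdG: "(f + p * T) * p dvd card (carrier G)" using cG cDT p_dvd_centr by (simp add: mult_dvd_mono)
  \<comment> \<open>Some class of a nontrivial element has odd size, which must not be below the
    minimum \<open>card D\<close>.\<close>
  have small_odd: False if even: "2 dvd card (carrier G)" and odd: "\<And>c. odd c \<Longrightarrow> c dvd card (carrier G) \<Longrightarrow> c < card D"
  proof -
    obtain v where v: "v \<in> carrier G" "v \<noteq> \<one>" "\<not> 2 dvd card (cls v)"
      using ex_p_central[OF two_is_prime_nat even] by blast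
    then show False using mn[OF v(1,2)] odd[of "card (cls v)"] cls_dvd[OF v(1)] by auto
  qed
  have centr_pow: "\<exists>b. card (centr x) = q ^ b" if q: "prime q" "\<And>r. prime r \<Longrightarrow> r dvd card (centr x) \<Longrightarrow> r = q" for q
    using prime_power_of_unique_prime[OF cpos q] by metis
  have pd: False if "prime r" "f + p * T = r" "card (centr x) = q ^ b" "prime q" "q \<noteq> r"
    "\<And>j. j > 0 \<Longrightarrow> q ^ j mod r = 1 \<Longrightarrow> q ^ j dvd fact (r - 1) \<Longrightarrow> False" for r q b
  proof -
    have 1: "card D = r" using that(2) cDT by simp
    have 2: "card (carrier G) = r * q ^ b" using cG 1 that(3) by simp
    show False using prime_size[OF that(1) 1 2 that(4,5)] mn that(6) 1 by (metis)
  qed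
  have inv_free: "\<not> 2 dvd card (centr x)" if "odd p" "f = 1" "T \<le> 3"
  proof
    assume "2 dvd card (centr x)"
    then obtain v where v: "v \<in> centr x" "v \<noteq> \<one>" "v [^] (2::nat) = \<one>"
      using cauchy[OF centr_subgroup[OF xG(1)] two_is_prime_nat] by metis
    have vG: "v \<in> carrier G" using v by (simp add: mem_centr)
    then have "v \<otimes> v = \<one>" using v(3) by (simp add: numeral_2_eq_2)
    then show False using involution_no_fixed[OF that[unfolded T_def] vG _ self_D v(1)] v by blast
  qed
  have pow_le: "j \<le> k" if "\<not> q ^ Suc k dvd m" "q ^ j dvd m" for q j k m :: nat
    using that by (meson dvd_trans le_imp_power_dvd not_less_eq_eq)
  have rT: "r = p \<or> r \<le> T" if "prime r" "r dvd card (centr x)" for r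
    using prime_dvd_centr[OF that] by (simp add: T_def)
  have pair: False if "p = 2" "f = 2"
    using involution_pair[OF that] mn by (meson leD)
  have p5: "p = 2 \<or> p = 3 \<or> p = 5"
  proof -
    have "p * 2 \<le> p * T" using t2 by simp
    then have "p \<le> 5" using d11 f_pos by linarith
    moreover have "p \<noteq> 4" using p by auto
    ultimately show ?thesis using prime_ge_2_nat[OF p] by auto
  qed
  have T_even: "even T" if "p = 2" using involution_t_even[OF that] by (simp add: T_def)
  consider (a) "p = 2" "T = 2" | (b) "p = 2" "T = 4" | (c) "p = 3" "T = 2" | (d) "p = 3" "T = 3" | (e) "p = 5" "T = 2"
  proof -
    have "T = 2 \<or> T = 4" if "p = 2"
    proof -
      have "T \<le> 5" using d11 f_pos that by simp
      moreover have "T \<noteq> 3" "T \<noteq> 5" using T_even[OF that] by auto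
      ultimately show ?thesis using t2 by auto
    qed
    moreover have "T = 2 \<or> T = 3" if "p = 3" using d11 f_pos t2 that by auto
    moreover have "T = 2" if "p = 5" using d11 f_pos t2 that by auto
    ultimately show ?thesis using p5 that by blast
  qed
  then show False
  proof cases
    case a
    have "r = 2" if "prime r" "r dvd card (centr x)" for r
      using rT[OF that] a prime_ge_2_nat[OF that(1)] by auto
    then obtain b where b: "card (centr x) = 2 ^ b" using centr_pow[OF two_is_prime_nat] by blast
    have "f = 1 \<or> f = 2 \<or> f = 3 \<or> f = 4 \<or> f = 5 \<or> f = 6 \<or> f = 7" using d11 f_pos a by auto
    then show False
    proof (elim disjE)
      assume f: "f = 1"
      \<comment> \<open>2 has order 4 modulo 5, but 4! contains only three factors 2.\<close>
      have nj: "False" if "j > 0" "2 ^ j mod 5 = (1::nat)" "2 ^ j dvd (fact (5 - 1) :: nat)" for j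
      proof -
        have "j \<le> 3" by (rule pow_le[OF _ that(3)]) (simp add: fact_numeral)
        then have "j = 1 \<or> j = 2 \<or> j = 3" using that(1) by auto
        then show False using that(2) by auto
      qed
      show False by (rule pd[of 5 2 b, OF _ _ b _ _ nj]) (use f a in simp_all)
    next
      assume "f = 2" then show False using pair a by simp
    next
      assume "f = 3" then show False using blk(1) a by simp
    next
      assume "f = 4"
      then have "card (carrier G) = 2 ^ (b + 3)" using cG cDT a b by (simp add: power_add)
      then show False using not_p_group[OF two_is_prime_nat] by blast
    next
      assume "f = 5" then show False using no_class_2_5_2 a by (simp add: T_def)
    next
      assume f: "f = 6"
      have e: "card (carrier G) = 5 * 2 ^ Suc b" using cG cDT a b f by simp
      show False
      proof (rule small_odd)
        fix c :: nat assume c: "odd c" "c dvd card (carrier G)"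
        have "coprime c (2 ^ Suc b)" using c(1) by simp
        then have "c dvd 5" using c(2) unfolding e by (metis coprime_dvd_mult_left_iff)
        then show "c < card D" using cDT a f by (auto dest: dvd_imp_le)
      qed (simp add: e)
    next
      assume f: "f = 7"
      \<comment> \<open>2 has order 10 modulo 11, but 10! contains only eight factors 2.\<close>
      have nj: "False" if "j > 0" "2 ^ j mod 11 = (1::nat)" "2 ^ j dvd (fact (11 - 1) :: nat)" for j
      proof -
        have "j \<le> 8" by (rule pow_le[OF _ that(3)]) (simp add: fact_numeral)
        then have "j = 1 \<or> j = 2 \<or> j = 3 \<or> j = 4 \<or> j = 5 \<or> j = 6 \<or> j = 7 \<or> j = 8" using that(1) by auto
        then show False using that(2) by auto
      qed
      show False by (rule pd[of 11 2 b, OF _ _ b _ _ nj]) (use f a in simp_all)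
    qed
  next
    case b
    have "f = 1 \<or> f = 2 \<or> f = 3" using d11 f_pos b by auto
    then show False
    proof (elim disjE)
      assume "f = 1" then show False using no_class_2_1_4 b mn by (simp add: T_def)
    next
      assume "f = 2" then show False using pair b by simp
    next
      assume "f = 3" then show False using blk(1) b by simp
    qed
  next
    case c
    have "f = 1 \<or> f = 2 \<or> f = 3 \<or> f = 4 \<or> f = 5" using d11 f_pos c by auto
    then show False
    proof (elim disjE)
      assume f: "f = 1"
      have "r = 3" if r: "prime r" "r dvd card (centr x)" for r
      proof -
        have "r \<noteq> 2" using inv_free c f r by auto
        then show ?thesis using rT[OF r] c prime_ge_2_nat[OF r(1)] by auto
      qed
      then obtain b where b: "card (centr x) = 3 ^ b" using centr_pow[of 3] by auto
      \<comment> \<open>3 has order 6 modulo 7, but 6! contains only two factors 3.\<close>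
      have nj: "False" if "j > 0" "3 ^ j mod 7 = (1::nat)" "3 ^ j dvd (fact (7 - 1) :: nat)" for j
      proof -
        have "j \<le> 2" by (rule pow_le[OF _ that(3)]) (simp add: fact_numeral)
        then have "j = 1 \<or> j = 2" using that(1) by auto
        then show False using that(2) by auto
      qed
      show False by (rule pd[of 7 3 b, OF _ _ b _ _ nj]) (use f c in simp_all)
    next
      assume f: "f = 2"
      \<comment> \<open>The eight elements of \<open>D\<close> form four blocks, and
        \<open>G\<close> acts faithfully on these.\<close>
      have "card (carrier G) dvd 24" using blk(2) c f by (simp add: fact_numeral)
      moreover have "24 dvd card (carrier G)" using dvdG c f by simp
      ultimately have e: "card (carrier G) = 24" by (rule dvd_antisym)
      show False
      proof (rule small_odd)
        fix k :: nat assume k: "odd k" "k dvd card (carrier G)"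
        have "coprime k (2 ^ 3)" unfolding coprime_power_right_iff using k(1) by simp
        moreover have "k dvd 3 * 2 ^ 3" using k(2) e by simp
        ultimately have "k dvd 3" by (metis coprime_dvd_mult_left_iff)
        then show "k < card D" using cDT c f by (auto dest: dvd_imp_le)
      qed (simp add: e)
    next
      assume f: "f = 3"
      have "card (carrier G) dvd 6" using blk(2) c f by (simp add: fact_numeral)
      moreover have "27 dvd card (carrier G)" using dvdG c f by simp
      ultimately have "27 dvd (6::nat)" by (rule dvd_trans[rotated])
      then show False by simp
    next
      assume "f = 4" then show False using blk(1) c by simp
    next
      assume "f = 5" then show False using no_class_3_5_2 c by (simp add: T_def)
    qed
  next
    case d
    have "f = 1 \<or> f = 2" using d11 f_pos d by auto
    then show False
    proof
      assume f: "f = 1"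
      \<comment> \<open>Here \<open>card D = 10\<close>. An involution centralizes no element of
        \<open>D\<close>, so it would move all ten points, which is not a multiple of 4.\<close>
      have "2 dvd card (carrier G)" using cG cDT d f by simp
      then obtain v where v: "v \<in> carrier G" "v \<noteq> \<one>" "v [^] (2::nat) = \<one>"
        using cauchy[OF subgroup_self two_is_prime_nat] by metis
      then have vv: "v \<otimes> v = \<one>" by (simp add: numeral_2_eq_2)
      have "y \<notin> centr v" if y: "y \<in> D" for y
      proof
        assume "y \<in> centr v"
        then have "v \<in> centr y" using v by (auto simp: mem_centr)
        then show False using involution_no_fixed[OF _ f _ v(1) vv y] d v by (simp add: T_def)
      qed
      then have "D - centr v = D" by blast
      then have "4 dvd card D" using involution_moves_four_cls[OF xG(1) v(1) vv] by simp
      then show False using cDT d f by simp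
    next
      assume "f = 2" then show False using blk(1) d by simp
    qed
  next
    case e
    have f: "f = 1" using d11 f_pos e by auto
    have "r = 5" if r: "prime r" "r dvd card (centr x)" for r
    proof -
      have "r \<noteq> 2" using inv_free e f r by auto
      then show ?thesis using rT[OF r] e prime_ge_2_nat[OF r(1)] by auto
    qed
    then obtain b where b: "card (centr x) = 5 ^ b" using centr_pow[of 5] by auto
    \<comment> \<open>5 has order 5 modulo 11, but 10! contains only two factors 5.\<close>
    have nj: "False" if "j > 0" "5 ^ j mod 11 = (1::nat)" "5 ^ j dvd (fact (11 - 1) :: nat)" for j
    proof -
      have "j \<le> 2" by (rule pow_le[OF _ that(3)]) (simp add: fact_numeral)
      then have "j = 1 \<or> j = 2" using that(1) by auto
      then show False using that(2) by auto
    qed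
    show False by (rule pd[of 11 5 b, OF _ _ b _ _ nj]) (use f e in simp_all)
  qed
qed

end

section \<open>Simple groups with many classes\<close>

text \<open>The commuting probability is at least 1/12, cleared of denominators. Only the inequality
  is available for the simple quotient at first; equality comes out of
  \<open>centr_count\<close>.\<close>

locale many_classes = nonabelian_simple +
  assumes commuting: "card (carrier G) ^ 2 \<le> 12 * (\<Sum>x\<in>carrier G. card (centr x))"
begin

definition conj_classes where "conj_classes = cls ` carrier G"

lemma finite_classes [simp]: "finite conj_classes"
  using fin by (simp add: conj_classes_def)

lemma classes_disjoint:
  assumes "A \<in> conj_classes" "B \<in> conj_classes" "A \<noteq> B" shows "A \<inter> B = {}"
proof (rule ccontr)
  assume "A \<inter> B \<noteq> {}"
  then obtain z where "z \<in> A" "z \<in> B" by blast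
  then have "cls z = A" "cls z = B" using assms cls_eq by (auto simp: conj_classes_def)
  then show False using assms(3) by simp
qed

lemma finite_class: "A \<in> conj_classes \<Longrightarrow> finite A"
  by (auto simp: conj_classes_def)

lemma Union_classes: "\<Union>conj_classes = carrier G"
  using cls_self cls_carrier by (auto simp: conj_classes_def)

lemma sum_classes: "(\<Sum>A\<in>conj_classes. card A) = card (carrier G)"
  using card_Union_disjoint[of conj_classes] classes_disjoint finite_class
  by (simp add: Union_classes pairwise_def disjnt_def)

lemma sum_centr: "(\<Sum>x\<in>carrier G. card (centr x)) = card (carrier G) * card conj_classes"
proof -
  have "(\<Sum>x\<in>carrier G. card (centr x)) = (\<Sum>A\<in>conj_classes. \<Sum>x\<in>A. card (centr x))"
    unfolding Union_classes[symmetric]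
    by (subst sum.Union_disjoint) (use classes_disjoint finite_class in \<open>auto simp: Union_classes\<close>)
  also have "\<dots> = (\<Sum>A\<in>conj_classes. card (carrier G))"
  proof (rule sum.cong[OF refl])
    fix A assume "A \<in> conj_classes"
    then obtain x where x: "x \<in> carrier G" "A = cls x" by (auto simp: conj_classes_def)
    have "(\<Sum>y\<in>A. card (centr y)) = (\<Sum>y\<in>A. card (centr x))"
      using x card_cls_eq by (intro sum.cong) auto
    then show "(\<Sum>y\<in>A. card (centr y)) = card (carrier G)" using cls_centr[OF x(1)] x by simp
  qed
  finally show ?thesis by simp
qed

lemma few_elements: "card (carrier G) \<le> 12 * card conj_classes"
proof -
  have "card (carrier G) * card (carrier G) \<le> card (carrier G) * (12 * card conj_classes)"
    using commuting by (simp add: sum_centr power2_eq_square mult.left_commute)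
  then show ?thesis using card_pos by simp
qed

lemma one_class: "{\<one>} \<in> conj_classes"
  by (auto simp: conj_classes_def image_iff intro!: bexI[of _ \<one>])

lemma class_ge_12: "A \<in> conj_classes - {{\<one>}} \<Longrightarrow> 12 \<le> card A"
proof -
  assume A: "A \<in> conj_classes - {{\<one>}}"
  then obtain x where x: "x \<in> carrier G" "A = cls x" by (auto simp: conj_classes_def)
  then have "x \<noteq> \<one>" using A by auto
  then show ?thesis using card_cls_ge_12 x by simp
qed

text \<open>By \<open>class_ge_12\<close> the truncated differences are genuine. The bound 11 is the
  12 allotted to the trivial class minus its single element.\<close>

lemma cost:
  assumes "T \<subseteq> conj_classes - {{\<one>}}"
  shows "(\<Sum>A\<in>T. card A - 12) \<le> 11"
proof -
  have "(\<Sum>A\<in>conj_classes - {{\<one>}}. card A - 12) + (\<Sum>A\<in>conj_classes - {{\<one>}}. 12) = (\<Sum>A\<in>conj_classes - {{\<one>}}. card A)"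
    unfolding sum.distrib[symmetric] using class_ge_12 by (intro sum.cong) auto
  moreover have "(\<Sum>A\<in>conj_classes. card A) = 1 + (\<Sum>A\<in>conj_classes - {{\<one>}}. card A)"
    using sum.remove[OF finite_classes one_class, of card] by simp
  moreover have "(\<Sum>A\<in>conj_classes - {{\<one>}}. 12) + 12 = 12 * card conj_classes"
    using one_class card_gt_0_iff[of conj_classes] by (auto simp: algebra_simps)
  ultimately have "(\<Sum>A\<in>conj_classes - {{\<one>}}. card A - 12) \<le> 11"
    using few_elements sum_classes by linarith
  moreover have "(\<Sum>A\<in>T. card A - 12) \<le> (\<Sum>A\<in>conj_classes - {{\<one>}}. card A - 12)"
    by (rule sum_mono2) (use assms in auto)
  ultimately show ?thesis by linarith
qed

lemma sum_sub_classes: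
  assumes "T \<subseteq> conj_classes" shows "(\<Sum>A\<in>T. card A) \<le> card (carrier G)"
  unfolding sum_classes[symmetric] by (rule sum_mono2) (use assms in auto)

lemma cls_in: "x \<in> carrier G \<Longrightarrow> x \<noteq> \<one> \<Longrightarrow> cls x \<in> conj_classes - {{\<one>}}"
  using cls_self by (auto simp: conj_classes_def)

lemma cls_le_23: "x \<in> carrier G \<Longrightarrow> x \<noteq> \<one> \<Longrightarrow> card (cls x) \<le> 23"
  using cost[of "{cls x}"] cls_in by auto

section \<open>Commuting elements of distinct prime orders\<close>

lemma cls_eq_pow:
  assumes "x \<in> carrier G" "y \<in> carrier G" "cls x = cls y" shows "x [^] (n::nat) = \<one> \<longleftrightarrow> y [^] n = \<one>"
proof -
  obtain g where g: "g \<in> carrier G" "y = conj g x" using cls_self[OF assms(2)] assms(3) by (auto simp: cls_def)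
  then show ?thesis using assms conj_inject[of g "x [^] n" \<one>] by (simp add: conj_pow)
qed

lemma cls_neq:
  assumes "x \<in> carrier G" "y \<in> carrier G" "x [^] (n::nat) = \<one>" "y [^] n \<noteq> \<one>" shows "cls x \<noteq> cls y"
  using cls_eq_pow assms by blast

text \<open>\<open>q\<close> is invertible modulo \<open>p\<close>, so \<open>x\<close> is in turn a
  power of \<open>x [^] q\<close>.\<close>

lemma other_prime_pow:
  assumes x: "x \<in> carrier G" "x \<noteq> \<one>" "x [^] p = \<one>" and pq: "prime (p::nat)" "prime q" "p \<noteq> q"
  shows "x [^] q \<noteq> \<one>" "centr (x [^] q) \<subseteq> centr x"
proof -
  show "x [^] q \<noteq> \<one>" using prime_order_unique[OF x pq(1)] pq by blast
  have "gcd q p = 1" using pq by (metis coprime_iff_gcd_eq_1 primes_coprime)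
  moreover have "q \<noteq> 0" using pq by auto
  ultimately obtain m y where "q * m = p * y + 1" using bezout_nat[of q p] by auto
  then have "(x [^] q) [^] m = x [^] (p * y + 1)" using x by (simp add: nat_pow_pow)
  also have "\<dots> = x" using x by (simp add: nat_pow_mult[symmetric] nat_pow_pow[symmetric])
  finally have "(x [^] q) [^] m = x" .
  then show "centr (x [^] q) \<subseteq> centr x" using centr_pow_subset[of "x [^] q" m] x by simp
qed

text \<open>Powers of \<open>x \<otimes> v\<close> recover \<open>x\<close> and \<open>v\<close>, so
  its class size is a multiple of theirs. All three sizes lie between 12 and 23, where no number is
  a proper multiple of another.\<close>

lemma commuting_primes:
  assumes x: "x \<in> carrier G" "x \<noteq> \<one>" "x [^] p = \<one>" and v: "v \<in> centr x" "v \<noteq> \<one>" "v [^] q = \<one>"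
    and pq: "prime (p::nat)" "prime q" "p \<noteq> q"
  shows "card (cls v) = card (cls x)" "card (cls (x \<otimes> v)) = card (cls x)"
    "x \<otimes> v \<noteq> \<one>" "(x \<otimes> v) [^] p \<noteq> \<one>" "(x \<otimes> v) [^] q \<noteq> \<one>"
proof -
  have vG: "v \<in> carrier G" using v by (simp add: mem_centr)
  let ?y = "x \<otimes> v"
  have yG: "?y \<in> carrier G" using x vG by simp
  have com: "x \<otimes> v = v \<otimes> x" using v by (simp add: mem_centr)
  have yp: "?y [^] p = v [^] p" "?y [^] q = x [^] q"
    using pow_mult_distrib[OF com x(1) vG] x v vG by simp_all
  show y: "?y [^] p \<noteq> \<one>" "?y [^] q \<noteq> \<one>"
    using yp other_prime_pow(1)[OF x pq] other_prime_pow(1)[OF vG v(2,3) pq(2,1)] pq by auto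
  then show y1: "?y \<noteq> \<one>" by auto
  have "centr ?y \<subseteq> centr x" "centr ?y \<subseteq> centr v"
    using centr_pow_subset[OF yG, of q] centr_pow_subset[OF yG, of p] yp other_prime_pow(2)[OF x pq]
      other_prime_pow(2)[OF vG v(2,3) pq(2,1)] pq by auto
  then have d: "card (cls x) dvd card (cls ?y)" "card (cls v) dvd card (cls ?y)"
    using cls_mono_centr yG x vG by auto
  have e: "n = m" if nm: "n dvd m" and "12 \<le> n" "m \<le> 23" "0 < m" for n m :: nat
  proof -
    obtain k where k: "m = n * k" using nm by blast
    have "k < 2"
    proof (rule ccontr)
      assume "\<not> k < 2"
      then have "12 * 2 \<le> n * k" using that(2) by (intro mult_le_mono) auto
      then show False using k that by simp
    qed
    then have "k = 0 \<or> k = 1" by auto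
    then show ?thesis using k that by auto
  qed
  have "card (cls x) = card (cls ?y)" "card (cls v) = card (cls ?y)"
    using e[OF d(1) card_cls_ge_12[OF x(1,2)] cls_le_23[OF yG y1] card_cls_pos[OF yG]]
      e[OF d(2) card_cls_ge_12[OF vG v(2)] cls_le_23[OF yG y1] card_cls_pos[OF yG]] by auto
  then show "card (cls v) = card (cls x)" "card (cls ?y) = card (cls x)" by auto
qed

text \<open>The three classes differ in the orders of their elements and have equal sizes;
  \<open>W\<close> holds further classes to be charged to the same budget.\<close>

lemma commuting_primes_cost:
  assumes x: "x \<in> carrier G" "x \<noteq> \<one>" "x [^] p = \<one>" and v: "v \<in> centr x" "v \<noteq> \<one>" "v [^] q = \<one>"
    and pq: "prime (p::nat)" "prime q" "p \<noteq> q"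
    and W: "W \<subseteq> conj_classes - {{\<one>}}" "W \<inter> {cls x, cls v, cls (x \<otimes> v)} = {}"
  shows "3 * (card (cls x) - 12) + (\<Sum>A\<in>W. card A - 12) \<le> 11"
proof -
  note cp = commuting_primes[OF x v pq]
  have vG: "v \<in> carrier G" using v by (simp add: mem_centr)
  have yG: "x \<otimes> v \<in> carrier G" using x vG by simp
  have "cls x \<noteq> cls v" "cls x \<noteq> cls (x \<otimes> v)" "cls v \<noteq> cls (x \<otimes> v)"
    using cls_neq[OF x(1) vG x(3)] cls_neq[OF x(1) yG x(3)] cls_neq[OF vG yG v(3)] cp
      other_prime_pow(1)[OF vG v(2,3) pq(2,1)] pq by auto
  then have "(\<Sum>A\<in>{cls x, cls v, cls (x \<otimes> v)}. card A - 12) = 3 * (card (cls x) - 12)"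
    using cp(1,2) by auto
  moreover have "(\<Sum>A\<in>{cls x, cls v, cls (x \<otimes> v)} \<union> W. card A - 12) =
      (\<Sum>A\<in>{cls x, cls v, cls (x \<otimes> v)}. card A - 12) + (\<Sum>A\<in>W. card A - 12)"
    using W finite_subset[OF W(1)] by (intro sum.union_disjoint) auto
  moreover have "(\<Sum>A\<in>{cls x, cls v, cls (x \<otimes> v)} \<union> W. card A - 12) \<le> 11"
    using cls_in x vG v yG cp W by (intro cost) auto
  ultimately show ?thesis by linarith
qed

text \<open>A second prime would produce three classes of excess at least 4, exceeding the budget
  11; hence the bound 16.\<close>

lemma centr_prime_power:
  assumes x: "x \<in> carrier G" "x \<noteq> \<one>" "x [^] p = \<one>" "prime (p::nat)" and n: "16 \<le> card (cls x)"
  obtains b where "card (centr x) = p ^ b"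
proof (rule prime_power_of_unique_prime[OF card_centr_pos[OF x(1)] x(4)])
  fix q assume q: "prime q" "q dvd card (centr x)"
  show "q = p"
  proof (rule ccontr)
    assume ne: "q \<noteq> p"
    obtain v where v: "v \<in> centr x" "v \<noteq> \<one>" "v [^] q = \<one>"
      using cauchy[OF centr_subgroup[OF x(1)] q] by metis
    show False using commuting_primes_cost[OF x(1-3) v x(4) q(1) ne[symmetric], of "{}"] n by simp
  qed
qed

text \<open>Class sizes of at most 23 leave room for one cycle only, so the order is
  \<open>q * (q + 1)\<close>, and the \<open>q\<close> elements of \<open>W\<close> include all
  whose \<open>q\<close>-th power is nontrivial. For 13, 17 and 19 two primes divide
  \<open>q + 1\<close>; they give two disjoint classes inside \<open>W\<close>, at least 24
  elements.\<close>

lemma prime_less_13: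
  assumes q: "prime q" "q dvd card (carrier G)" shows "q < 13"
proof (rule ccontr)
  assume q13: "\<not> q < 13"
  obtain x where x: "x \<in> carrier G" "x \<noteq> \<one>" "x [^] q = \<one>" using ex_p_central[OF q] by metis
  interpret prime_class G x q by unfold_locales (use x q in auto)
  have le: "f + q * t \<le> 22 + 1" using cls_le_23[OF x(1,2)] card_D by simp
  have t1: "t = 1"
  proof (rule ccontr)
    assume "t \<noteq> 1"
    then have "13 * 2 \<le> q * t" using t_pos q13 by (intro mult_le_mono) auto
    then show False using le by simp
  qed
  obtain W where W: "W \<subseteq> carrier G" "card W = q" "\<forall>w\<in>W. w \<noteq> \<one> \<and> cls w \<subseteq> W"
      "\<forall>w\<in>carrier G. w [^] q \<noteq> \<one> \<longrightarrow> w \<in> W" using one_cycle(5)[OF t1] by blast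
  have cG: "card (carrier G) = q * (q + 1)" using one_cycle(4)[OF t1] .
  have "q \<le> 22" using le t1 f_pos by simp
  have two: False if r: "prime r" "prime s" "r \<noteq> s" "r dvd q + 1" "s dvd q + 1" "r \<noteq> q" "s \<noteq> q" for r s
  proof -
    obtain a where a: "a \<in> carrier G" "a \<noteq> \<one>" "a [^] r = \<one>"
      using cauchy[OF subgroup_self r(1)] r(4) cG by (metis dvd_mult)
    obtain b where b: "b \<in> carrier G" "b \<noteq> \<one>" "b [^] s = \<one>"
      using cauchy[OF subgroup_self r(2)] r(5) cG by (metis dvd_mult)
    have "a \<in> W" "b \<in> W"
      using W(4) a b other_prime_pow(1)[OF a r(1) q(1)] other_prime_pow(1)[OF b r(2) q(1)] r by auto
    then have "cls a \<union> cls b \<subseteq> W" using W(3) by blast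
    then have "card (cls a \<union> cls b) \<le> q" using W(1,2) fin by (metis card_mono finite_subset)
    moreover have "cls a \<noteq> cls b" using cls_neq[OF a(1) b(1) a(3)] other_prime_pow(1)[OF b r(2,1)] r by auto
    then have "cls a \<inter> cls b = {}" using classes_disjoint cls_in a b by auto
    then have "card (cls a \<union> cls b) = card (cls a) + card (cls b)"
      using a b by (intro card_Un_disjoint) auto
    ultimately show False using card_cls_ge_12[OF a(1,2)] card_cls_ge_12[OF b(1,2)] \<open>q \<le> 22\<close> by linarith
  qed
  have "q = 13 \<or> q = 17 \<or> q = 19"
  proof -
    have "q = 13 \<or> q = 14 \<or> q = 15 \<or> q = 16 \<or> q = 17 \<or> q = 18 \<or> q = 19 \<or> q = 20 \<or> q = 21 \<or> q = 22"
      using q13 \<open>q \<le> 22\<close> by presburger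
    moreover have "\<not> 2 dvd q" "\<not> 3 dvd q"
      using q(1) q13 primes_dvd_imp_eq[of 2 q] primes_dvd_imp_eq[of 3 q] by auto
    ultimately show ?thesis by auto
  qed
  then show False using two[of 2 7] two[of 2 3] two[of 2 5] by auto
qed

lemma card_cls_cases:
  assumes x: "x \<in> carrier G" "x \<noteq> \<one>"
  shows "card (cls x) \<in> {12, 14, 15, 16, 18, 20, 21, 22}"
proof -
  define n where "n = card (cls x)"
  have "n = 12 \<or> n = 13 \<or> n = 14 \<or> n = 15 \<or> n = 16 \<or> n = 17 \<or> n = 18 \<or> n = 19 \<or> n = 20 \<or> n = 21 \<or> n = 22 \<or> n = 23"
    using card_cls_ge_12[OF x] cls_le_23[OF x] unfolding n_def[symmetric] by presburger
  moreover have "card (cls x) \<noteq> 13" "card (cls x) \<noteq> 17" "card (cls x) \<noteq> 19" "card (cls x) \<noteq> 23"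
    using prime_less_13[of "card (cls x)"] cls_dvd[OF x(1)] by auto
  ultimately show ?thesis by (auto simp: n_def)
qed

text \<open>In odd order only the class sizes 15 and 21 survive, both multiples of 3, whereas some
  nontrivial element has class size prime to 3.\<close>

lemma even_card: "2 dvd card (carrier G)"
proof (rule ccontr)
  assume odd: "\<not> 2 dvd card (carrier G)"
  have o: "card (cls x) = 15 \<or> card (cls x) = 21" if x: "x \<in> carrier G" "x \<noteq> \<one>" for x
  proof -
    have "\<not> 2 dvd card (cls x)" using cls_dvd[OF x(1)] odd dvd_trans by blast
    then show ?thesis using card_cls_cases[OF x] by auto
  qed
  obtain x where x: "x \<in> carrier G" "x \<noteq> \<one>" using nonabelian by (metis l_one r_one one_closed)
  have "3 dvd card (cls x)" using o[OF x] by auto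
  then have "3 dvd card (carrier G)" using cls_dvd[OF x(1)] dvd_trans by blast
  then obtain z where z: "z \<in> carrier G" "z \<noteq> \<one>" "\<not> 3 dvd card (cls z)" using ex_p_central[of 3] by auto
  then show False using o[OF z(1,2)] by auto
qed

text \<open>Inversion pairs off the elements of the class, and none equals its own inverse.\<close>

lemma real_class_even:
  assumes v: "v \<in> carrier G" "v \<noteq> \<one>" "v [^] q = \<one>" "prime (q::nat)" "q \<noteq> 2" and e: "cls (inv v) = cls v"
  shows "even (card (cls v))"
proof -
  let ?p = "\<lambda>z. if z \<in> cls v then inv z else z"
  have C: "z \<in> carrier G" if "z \<in> cls v" for z using that cls_carrier[OF v(1)] by blast
  have iv: "inv z \<in> cls v" if "z \<in> cls v" for z
    using that v e by (auto simp: cls_def simp flip: conj_inv)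
  have pp: "?p (?p z) = z" for z using iv C by auto
  have "?p permutes cls v"
    by (rule bij_imp_permutes, rule bij_betwI[where g = ?p]) (use iv C in auto)
  then have "even (card {z. ?p z \<noteq> z})" using involution_sign[OF finite_cls[OF v(1)] _ pp] by blast
  moreover have "{z. ?p z \<noteq> z} = cls v"
  proof -
    have "inv z \<noteq> z" if z: "z \<in> cls v" for z
    proof
      assume "inv z = z"
      then have "z [^] (2::nat) = \<one>" using C[OF z] by (metis l_inv nat_pow_0 nat_pow_Suc numeral_2_eq_2 l_one)
      moreover have "z [^] q = \<one>" using z v by (auto simp: cls_def simp flip: conj_pow)
      moreover have "z \<noteq> \<one>" using cls_not_one[OF v(1,2) z] .
      ultimately show False using prime_order_unique[OF C[OF z] _ _ v(4) _ two_is_prime_nat] v(5) by blast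
    qed
    then show ?thesis by auto
  qed
  ultimately show ?thesis by simp
qed

text \<open>\<open>y\<close> and \<open>z\<close> are chosen with class sizes prime to 2 and to 3.
  The budget cuts these sizes down to 15 and to 16 or 20 and makes both centralizers groups of prime
  power order, so the order of the group factors in two ways.\<close>

lemma order_60_classes:
  obtains y z where "y \<in> carrier G" "y \<noteq> \<one>" "z \<in> carrier G" "z \<noteq> \<one>"
    "card (carrier G) = 60" "card (cls y) = 15" "card (cls z) = 20"
proof -
  obtain y where y: "y \<in> carrier G" "y \<noteq> \<one>" "y [^] (2::nat) = \<one>" "\<not> 2 dvd card (cls y)"
    using ex_p_central[OF two_is_prime_nat even_card] by metis
  have ny: "card (cls y) = 15 \<or> card (cls y) = 21" using card_cls_cases[OF y(1,2)] y(4) by auto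
  have p3: "prime (3::nat)" by simp
  have "3 dvd card (cls y)" using ny by auto
  then have "3 dvd card (carrier G)" using cls_dvd[OF y(1)] dvd_trans by blast
  then obtain z where z: "z \<in> carrier G" "z \<noteq> \<one>" "z [^] (3::nat) = \<one>" "\<not> 3 dvd card (cls z)"
    using ex_p_central[OF p3] by metis
  have nz: "card (cls z) \<in> {14, 16, 20, 22}" using card_cls_cases[OF z(1,2)] z(4) by auto
  have yz: "cls y \<noteq> cls z" using nz ny by auto
  have "card (cls y) \<noteq> 21"
  proof
    assume n21: "card (cls y) = 21"
    \<comment> \<open>Size 21 costs 9, so the class of \<open>z\<close> may cost at most 2.\<close>
    have "(\<Sum>A\<in>{cls y, cls z}. card A - 12) \<le> 11" using cls_in y z by (intro cost) auto
    then have n14: "card (cls z) = 14" using nz yz n21 by auto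
    obtain a where "card (centr y) = 2 ^ a" using centr_prime_power[OF y(1-3) two_is_prime_nat] n21 by auto
    then have cG: "card (carrier G) = 21 * 2 ^ a" using cls_centr[OF y(1)] n21 by simp
    have cz: "card (carrier G) = 14 * card (centr z)" using cls_centr[OF z(1)] n14 by simp
    show False
    proof (cases "2 dvd card (centr z)")
      case True
      \<comment> \<open>Three classes of size 14 would cost 6 in addition to the 9 for
        \<open>y\<close>.\<close>
      then obtain v where v: "v \<in> centr z" "v \<noteq> \<one>" "v [^] (2::nat) = \<one>"
        using cauchy[OF centr_subgroup[OF z(1)] two_is_prime_nat] by metis
      have "card (cls v) = 14" "card (cls (z \<otimes> v)) = 14"
        using commuting_primes(1,2)[OF z(1-3) v p3 two_is_prime_nat] n14 by auto
      then have "cls y \<notin> {cls z, cls v, cls (z \<otimes> v)}" using n14 n21 by auto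
      then have "3 * (card (cls z) - 12) + (card (cls y) - 12) \<le> 11"
        using commuting_primes_cost[OF z(1-3) v p3 two_is_prime_nat _, of "{cls y}"] cls_in y by auto
      then show False using n14 n21 by simp
    next
      case False
      \<comment> \<open>14 times an odd number equals 21 times a power of 2, so the order is at most
        42, too small for classes of sizes 14, 21 and at least 12.\<close>
      have "a \<le> 1"
      proof (rule ccontr)
        assume "\<not> a \<le> 1"
        then obtain b where "a = Suc (Suc b)" by (metis Suc_le_eq less_Suc0 not_less_eq not_less not0_implies_Suc One_nat_def le_0_eq le_SucE)
        then have "2 * (21 * 2 ^ b) = 7 * card (centr z)" using cG cz by simp
        then have "2 dvd 7 * card (centr z)" by (metis dvd_triv_left)
        then show False using False by simp
      qed
      then have c42: "card (carrier G) \<le> 42" using cG by (cases a) auto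
      have "7 dvd card (carrier G)" using cG by simp
      then obtain w where w: "w \<in> carrier G" "w \<noteq> \<one>" "w [^] (7::nat) = \<one>" using ex_p_central[of 7] by auto
      have "cls w \<noteq> cls y" "cls w \<noteq> cls z"
        using cls_neq[OF y(1) w(1) y(3)] cls_neq[OF z(1) w(1) z(3)] other_prime_pow(1)[OF w, of 2] other_prime_pow(1)[OF w, of 3] by auto
      then have "(\<Sum>A\<in>{cls w, cls y, cls z}. card A) = card (cls w) + card (cls y) + card (cls z)"
        using yz by auto
      moreover have "(\<Sum>A\<in>{cls w, cls y, cls z}. card A) \<le> card (carrier G)"
        using cls_in w y z by (intro sum_sub_classes) auto
      ultimately show False using card_cls_ge_12[OF w(1,2)] n14 n21 c42 by linarith
    qed
  qed
  then have n15: "card (cls y) = 15" using ny by blast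
  \<comment> \<open>Otherwise there are three classes of size 15, costing 9. Since 15 is odd,
    \<open>v\<close> is not conjugate to its inverse, and the class of \<open>inv v\<close> costs
    another 3.\<close>
  have "q = 2" if q: "prime q" "q dvd card (centr y)" for q
  proof (rule ccontr)
    assume q2: "q \<noteq> 2"
    obtain v where v: "v \<in> centr y" "v \<noteq> \<one>" "v [^] q = \<one>"
      using cauchy[OF centr_subgroup[OF y(1)] q] by metis
    have vG: "v \<in> carrier G" using v by (simp add: mem_centr)
    note cp = commuting_primes[OF y(1-3) v two_is_prime_nat q(1) q2[symmetric]]
    have cv: "card (cls v) = 15" using cp n15 by simp
    have iq: "inv v [^] q = \<one>" using v vG by (simp add: nat_pow_inv)
    have i1: "inv v \<noteq> \<one>" using v vG by simp
    have "card (cls (inv v)) = card (cls v)"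
    proof -
      have "centr (inv v) = centr v"
        using vG by (auto simp: mem_centr_conj conj_inv)
      then show ?thesis using cls_centr[OF vG] cls_centr[of "inv v"] vG card_pos
        by (metis inv_closed mult_cancel2 mult_is_0 less_irrefl)
    qed
    moreover have "cls (inv v) \<noteq> cls v" using real_class_even[OF vG v(2,3) q(1) q2] cv by auto
    moreover have "cls (inv v) \<noteq> cls y" "cls (inv v) \<noteq> cls (y \<otimes> v)"
      using cls_neq[of "inv v" y q] cls_neq[of "inv v" "y \<otimes> v" q] iq vG y cp other_prime_pow(1)[OF y(1-3) two_is_prime_nat q(1)] q2 by auto
    ultimately have "3 * (card (cls y) - 12) + (card (cls (inv v)) - 12) \<le> 11"
      using commuting_primes_cost[OF y(1-3) v two_is_prime_nat q(1) q2[symmetric], of "{cls (inv v)}"] cls_in i1 vG by auto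
    then show False using n15 cv \<open>card (cls (inv v)) = card (cls v)\<close> by simp
  qed
  moreover have "card (centr y) > 0" using card_centr_pos[OF y(1)] .
  ultimately obtain a where "card (centr y) = 2 ^ a" using prime_power_of_unique_prime two_is_prime_nat by metis
  then have cG: "card (carrier G) = 15 * 2 ^ a" using cls_centr[OF y(1)] n15 by simp
  have nd: "\<not> r dvd card (carrier G)" if "prime r" "r \<noteq> 2" "r \<noteq> 3" "r \<noteq> 5" for r
  proof
    assume "r dvd card (carrier G)"
    then have "r dvd (3 * 5) * 2 ^ a" using cG by simp
    then have "r dvd 3 \<or> r dvd 5 \<or> r dvd 2" using that(1) by (metis prime_dvd_mult_iff prime_dvd_power)
    then show False using that primes_dvd_imp_eq[of r 3] primes_dvd_imp_eq[of r 5] primes_dvd_imp_eq[of r 2] by auto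
  qed
  have "\<not> 7 dvd card (cls z)" "\<not> 11 dvd card (cls z)"
    using nd[of 7] nd[of 11] cls_dvd[OF z(1)] dvd_trans by auto
  then have nz': "card (cls z) = 16 \<or> card (cls z) = 20" using nz by auto
  then have "16 \<le> card (cls z)" by auto
  then obtain b where "card (centr z) = 3 ^ b" by (rule centr_prime_power[OF z(1-3) p3])
  then have cGz: "card (carrier G) = card (cls z) * 3 ^ b" using cls_centr[OF z(1)] by simp
  have n20: "card (cls z) = 20"
  proof (rule ccontr)
    assume "card (cls z) \<noteq> 20"
    then have "card (carrier G) = 2 ^ 4 * 3 ^ b" using nz' cGz by simp
    moreover have "5 dvd card (carrier G)" using cG by simp
    moreover have p5: "prime (5::nat)" by simp
    ultimately have "5 dvd (2::nat) ^ 4 \<or> 5 dvd (3::nat) ^ b" using prime_dvd_mult_iff[OF p5] by metis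
    then have "5 dvd (2::nat) \<or> 5 dvd (3::nat)" using prime_dvd_power[OF p5] by blast
    then show False by auto
  qed
  have e: "3 * 2 ^ a = 4 * (3::nat) ^ b" using cG cGz n20 by simp
  have "coprime ((3::nat) ^ b) (2 ^ a)" by simp
  moreover have "3 ^ b dvd 3 * (2::nat) ^ a" using e by simp
  ultimately have "3 ^ b dvd (3::nat)" by (metis coprime_dvd_mult_left_iff)
  then have "(3::nat) ^ b \<le> 3 ^ 1" using dvd_imp_le by fastforce
  then have "b \<le> 1" by (simp only: power_increasing_iff)
  moreover have "b \<noteq> 0"
  proof
    assume "b = 0"
    then have "3 dvd (4::nat)" using e by (metis dvd_triv_left mult.right_neutral power_0)
    then show False by simp
  qed
  ultimately have "b = 1" by linarith
  then have "card (carrier G) = 60" using cGz n20 by simp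
  then show ?thesis using that y z n15 n20 by blast
qed


section \<open>Centralizers and automorphisms in the case of order 60\<close>

lemma order_60: "card (carrier G) = 60"
  by (rule order_60_classes)

lemma class_types:
  obtains y z where "y \<in> carrier G" "z \<in> carrier G" "y \<noteq> \<one>" "z \<noteq> \<one>" "cls y \<noteq> cls z"
    "card (cls y) = 15" "card (cls z) = 20"
    "\<And>w. w \<in> carrier G \<Longrightarrow> w \<noteq> \<one> \<Longrightarrow> w \<notin> cls y \<Longrightarrow> w \<notin> cls z \<Longrightarrow> card (cls w) = 12"
proof -
  obtain y z where yz: "y \<in> carrier G" "y \<noteq> \<one>" "z \<in> carrier G" "z \<noteq> \<one>" "card (cls y) = 15" "card (cls z) = 20"
    using order_60_classes by metis
  have ne: "cls y \<noteq> cls z" using yz by auto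
  have "card (cls w) = 12" if w: "w \<in> carrier G" "w \<noteq> \<one>" "w \<notin> cls y" "w \<notin> cls z" for w
  proof -
    have "cls w \<noteq> cls y" "cls w \<noteq> cls z" using w cls_self[OF w(1)] by auto
    then have "(\<Sum>A\<in>{cls w, cls y, cls z}. card A - 12) = (card (cls w) - 12) + 11"
      using ne yz by auto
    moreover have "(\<Sum>A\<in>{cls w, cls y, cls z}. card A - 12) \<le> 11"
      using cls_in w yz by (intro cost) auto
    ultimately show ?thesis using card_cls_ge_12[OF w(1,2)] by linarith
  qed
  then show ?thesis using that[of y z] yz ne by blast
qed

lemma card_centr_cases:
  assumes w: "w \<in> carrier G" "w \<noteq> \<one>" shows "card (centr w) = 3 \<or> card (centr w) = 4 \<or> card (centr w) = 5"
proof -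
  obtain y z where yz: "y \<in> carrier G" "z \<in> carrier G" "card (cls y) = 15" "card (cls z) = 20"
    "\<And>w. w \<in> carrier G \<Longrightarrow> w \<noteq> \<one> \<Longrightarrow> w \<notin> cls y \<Longrightarrow> w \<notin> cls z \<Longrightarrow> card (cls w) = 12"
    using class_types by metis
  have "card (cls w) = 15 \<or> card (cls w) = 20 \<or> card (cls w) = 12"
  proof (cases "w \<in> cls y \<or> w \<in> cls z")
    case True
    then have "cls w = cls y \<or> cls w = cls z" using cls_eq yz(1,2) by blast
    then show ?thesis using yz(3,4) by (elim disjE) simp_all
  qed (use yz(5)[OF w] in blast)
  then show ?thesis using cls_centr[OF w(1)] order_60 by auto
qed

text \<open>The sum 300 is 3600 / 12: the commuting probability is exactly 1/12. The 24 elements are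
  those outside the classes of sizes 1, 15 and 20.\<close>

lemma centr_count:
  "card {w \<in> carrier G. card (centr w) = 5} = 24" "(\<Sum>w\<in>carrier G. card (centr w)) = 300"
proof -
  obtain y z where yz: "y \<in> carrier G" "z \<in> carrier G" "y \<noteq> \<one>" "z \<noteq> \<one>" "cls y \<noteq> cls z"
    "card (cls y) = 15" "card (cls z) = 20"
    and w: "\<And>w. w \<in> carrier G \<Longrightarrow> w \<noteq> \<one> \<Longrightarrow> w \<notin> cls y \<Longrightarrow> w \<notin> cls z \<Longrightarrow> card (cls w) = 12"
    using class_types by metis
  let ?R = "carrier G - {\<one>} - cls y - cls z"
  have dis: "cls y \<inter> cls z = {}" using classes_disjoint cls_in yz by auto
  have one: "\<one> \<notin> cls y" "\<one> \<notin> cls z" using cls_not_one yz by auto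
  have sub: "cls y \<subseteq> carrier G" "cls z \<subseteq> carrier G" using cls_carrier yz by auto
  have c: "card (centr u) = 4" if "u \<in> cls y" for u
    using card_cls_eq[OF yz(1) that] cls_centr[OF yz(1)] yz order_60 by simp
  have d: "card (centr u) = 3" if "u \<in> cls z" for u
    using card_cls_eq[OF yz(2) that] cls_centr[OF yz(2)] yz order_60 by simp
  have e: "card (centr u) = 5" if "u \<in> ?R" for u
    using w[of u] cls_centr[of u] that order_60 by simp
  have o: "card (centr \<one>) = 60" using cls_centr[of \<one>] order_60 by simp
  have "card ?R = card (carrier G - {\<one>} - cls y) - card (cls z)"
    using sub dis one yz by (intro card_Diff_subset) auto
  also have "card (carrier G - {\<one>} - cls y) = card (carrier G - {\<one>}) - card (cls y)"
    using sub one yz by (intro card_Diff_subset) auto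
  finally have cR: "card ?R = 24" using order_60 yz fin by simp
  have "{w \<in> carrier G. card (centr w) = 5} = ?R"
  proof
    show "?R \<subseteq> {w \<in> carrier G. card (centr w) = 5}" using e by blast
    have "w \<in> ?R" if w: "w \<in> carrier G" "card (centr w) = 5" for w
    proof -
      have "w \<noteq> \<one>" using o w(2) by auto
      moreover have "w \<notin> cls y" "w \<notin> cls z" using c[of w] d[of w] w(2) by auto
      ultimately show ?thesis using w(1) by blast
    qed
    then show "{w \<in> carrier G. card (centr w) = 5} \<subseteq> ?R" by blast
  qed
  then show "card {w \<in> carrier G. card (centr w) = 5} = 24" using cR by simp
  have un: "carrier G = ({\<one>} \<union> cls y) \<union> (cls z \<union> ?R)" using sub by auto
  have "(\<Sum>w\<in>carrier G. card (centr w)) = (\<Sum>w\<in>({\<one>} \<union> cls y) \<union> (cls z \<union> ?R). card (centr w))"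
    by (rule sum.cong[OF un refl])
  also have "\<dots> = (\<Sum>w\<in>{\<one>} \<union> cls y. card (centr w)) + (\<Sum>w\<in>cls z \<union> ?R. card (centr w))"
  proof (rule sum.union_disjoint)
    show "finite ({\<one>} \<union> cls y)" "finite (cls z \<union> ?R)" using fin yz(1,2) by simp_all
    show "({\<one>} \<union> cls y) \<inter> (cls z \<union> ?R) = {}" using dis one by blast
  qed
  also have "(\<Sum>w\<in>{\<one>} \<union> cls y. card (centr w)) = 60 + (\<Sum>w\<in>cls y. card (centr w))"
    using sum.insert[OF finite_cls[OF yz(1)] one(1), of "\<lambda>w. card (centr w)"] o by simp
  also have "(\<Sum>w\<in>cls z \<union> ?R. card (centr w)) = (\<Sum>w\<in>cls z. card (centr w)) + (\<Sum>w\<in>?R. card (centr w))"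
  proof (rule sum.union_disjoint)
    show "finite (cls z)" "finite ?R" using fin yz(1,2) by simp_all
    show "cls z \<inter> ?R = {}" by blast
  qed
  also have "(\<Sum>w\<in>cls y. card (centr w)) = 15 * 4" using c yz by simp
  also have "(\<Sum>w\<in>cls z. card (centr w)) = 20 * 3" using d yz by simp
  also have "(\<Sum>w\<in>?R. card (centr w)) = 24 * 5" using e cR by simp
  finally show "(\<Sum>w\<in>carrier G. card (centr w)) = 300" by simp
qed

text \<open>The intersection of the two centralizers contains \<open>\<one>\<close>,
  \<open>x\<close> and \<open>y\<close>, and none of 3, 4 and 5 has a proper divisor that is at
  least 3.\<close>

lemma centr_subset_centr:
  assumes x: "x \<in> carrier G" "x \<noteq> \<one>" and y: "y \<in> centr x" "y \<noteq> \<one>"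
  shows "centr x \<subseteq> centr y"
proof (cases "x = y")
  case False
  have yG: "y \<in> carrier G" using y by (simp add: mem_centr)
  have s: "subgroup (centr x \<inter> centr y) G"
    using subgroups_Inter_pair centr_subgroup x(1) yG by blast
  have "card (centr x \<inter> centr y) dvd card (centr x)"
    using subgroup_card_dvd_subgroup[OF s centr_subgroup[OF x(1)]] by simp
  moreover have "{\<one>, x, y} \<subseteq> centr x \<inter> centr y"
    using x y yG subgroup.one_closed[OF s] by (auto simp: mem_centr)
  then have "card {\<one>, x, y} \<le> card (centr x \<inter> centr y)" by (intro card_mono) auto
  then have "3 \<le> card (centr x \<inter> centr y)" using False x y by auto
  moreover have "n = k" if "n dvd k" "3 \<le> n" "k = 3 \<or> k = 4 \<or> k = 5" for n k :: nat
  proof -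
    have "n \<le> k" using that by (auto intro: dvd_imp_le)
    then have "n = 3 \<or> n = 4 \<or> n = 5" using that(2,3) by auto
    then show ?thesis using that(1,3) by auto
  qed
  ultimately have "card (centr x \<inter> centr y) = card (centr x)" using card_centr_cases[OF x] by blast
  then have "centr x \<inter> centr y = centr x" by (intro card_subset_eq) auto
  then show ?thesis by blast
qed simp

lemma centr_eq:
  assumes x: "x \<in> carrier G" "x \<noteq> \<one>" and y: "y \<in> centr x" "y \<noteq> \<one>"
  shows "centr y = centr x"
proof -
  have "y \<in> carrier G" "x \<in> centr y" using x y by (auto simp: mem_centr)
  then show ?thesis using centr_subset_centr[OF x y] centr_subset_centr[of y x] x y by blast
qed

text \<open>The automorphism, composed with a suitable element of the cyclic group \<open>centr a\<close>, fixes the six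
  subgroups of order 5, because \<open>centr a\<close> permutes the five others transitively; but the action of
  \<open>G\<close> on these six subgroups is faithful.\<close>

lemma automorphism_inner:
  assumes \<alpha>: "\<And>s. s \<in> carrier G \<Longrightarrow> \<alpha> s \<in> carrier G" "inj_on \<alpha> (carrier G)"
    "\<And>s r. s \<in> carrier G \<Longrightarrow> r \<in> carrier G \<Longrightarrow> \<alpha> (s \<otimes> r) = \<alpha> s \<otimes> \<alpha> r"
    and a: "a \<in> carrier G" "card (centr a) = 5" "\<alpha> a = a"
  obtains b where "b \<in> carrier G" "\<And>s. s \<in> carrier G \<Longrightarrow> \<alpha> s = conj b s"
proof -
  define E where "E = {w \<in> carrier G. card (centr w) = 5}"
  define X where "X = centr ` E"
  let ?act = "\<lambda>g A. conj g ` A"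
  have E1: "w \<noteq> \<one>" if "w \<in> E" for w
    using that cls_centr[of \<one>] order_60 by (auto simp: E_def)
  have E_conj: "conj g w \<in> E" if "g \<in> carrier G" "w \<in> E" for g w
  proof -
    have "w \<in> carrier G" using that by (simp add: E_def)
    moreover have "inj_on (conj g) (centr w)" using that centr_carrier by (auto intro!: inj_onI simp: subset_iff)
    ultimately show ?thesis using that centr_conj[of g w] card_image by (fastforce simp: E_def)
  qed
  have XG: "A \<subseteq> carrier G" if "A \<in> X" for A using that centr_carrier by (auto simp: X_def)
  have act: "action G X ?act"
  proof unfold_locales
    show "finite X" using fin by (simp add: X_def E_def)
    fix g h A assume g: "g \<in> carrier G" and A: "A \<in> X"
    obtain w where w: "w \<in> E" "A = centr w" using A by (auto simp: X_def)
    then have "?act g A = centr (conj g w)" using centr_conj[OF g, of w] by (simp add: E_def)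
    then show "?act g A \<in> X" using E_conj[OF g w(1)] by (simp add: X_def)
    assume h: "h \<in> carrier G"
    show "?act (g \<otimes> h) A = ?act g (?act h A)"
      using g h XG[OF A] by (auto simp: image_image conj_conj subset_iff intro!: image_cong)
  next
    fix A assume "A \<in> X"
    then have "A \<subseteq> carrier G" by (rule XG)
    then have "conj \<one> z = z" if "z \<in> A" for z using that by (simp add: subset_iff)
    then show "?act \<one> A = A" by simp
  qed (rule fin)
  interpret A: action G X ?act by fact
  have fib: "{w \<in> E. centr w = U} = U - {\<one>}" if U: "U \<in> X" for U
  proof -
    obtain u where u: "u \<in> E" "U = centr u" using U by (auto simp: X_def)
    have uG: "u \<in> carrier G" "u \<noteq> \<one>" "card U = 5" using u E1 by (auto simp: E_def)
    show ?thesis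
    proof
      have "w \<in> U - {\<one>}" if "w \<in> E" "centr w = U" for w
        using that E1[OF that(1)] by (auto simp: E_def mem_centr)
      then show "{w \<in> E. centr w = U} \<subseteq> U - {\<one>}" by blast
      have "w \<in> E \<and> centr w = U" if "w \<in> U - {\<one>}" for w
      proof -
        have "centr w = U" using centr_eq[OF uG(1,2), of w] that u by auto
        moreover have "w \<in> carrier G" using that u by (auto simp: mem_centr)
        ultimately show ?thesis using uG(3) by (simp add: E_def)
      qed
      then show "U - {\<one>} \<subseteq> {w \<in> E. centr w = U}" by blast
    qed
  qed
  have cU: "card U = 5" "\<one> \<in> U" if "U \<in> X" for U
    using that subgroup.one_closed[OF centr_subgroup] by (auto simp: X_def E_def)
  \<comment> \<open>The centralizers of order 5, without \<open>\<one>\<close>, partition the 24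
    elements of \<open>E\<close> into sets of four, which gives six subgroups.\<close>
  have "4 * card ((\<lambda>U. U - {\<one>}) ` X) = card (\<Union>((\<lambda>U. U - {\<one>}) ` X))"
  proof (rule card_partition)
    show "card c = 4" if "c \<in> (\<lambda>U. U - {\<one>}) ` X" for c using that cU by auto
    fix c d assume cd: "c \<in> (\<lambda>U. U - {\<one>}) ` X" "d \<in> (\<lambda>U. U - {\<one>}) ` X" "c \<noteq> d"
    then obtain U V where UV: "U \<in> X" "V \<in> X" "c = U - {\<one>}" "d = V - {\<one>}" by blast
    then show "c \<inter> d = {}" using fib[of U] fib[of V] cd(3) by blast
  next
    show "finite (\<Union> ((\<lambda>U. U - {\<one>}) ` X))"
      using XG by (intro finite_subset[OF _ fin]) blast
  qed (use A.finX in auto)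
  moreover have "\<Union>((\<lambda>U. U - {\<one>}) ` X) = E"
  proof
    show "\<Union>((\<lambda>U. U - {\<one>}) ` X) \<subseteq> E" using fib by blast
    show "E \<subseteq> \<Union>((\<lambda>U. U - {\<one>}) ` X)"
    proof
      fix w assume w: "w \<in> E"
      then have "w \<in> centr w - {\<one>}" "centr w \<in> X" using E1 by (auto simp: E_def X_def mem_centr)
      then show "w \<in> \<Union>((\<lambda>U. U - {\<one>}) ` X)" by blast
    qed
  qed
  moreover have "inj_on (\<lambda>U. U - {\<one>}) X"
    using cU(2) by (intro inj_onI) (metis insert_Diff)
  ultimately have cX: "card X = 6" using centr_count(1) by (simp add: card_image E_def)
  have aE: "a \<in> E" using a by (simp add: E_def)
  let ?U0 = "centr a"
  have U0: "?U0 \<in> X" using aE by (simp add: X_def)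
  have sub0: "subgroup ?U0 G" using centr_subgroup[OF a(1)] .
  have ord5: "b [^] (5::nat) = \<one>" if "b \<in> ?U0" for b
    using ord_dvd_subgroup[OF sub0 that] a(2) pow_eq_id[of b 5] that by (simp add: mem_centr)
  \<comment> \<open>\<open>b\<close> has order 5 and permutes the five elements of \<open>U\<close>,
    fixing \<open>\<one>\<close>; so it fixes \<open>U\<close> pointwise, and \<open>U\<close> is
    the centralizer of \<open>b\<close>.\<close>
  have fixes_only: "U = ?U0" if U: "U \<in> X" and b: "b \<in> ?U0" "b \<noteq> \<one>" "?act b U = U" for U b
  proof -
    have bG: "b \<in> carrier G" using b by (simp add: mem_centr)
    have "card U mod 5 = card (U \<inter> centr b) mod 5"
      by (rule order_p_fixed_points[OF bG ord5[OF b(1)]]) (use XG[OF U] b(3) in auto)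
    then have "card (U \<inter> centr b) mod 5 = 0" using cU[OF U] by simp
    moreover have "\<one> \<in> U \<inter> centr b" using cU[OF U] subgroup.one_closed[OF centr_subgroup[OF bG]] by blast
    then have "card (U \<inter> centr b) > 0" by (auto simp: card_gt_0_iff)
    ultimately have "5 \<le> card (U \<inter> centr b)" by (auto dest!: dvd_imp_le simp: mod_eq_0_iff_dvd)
    then have "U \<inter> centr b = centr b"
      using centr_eq[OF a(1) E1[OF aE] b(1,2)] a(2) by (intro card_seteq) auto
    moreover have "U \<inter> centr b = U"
      using \<open>5 \<le> card (U \<inter> centr b)\<close> cU[OF U] XG[OF U] fin by (intro card_seteq) (auto intro: finite_subset)
    ultimately show ?thesis using centr_eq[OF a(1) E1[OF aE] b(1,2)] by blast
  qed
  have "\<not> X \<subseteq> {?U0}"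
  proof
    assume "X \<subseteq> {?U0}"
    then have "card X \<le> card {?U0}" by (intro card_mono) simp_all
    then show False using cX by simp
  qed
  then obtain U1 where U1: "U1 \<in> X" "U1 \<noteq> ?U0" by blast
  have inU0: "conj b ` ?U0 = ?U0" if "b \<in> ?U0" for b
  proof -
    have bG: "b \<in> carrier G" "conj b a = a" using that a by (auto simp: mem_centr_conj)
    then show ?thesis using centr_conj[OF bG(1) a(1)] by simp
  qed
  have stay: "?act b U \<in> X - {?U0}" if "b \<in> ?U0" "U \<in> X - {?U0}" for b U
  proof -
    have bG: "b \<in> carrier G" using that by (simp add: mem_centr)
    have "?act b U \<noteq> ?act b ?U0" using A.act_eq_iff[OF bG _ U0, of U] that by auto
    then show ?thesis using A.act_closed[OF bG] that inU0 by auto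
  qed
  \<comment> \<open>By \<open>fixes_only\<close> the stabilizer of \<open>U1\<close> in
    \<open>?U0\<close> is trivial, so its orbit has five elements.\<close>
  have trans: "\<exists>b\<in>?U0. ?act b U1 = U" if U: "U \<in> X - {?U0}" for U
  proof -
    interpret B: action "G\<lparr>carrier := ?U0\<rparr>" "X - {?U0}" ?act
    proof (rule action_subgroup[OF sub0])
      show "finite (X - {?U0})" using A.finX by simp
      fix g h A assume "g \<in> ?U0" "h \<in> ?U0" "A \<in> X - {?U0}"
      then show "?act (g \<otimes> h) A = ?act g (?act h A)" using A.act_mult[of g h A] by (simp add: mem_centr)
    qed (use stay A.act_one in auto)
    have "B.stab U1 = {\<one>}"
      using fixes_only[OF U1(1)] U1 A.act_one[OF U1(1)] subgroup.one_closed[OF sub0] by (auto simp: B.stab_def)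
    then have "card (B.orb U1) = 5" using B.orbit_stabilizer[of U1] U1 a(2) by simp
    moreover have "B.orb U1 \<subseteq> X - {?U0}" using B.orb_subset[of U1] U1 by blast
    moreover have "card (X - {?U0}) = 5" using cX U0 by simp
    ultimately have "B.orb U1 = X - {?U0}" using A.finX by (intro card_subset_eq) simp_all
    then have "U \<in> B.orb U1" using U by simp
    then obtain b where "U = ?act b U1" "b \<in> carrier (G\<lparr>carrier := ?U0\<rparr>)"
      unfolding B.orb_def by (rule imageE)
    then show ?thesis by (intro bexI[of _ b]) simp_all
  qed
  have \<alpha>_surj: "\<alpha> ` carrier G = carrier G"
    using endo_inj_surj[OF fin _ \<alpha>(2)] \<alpha>(1) by blast
  have \<alpha>_centr: "\<alpha> ` centr w = centr (\<alpha> w)" if w: "w \<in> carrier G" for w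
  proof
    have "\<alpha> u \<in> centr (\<alpha> w)" if "u \<in> centr w" for u
    proof -
      have u: "u \<in> carrier G" "u \<otimes> w = w \<otimes> u" using that by (simp_all add: mem_centr)
      show ?thesis using \<alpha>(1)[OF u(1)] \<alpha>(3)[OF u(1) w] \<alpha>(3)[OF w u(1)] u(2) by (simp add: mem_centr)
    qed
    then show "\<alpha> ` centr w \<subseteq> centr (\<alpha> w)" by blast
    show "centr (\<alpha> w) \<subseteq> \<alpha> ` centr w"
    proof
      fix v assume v: "v \<in> centr (\<alpha> w)"
      then obtain u where u: "u \<in> carrier G" "v = \<alpha> u" using \<alpha>_surj by (auto simp: mem_centr)
      then have "\<alpha> (u \<otimes> w) = \<alpha> (w \<otimes> u)" using v w by (simp add: mem_centr \<alpha>(3))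
      then have "u \<otimes> w = w \<otimes> u" using \<alpha>(2) u w by (simp add: inj_on_eq_iff)
      then show "v \<in> \<alpha> ` centr w" using u by (auto simp: mem_centr)
    qed
  qed
  have \<alpha>X: "\<alpha> ` U \<in> X" if U: "U \<in> X" for U
  proof -
    obtain w where w: "w \<in> E" "U = centr w" using U by (auto simp: X_def)
    have "card (\<alpha> ` centr w) = card (centr w)"
      by (rule card_image) (rule inj_on_subset[OF \<alpha>(2) centr_carrier])
    then have "\<alpha> w \<in> E" using w \<alpha>(1) \<alpha>_centr[of w] by (simp add: E_def)
    then show ?thesis using w \<alpha>_centr[of w] by (simp add: X_def E_def)
  qed
  have im_inj: "\<alpha> ` U = \<alpha> ` V \<longleftrightarrow> U = V" if "U \<subseteq> carrier G" "V \<subseteq> carrier G" for U V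
    using inj_on_image_eq_iff[OF \<alpha>(2) that] .
  have \<alpha>0: "\<alpha> ` ?U0 = ?U0" using \<alpha>_centr[OF a(1)] a(3) by simp
  then have "\<alpha> ` U1 \<noteq> ?U0" using im_inj[of U1 ?U0] XG U0 U1 by auto
  then obtain b where b: "b \<in> ?U0" "?act b U1 = \<alpha> ` U1" using trans \<alpha>X[OF U1(1)] by blast
  have bG: "b \<in> carrier G" using b by (simp add: mem_centr)
  \<comment> \<open>The corrected automorphism fixes \<open>U1\<close> in addition to
    \<open>?U0\<close>.\<close>
  define \<beta> where "\<beta> s = conj (inv b) (\<alpha> s)" for s
  have \<beta>G: "\<beta> s \<in> carrier G" if "s \<in> carrier G" for s using that \<alpha>(1) bG by (simp add: \<beta>_def)
  have \<alpha>_one: "\<alpha> \<one> = \<one>"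
    using \<alpha>(3)[of \<one> \<one>] \<alpha>(1)[of \<one>] by (metis l_one one_closed r_cancel_one)
  have \<alpha>_inv: "\<alpha> (inv s) = inv (\<alpha> s)" if "s \<in> carrier G" for s
    using \<alpha>(3)[of "inv s" s] \<alpha>(1) \<alpha>_one that by (metis inv_closed inv_equality l_inv)
  have \<alpha>_conj: "\<alpha> (conj r s) = conj (\<alpha> r) (\<alpha> s)" if "r \<in> carrier G" "s \<in> carrier G" for r s
    using that by (simp add: conj_def \<alpha>(3) \<alpha>_inv)
  have \<alpha>_fix: "\<alpha> c = c" if c: "c \<in> ?U0" for c
  proof -
    let ?F = "{c \<in> ?U0. \<alpha> c = c}"
    have F: "subgroup ?F G"
    proof (rule subgroupI)
      show "?F \<noteq> {}" using a by (auto simp: mem_centr)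
      show "inv c \<in> ?F" if "c \<in> ?F" for c
        using that subgroup.m_inv_closed[OF sub0] \<alpha>_inv by (auto simp: mem_centr)
      show "c \<otimes> d \<in> ?F" if "c \<in> ?F" "d \<in> ?F" for c d
        using that subgroup.m_closed[OF sub0] \<alpha>(3) by (auto simp: mem_centr)
    qed (auto simp: mem_centr)
    have "a \<in> ?F" using a by (simp add: mem_centr)
    then have "ord a dvd card ?F" using ord_dvd_subgroup[OF F] by blast
    moreover have "ord a = 5" using ord_prime[OF a(1) E1[OF aE] ord5] a(1) by (simp add: mem_centr)
    moreover have "card ?F > 0" using \<open>a \<in> ?F\<close> by (auto simp: card_gt_0_iff)
    ultimately have "5 \<le> card ?F" by (auto dest: dvd_imp_le)
    then have "?F = ?U0" using a(2) by (intro card_seteq) auto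
    then show ?thesis using c by blast
  qed
  \<comment> \<open>Every remaining subgroup is a conjugate of \<open>U1\<close> by some
    \<open>c\<close> in \<open>?U0\<close>. Conjugation by \<open>c\<close> commutes with
    \<open>\<beta>\<close>, because \<open>\<alpha>\<close> fixes \<open>c\<close> and
    \<open>b\<close> commutes with \<open>c\<close>.\<close>
  have \<beta>X: "\<beta> ` U = U" if U: "U \<in> X" for U
  proof (cases "U = ?U0")
    case True
    have "\<beta> ` ?U0 = conj (inv b) ` \<alpha> ` ?U0" by (simp add: \<beta>_def image_image)
    also have "\<dots> = ?U0" unfolding \<alpha>0 using inU0 subgroup.m_inv_closed[OF sub0 b(1)] by blast
    finally show ?thesis using True by simp
  next
    case False
    then obtain c where c: "c \<in> ?U0" "?act c U1 = U" using trans U by blast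
    have cG: "c \<in> carrier G" using c by (simp add: mem_centr)
    have com: "c \<otimes> b = b \<otimes> c"
    proof (cases "b = \<one>")
      case False
      then show ?thesis using centr_eq[OF a(1) E1[OF aE] b(1)] c by (simp add: mem_centr) (metis mem_centr)
    qed (use cG in simp)
    have cb: "inv b \<otimes> c = c \<otimes> inv b"
      using com cG bG by (metis inv_closed inv_solve_left inv_solve_right m_assoc m_closed)
    have "\<beta> ` U = (\<lambda>s. conj (inv b) (\<alpha> (conj c s))) ` U1" using c by (auto simp: \<beta>_def image_image)
    also have "\<dots> = (\<lambda>s. conj c (conj (inv b) (\<alpha> s))) ` U1"
    proof (rule image_cong[OF refl])
      fix s assume "s \<in> U1"
      then have sG: "s \<in> carrier G" "\<alpha> s \<in> carrier G" using XG U1 \<alpha>(1) by auto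
      have "conj (inv b) (\<alpha> (conj c s)) = conj (inv b \<otimes> c) (\<alpha> s)"
        using sG bG cG by (simp add: \<alpha>_conj \<alpha>_fix[OF c(1)] conj_conj)
      also have "\<dots> = conj c (conj (inv b) (\<alpha> s))" unfolding cb using sG bG cG by (simp add: conj_conj)
      finally show "conj (inv b) (\<alpha> (conj c s)) = conj c (conj (inv b) (\<alpha> s))" .
    qed
    also have "\<dots> = conj c ` conj (inv b) ` \<alpha> ` U1" by (simp add: image_image)
    also have "\<dots> = conj c ` U1"
      using b(2)[symmetric] A.act_inv(1)[OF bG U1(1)] by simp
    finally show ?thesis using c by simp
  qed
  have \<beta>_conj: "\<beta> (conj r s) = conj (\<beta> r) (\<beta> s)" if "r \<in> carrier G" "s \<in> carrier G" for r s
    using that bG \<alpha>(1)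
    by (simp add: \<beta>_def \<alpha>_conj conj_def[of "\<alpha> r"] conj_def[of "conj (inv b) (\<alpha> r)"] conj_mult conj_inv)
  have moves: "?act a U1 \<noteq> U1" using fixes_only[OF U1(1), of a] U1(2) E1[OF aE] a(1) by (auto simp: mem_centr)
  have \<beta>_id: "\<beta> s = s" if s: "s \<in> carrier G" for s
  proof -
    \<comment> \<open>\<open>\<beta>\<close> fixes both \<open>U\<close> and its conjugate by
      \<open>s\<close>, so \<open>s\<close> and \<open>\<beta> s\<close> act alike on the six
      subgroups.\<close>
    have "?act (inv s \<otimes> \<beta> s) U = U" if U: "U \<in> X" for U
    proof -
      have "?act s U = \<beta> ` (?act s U)" using \<beta>X[OF A.act_closed[OF s U]] by simp
      also have "\<dots> = (\<lambda>u. conj (\<beta> s) (\<beta> u)) ` U"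
        unfolding image_image using \<beta>_conj[OF s] XG[OF U] by (intro image_cong) auto
      also have "\<dots> = ?act (\<beta> s) (\<beta> ` U)" by (simp add: image_image)
      also have "\<dots> = ?act (\<beta> s) U" using \<beta>X[OF U] by simp
      finally have "?act (inv s) (?act (\<beta> s) U) = U" using A.act_inv(1)[OF s U] by simp
      then show ?thesis using A.act_mult[OF _ \<beta>G[OF s] U, of "inv s"] s by simp
    qed
    then have "inv s \<otimes> \<beta> s = \<one>"
      using action_faithful[OF act a(1) U1(1) moves, of "inv s \<otimes> \<beta> s"] s \<beta>G[OF s] by simp
    then show ?thesis using s \<beta>G[OF s] by (metis inv_equality inv_inv inv_closed)
  qed
  have "\<alpha> s = conj b s" if s: "s \<in> carrier G" for s
    using \<beta>_id[OF s] bG \<alpha>(1)[OF s] conj_inv_conj(2)[OF bG, of "\<alpha> s"] by (simp add: \<beta>_def)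
  then show ?thesis using that bG by blast
qed

end

section \<open>Reduction to a simple group\<close>

context finite_group
begin

text \<open>The orbit of \<open>x\<close> under \<open>M\<close> is contained in its class, and
  orbit-stabilizer is applied to both. Equality means that \<open>M\<close> is transitive on the
  class.\<close>

lemma card_centr_subgroup:
  assumes M: "subgroup M G" and x: "x \<in> carrier G"
  shows "card (centr x) * card M \<le> card (carrier G) * card (centr x \<inter> M)"
    and "card (centr x) * card M = card (carrier G) * card (centr x \<inter> M) \<Longrightarrow> cls x = (\<lambda>m. conj m x) ` M"
proof -
  have MG: "M \<subseteq> carrier G" using subgroup.subset[OF M] .
  interpret A: action "G\<lparr>carrier := M\<rparr>" "carrier G" conj
    by (rule action_subgroup[OF M fin]) (use MG in \<open>auto simp: conj_conj subset_iff\<close>)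
  have st: "A.stab x = centr x \<inter> M" using MG x by (auto simp: A.stab_def mem_centr_conj)
  have orb: "A.orb x = (\<lambda>m. conj m x) ` M" by (simp add: A.orb_def)
  have os: "card (A.orb x) * card (centr x \<inter> M) = card M" using A.orbit_stabilizer[OF x] st by simp
  have sub: "A.orb x \<subseteq> cls x" using MG by (auto simp: orb cls_def)
  then have le: "card (A.orb x) \<le> card (cls x)" using x by (intro card_mono) auto
  have e: "card (centr x) * card M = card (A.orb x) * (card (centr x) * card (centr x \<inter> M))"
    "card (carrier G) * card (centr x \<inter> M) = card (cls x) * (card (centr x) * card (centr x \<inter> M))"
    using os cls_centr[OF x] by (simp_all add: ac_simps flip: os)
  show "card (centr x) * card M \<le> card (carrier G) * card (centr x \<inter> M)"
    unfolding e using le by (rule mult_le_mono1)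
  assume "card (centr x) * card M = card (carrier G) * card (centr x \<inter> M)"
  moreover have "\<one> \<in> centr x \<inter> M"
    using subgroup.one_closed[OF M] subgroup.one_closed[OF centr_subgroup[OF x]] by blast
  then have "card (centr x) * card (centr x \<inter> M) > 0" by (auto simp: card_gt_0_iff)
  ultimately have "card (A.orb x) = card (cls x)" using e by (metis mult_cancel2 less_irrefl)
  then show "cls x = (\<lambda>m. conj m x) ` M"
    using card_subset_eq[OF finite_cls[OF x] sub] orb by simp
qed

text \<open>Commuting pairs between \<open>A\<close> and \<open>B\<close> are counted from either
  side.\<close>

lemma sum_centr_swap:
  assumes "A \<subseteq> carrier G" "B \<subseteq> carrier G"
  shows "(\<Sum>x\<in>A. card (centr x \<inter> B)) = (\<Sum>x\<in>B. card (centr x \<inter> A))"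
proof -
  have f: "finite A" "finite B" using assms fin finite_subset by auto
  have c: "card (centr x \<inter> B) = (\<Sum>y\<in>B. if x \<otimes> y = y \<otimes> x then 1 else 0)" if "B \<subseteq> carrier G" "finite B" for x B
  proof -
    have "centr x \<inter> B = {y \<in> B. x \<otimes> y = y \<otimes> x}" using that by (auto simp: mem_centr)
    then show ?thesis using that by (simp add: sum.If_cases Int_def)
  qed
  have "(\<Sum>x\<in>A. card (centr x \<inter> B)) = (\<Sum>x\<in>A. \<Sum>y\<in>B. if x \<otimes> y = y \<otimes> x then 1 else 0)"
    using c[OF assms(2) f(2)] by simp
  also have "\<dots> = (\<Sum>y\<in>B. \<Sum>x\<in>A. if x \<otimes> y = y \<otimes> x then 1 else 0)" by (rule sum.swap)
  also have "\<dots> = (\<Sum>y\<in>B. card (centr y \<inter> A))"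
    using c[OF assms(1) f(1)] by (intro sum.cong) (auto intro!: sum.cong)
  finally show ?thesis .
qed

text \<open>The bound for single centralizers is summed over \<open>G\<close>; the swap turns the
  result into a sum of full centralizers over \<open>M\<close>, to which the same bound applies once
  more. If the ends of this chain agree, the first summation is an equality, hence so is each of its
  terms.\<close>

lemma subgroup_commuting:
  assumes M: "subgroup M G" and G: "12 * (\<Sum>x\<in>carrier G. card (centr x)) = card (carrier G) ^ 2"
  shows "card M ^ 2 \<le> 12 * (\<Sum>x\<in>M. card (centr x \<inter> M))"
    and "card M ^ 2 = 12 * (\<Sum>x\<in>M. card (centr x \<inter> M)) \<Longrightarrow> x \<in> carrier G \<Longrightarrow>
      card (centr x) * card M = card (carrier G) * card (centr x \<inter> M)"
proof -
  let ?n = "card (carrier G)" and ?m = "card M"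
  let ?B = "\<Sum>x\<in>carrier G. card (centr x \<inter> M)" and ?C = "\<Sum>x\<in>M. card (centr x \<inter> M)"
  have MG: "M \<subseteq> carrier G" using subgroup.subset[OF M] .
  have n: "?n > 0" using card_pos .
  have 1: "(\<Sum>x\<in>carrier G. card (centr x) * ?m) \<le> (\<Sum>x\<in>carrier G. ?n * card (centr x \<inter> M))"
    using card_centr_subgroup(1)[OF M] by (rule sum_mono)
  then have "(\<Sum>x\<in>carrier G. card (centr x)) * ?m \<le> ?n * ?B"
    by (simp only: sum_distrib_left sum_distrib_right)
  then have "12 * ((\<Sum>x\<in>carrier G. card (centr x)) * ?m) \<le> 12 * (?n * ?B)" by simp
  moreover have "12 * ((\<Sum>x\<in>carrier G. card (centr x)) * ?m) = ?n * (?n * ?m)"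
    using G by (metis mult.assoc power2_eq_square)
  ultimately have "?n * (?n * ?m) \<le> ?n * (12 * ?B)" by (simp only: mult.left_commute)
  then have nB: "?n * ?m \<le> 12 * ?B" using n by simp
  have "centr x \<inter> carrier G = centr x" for x using centr_carrier by blast
  then have "?B = (\<Sum>x\<in>M. card (centr x))" using sum_centr_swap[OF subset_refl MG] by simp
  then have "?B * ?m = (\<Sum>x\<in>M. card (centr x) * ?m)" by (simp add: sum_distrib_right)
  also have "\<dots> \<le> (\<Sum>x\<in>M. ?n * card (centr x \<inter> M))"
    using card_centr_subgroup(1)[OF M] MG by (intro sum_mono) auto
  finally have BC: "?B * ?m \<le> ?n * ?C" by (simp add: sum_distrib_left)
  have "?n * ?m * ?m \<le> 12 * ?B * ?m" using nB by (rule mult_le_mono1)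
  also have "\<dots> \<le> 12 * (?n * ?C)" using BC by simp
  finally have "?n * ?m ^ 2 \<le> ?n * (12 * ?C)" by (simp add: power2_eq_square mult.assoc mult.left_commute)
  then show "?m ^ 2 \<le> 12 * ?C" using n by simp
  assume eq: "?m ^ 2 = 12 * ?C" and x: "x \<in> carrier G"
  have m: "?m > 0" using subgroup.one_closed[OF M] MG fin by (auto simp: card_gt_0_iff intro: finite_subset)
  have "12 * ?B * ?m \<le> ?n * ?m * ?m" using BC eq by (simp add: power2_eq_square mult.assoc mult.left_commute)
  then have "12 * ?B \<le> ?n * ?m" using m by simp
  then have "?n * (12 * ?B) \<le> ?n * (?n * ?m)" by (rule mult_le_mono2)
  then have "12 * (?n * ?B) \<le> ?n * (?n * ?m)" by (simp only: mult.left_commute)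
  also have "?n * (?n * ?m) = 12 * ((\<Sum>x\<in>carrier G. card (centr x)) * ?m)"
    using G by (metis mult.assoc power2_eq_square)
  finally have "?n * ?B \<le> (\<Sum>x\<in>carrier G. card (centr x)) * ?m" by simp
  then have "(\<Sum>x\<in>carrier G. ?n * card (centr x \<inter> M)) \<le> (\<Sum>x\<in>carrier G. card (centr x) * ?m)"
    by (simp only: sum_distrib_left sum_distrib_right)
  with 1 have "(\<Sum>x\<in>carrier G. card (centr x) * ?m) = (\<Sum>x\<in>carrier G. ?n * card (centr x \<inter> M))" by linarith
  then show "card (centr x) * ?m = ?n * card (centr x \<inter> M)"
    using card_centr_subgroup(1)[OF M] x fin by (rule sum_mono_inv)
qed

text \<open>A centralizer maps into the centralizer of the image. Equality of the sums makes each
  centralizer the full preimage, so commuting modulo \<open>N\<close> implies commuting.\<close>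

lemma quotient_commuting:
  assumes N: "N \<lhd> G"
  shows "finite_group (G Mod N)"
    and "(\<Sum>x\<in>carrier G. card (centr x)) \<le> card N ^ 2 * (\<Sum>X\<in>carrier (G Mod N). card (group.centr (G Mod N) X))"
    and "(\<Sum>x\<in>carrier G. card (centr x)) = card N ^ 2 * (\<Sum>X\<in>carrier (G Mod N). card (group.centr (G Mod N) X)) \<Longrightarrow>
      x \<in> carrier G \<Longrightarrow> y \<in> carrier G \<Longrightarrow> N #> x \<in> group.centr (G Mod N) (N #> y) \<Longrightarrow> x \<otimes> y = y \<otimes> x"
    and "card (carrier G) = card N * card (carrier (G Mod N))"
proof -
  interpret N: normal N G using N .
  let ?S = "G Mod N"
  have cS: "carrier ?S = (\<lambda>x. N #> x) ` carrier G" by (auto simp: FactGroup_def RCOSETS_def)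
  interpret S: finite_group ?S
    using N.factorgroup_is_group fin by (simp add: finite_group_def finite_group_axioms_def cS)
  show "finite_group ?S" by unfold_locales
  have NG: "N \<subseteq> carrier G" using N.subset .
  have mult: "(N #> x) \<otimes>\<^bsub>?S\<^esub> (N #> y) = N #> (x \<otimes> y)" if "x \<in> carrier G" "y \<in> carrier G" for x y
    using that N.rcos_sum by (simp add: FactGroup_def)
  have cX: "card X = card N" if "X \<in> carrier ?S" for X
    using that card_rcosets_equal[OF _ NG] by (auto simp: FactGroup_def)
  have XG: "X \<subseteq> carrier G" if "X \<in> carrier ?S" for X
    using that r_coset_subset_G[OF NG] by (auto simp: cS)
  have mem: "x \<in> X \<longleftrightarrow> N #> x = X" if x: "x \<in> carrier G" and X: "X \<in> carrier ?S" for x X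
  proof -
    obtain z where z: "z \<in> carrier G" "X = N #> z" using X unfolding cS by blast
    show ?thesis
    proof
      show "x \<in> X \<Longrightarrow> N #> x = X" using repr_independence[OF _ z(1) N.subgroup_axioms] z(2) by simp
      show "N #> x = X \<Longrightarrow> x \<in> X" using rcos_self[OF x N.subgroup_axioms] by simp
    qed
  qed
  have disj: "X \<inter> Y = {}" if "X \<in> carrier ?S" "Y \<in> carrier ?S" "X \<noteq> Y" for X Y
    using that mem XG by blast
  have card_Un: "card (\<Union>T) = card N * card T" if "T \<subseteq> carrier ?S" for T
  proof -
    have "card N * card T = card (\<Union>T)"
    proof (rule card_partition)
      show "finite T" using that S.fin finite_subset by blast
      show "finite (\<Union>T)" using that XG by (intro finite_subset[OF _ fin]) blast
      show "card X = card N" if "X \<in> T" for X using that \<open>T \<subseteq> carrier ?S\<close> cX by blast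
      show "X \<inter> Y = {}" if "X \<in> T" "Y \<in> T" "X \<noteq> Y" for X Y
        using that \<open>T \<subseteq> carrier ?S\<close> disj by blast
    qed
    then show ?thesis by simp
  qed
  have Un: "\<Union>(carrier ?S) = carrier G"
  proof
    show "\<Union>(carrier ?S) \<subseteq> carrier G" using XG by blast
    show "carrier G \<subseteq> \<Union>(carrier ?S)"
      using rcos_self[OF _ N.subgroup_axioms] unfolding cS by blast
  qed
  show "card (carrier G) = card N * card (carrier ?S)" using card_Un[OF subset_refl] Un by simp
  have sub: "centr x \<subseteq> \<Union>(S.centr (N #> x))" if x: "x \<in> carrier G" for x
  proof
    fix y assume y: "y \<in> centr x"
    then have yG: "y \<in> carrier G" "y \<otimes> x = x \<otimes> y" by (auto simp: mem_centr)
    then have "N #> y \<in> S.centr (N #> x)" using x mult by (auto simp: S.mem_centr cS)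
    then show "y \<in> \<Union>(S.centr (N #> x))" using rcos_self[OF yG(1) N.subgroup_axioms] by blast
  qed
  have fU: "finite (\<Union>(S.centr X))" for X
    using XG S.centr_carrier by (intro finite_subset[OF _ fin]) blast
  have le: "card (centr x) \<le> card N * card (S.centr (N #> x))" if x: "x \<in> carrier G" for x
    using card_mono[OF fU sub[OF x]] card_Un[OF S.centr_carrier] by simp
  have "(\<Sum>x\<in>carrier G. card N * card (S.centr (N #> x))) = (\<Sum>X\<in>carrier ?S. \<Sum>x\<in>X. card N * card (S.centr (N #> x)))"
    unfolding Un[symmetric]
  proof (rule sum.Union_disjoint[unfolded comp_def])
    show "\<forall>X\<in>carrier ?S. finite X" using finite_subset[OF XG fin] by blast
    show "\<forall>X\<in>carrier ?S. \<forall>Y\<in>carrier ?S. X \<noteq> Y \<longrightarrow> X \<inter> Y = {}" using disj by blast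
  qed
  also have "\<dots> = (\<Sum>X\<in>carrier ?S. card N * (card N * card (S.centr X)))"
  proof (rule sum.cong[OF refl])
    fix X assume X: "X \<in> carrier ?S"
    have "(\<Sum>x\<in>X. card N * card (S.centr (N #> x))) = (\<Sum>x\<in>X. card N * card (S.centr X))"
    proof (rule sum.cong[OF refl])
      fix x assume x: "x \<in> X"
      then have "x \<in> carrier G" using XG[OF X] by blast
      then have "N #> x = X" using mem X x by blast
      then show "card N * card (S.centr (N #> x)) = card N * card (S.centr X)" by simp
    qed
    then show "(\<Sum>x\<in>X. card N * card (S.centr (N #> x))) = card N * (card N * card (S.centr X))"
      using cX[OF X] by simp
  qed
  also have "\<dots> = card N ^ 2 * (\<Sum>X\<in>carrier ?S. card (S.centr X))"
    by (simp add: power2_eq_square sum_distrib_left mult.assoc)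
  finally have e: "(\<Sum>x\<in>carrier G. card N * card (S.centr (N #> x))) = card N ^ 2 * (\<Sum>X\<in>carrier ?S. card (S.centr X))" .
  show "(\<Sum>x\<in>carrier G. card (centr x)) \<le> card N ^ 2 * (\<Sum>X\<in>carrier ?S. card (S.centr X))"
    unfolding e[symmetric] using le by (rule sum_mono)
  assume eq: "(\<Sum>x\<in>carrier G. card (centr x)) = card N ^ 2 * (\<Sum>X\<in>carrier ?S. card (S.centr X))"
    and x: "x \<in> carrier G" and y: "y \<in> carrier G" and xy: "N #> x \<in> S.centr (N #> y)"
  have "card (centr y) = card N * card (S.centr (N #> y))"
    using eq[folded e] le y fin by (rule sum_mono_inv)
  then have "centr y = \<Union>(S.centr (N #> y))"
    using card_subset_eq[OF fU sub[OF y]] card_Un[OF S.centr_carrier] by simp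
  then have "x \<in> centr y" using xy rcos_self[OF x N.subgroup_axioms] by blast
  then show "x \<otimes> y = y \<otimes> x" by (simp add: mem_centr)
qed

lemma normal_derived_power: "(derived G ^^ n) (carrier G) \<lhd> G"
  by (induction n) (auto intro: derived_is_normal normal_self)

text \<open>A term of least cardinality in the derived series cannot shrink any further.\<close>

lemma perfect_normal_subgroup:
  assumes "\<not> solvable G"
  obtains M where "M \<lhd> G" "derived G M = M" "M \<noteq> {\<one>}"
proof -
  let ?H = "\<lambda>n. (derived G ^^ n) (carrier G)"
  obtain n where n: "\<And>k. card (?H n) \<le> card (?H k)"
    using ex_has_least_nat[of "\<lambda>_. True" 0 "\<lambda>n. card (?H n)"] by blast
  have sub: "subgroup (?H n) G" using normal_imp_subgroup[OF normal_derived_power] .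
  have "derived G (?H n) \<subseteq> ?H n" using derived_incl[OF subset_refl sub] .
  moreover have "finite (?H n)" using subgroup.subset[OF sub] fin finite_subset by blast
  moreover have "card (?H n) \<le> card (derived G (?H n))" using n[of "Suc n"] by simp
  ultimately have "derived G (?H n) = ?H n" by (simp add: card_seteq)
  moreover have "?H n \<noteq> {\<one>}"
    using assms solvable_iff_trivial_derived_seq by blast
  ultimately show ?thesis using that normal_derived_power by blast
qed

text \<open>\<open>N\<close> is a proper normal subgroup of largest cardinality; normal subgroups of
  the quotient are compared with it through their unions of cosets.\<close>

lemma simple_quotient:
  assumes "carrier G \<noteq> {\<one>}"
  obtains N where "N \<lhd> G" "simple_group (G Mod N)"
proof -
  let ?P = "\<lambda>K. K \<lhd> G \<and> K \<noteq> carrier G"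
  have "?P {\<one>}" using one_is_normal assms by auto
  moreover have "card K < card (carrier G) + 1" if "?P K" for K
    using that card_mono[OF fin, of K] normal_imp_subgroup subgroup.subset by (metis less_add_one le_less_trans)
  ultimately obtain N where N: "?P N" and max: "\<And>K. ?P K \<Longrightarrow> card K \<le> card N"
    using ex_has_greatest_nat[of ?P "{\<one>}" card "card (carrier G) + 1"] by (metis less_imp_le)
  interpret N: normal N G using N by blast
  interpret S: group "G Mod N" using N.factorgroup_is_group .
  have cS: "carrier (G Mod N) = (\<lambda>x. N #> x) ` carrier G" by (auto simp: FactGroup_def RCOSETS_def)
  have "simple_group (G Mod N)"
  proof
    have "carrier (G Mod N) \<noteq> {\<one>\<^bsub>G Mod N\<^esub>}" using N.fact_group_trivial_iff[OF fin] N by blast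
    moreover have "finite (carrier (G Mod N))" using fin by (simp add: cS)
    ultimately show "1 < Coset.order (G Mod N)"
      using S.one_closed by (metis Coset.order_def S.order_gt_0_iff_finite S.order_one_triv_iff less_one linorder_neqE_nat not_less0)
    fix H assume H: "H \<lhd> G Mod N"
    have U: "\<Union>H \<lhd> G" using N.factgroup_subgroup_union_normal[OF H] .
    have Uc: "\<Union>H = {x \<in> carrier G. N #> x \<in> H}"
      using N.factgroup_subgroup_union_char[OF normal_imp_subgroup[OF H]] .
    have "N \<in> H" using subgroup.one_closed[OF normal_imp_subgroup[OF H]] by (simp add: FactGroup_def)
    then have NU: "N \<subseteq> \<Union>H" by blast
    have HS: "H \<subseteq> carrier (G Mod N)" using subgroup.subset[OF normal_imp_subgroup[OF H]] .
    show "H = carrier (G Mod N) \<or> H = {\<one>\<^bsub>G Mod N\<^esub>}"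
    proof (cases "\<Union>H = carrier G")
      case True
      then have "carrier (G Mod N) \<subseteq> H" using Uc by (auto simp: cS)
      then show ?thesis using HS by blast
    next
      case False
      then have "card (\<Union>H) \<le> card N" using max U by blast
      moreover have "finite (\<Union>H)" using Uc fin by simp
      ultimately have UN: "\<Union>H = N" using NU card_seteq[of "\<Union>H" N] by blast
      have "X = N" if X: "X \<in> H" for X
      proof -
        obtain x where x: "x \<in> carrier G" "X = N #> x" using X HS unfolding cS by blast
        then have "x \<in> N" using rcos_self[OF x(1) N.subgroup_axioms] X UN by blast
        then show ?thesis using x coset_join2[OF x(1) N.subgroup_axioms] by simp
      qed
      then have "H = {N}" using \<open>N \<in> H\<close> by blast
      then have "H = {\<one>\<^bsub>G Mod N\<^esub>}" by (simp add: FactGroup_def)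
      then show ?thesis by blast
    qed
  qed
  then show ?thesis using that N by blast
qed

text \<open>An abelian quotient would put the derived subgroup, which is everything, into
  \<open>N\<close>.\<close>

lemma perfect_simple_quotient:
  assumes "derived G (carrier G) = carrier G" "N \<lhd> G" "simple_group (G Mod N)"
  shows "nonabelian_simple (G Mod N)"
proof -
  interpret N: normal N G using assms(2) .
  interpret S: simple_group "G Mod N" using assms(3) .
  interpret FS: finite_group "G Mod N" using quotient_commuting(1)[OF assms(2)] .
  show ?thesis
  proof unfold_locales
    show "\<exists>x\<in>carrier (G Mod N). \<exists>y\<in>carrier (G Mod N). x \<otimes>\<^bsub>G Mod N\<^esub> y \<noteq> y \<otimes>\<^bsub>G Mod N\<^esub> x"
    proof (rule ccontr)
      assume "\<not> ?thesis"
      then have "comm_group (G Mod N)" by (intro S.group_comm_groupI) blast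
      then have "derived G (carrier G) \<subseteq> N" using derived_minimal[OF assms(2)] by blast
      then have "N = carrier G" using assms(1) N.subset by blast
      then show False using N.fact_group_trivial_iff[OF fin] S.simple_not_triv by blast
    qed
  qed
qed


section \<open>Transitivity of commuting on noncentral elements\<close>

lemma commuting_transitive:
  assumes nsol: "\<not> solvable G" and pr: "12 * (\<Sum>x\<in>carrier G. card (centr x)) = card (carrier G) ^ 2"
    and xyw: "x \<in> carrier G" "centr x \<noteq> carrier G" "y \<in> carrier G" "centr y \<noteq> carrier G"
      "w \<in> carrier G" "centr w \<noteq> carrier G"
    and com: "x \<otimes> y = y \<otimes> x" "y \<otimes> w = w \<otimes> y"
  shows "x \<otimes> w = w \<otimes> x"
proof -
  obtain M where M: "M \<lhd> G" "derived G M = M" "M \<noteq> {\<one>}" using perfect_normal_subgroup[OF nsol] .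
  have Ms: "subgroup M G" using normal_imp_subgroup[OF M(1)] .
  have MG: "M \<subseteq> carrier G" using subgroup.subset[OF Ms] .
  have Mc: "m \<otimes> m' \<in> M" "inv m \<in> M" if "m \<in> M" "m' \<in> M" for m m'
    using that subgroup.m_closed[OF Ms] subgroup.m_inv_closed[OF Ms] by auto
  have Mconj: "conj g m \<in> M" if "g \<in> carrier G" "m \<in> M" for g m
    using that M(1) by (simp add: conj_def normal.inv_op_closed2)
  let ?\<Gamma> = "G\<lparr>carrier := M\<rparr>"
  interpret \<Gamma>: finite_group ?\<Gamma> using subgroup_finite_group[OF Ms] .
  have \<Gamma>_centr: "\<Gamma>.centr m = centr m \<inter> M" for m
    using MG by (auto simp: \<Gamma>.mem_centr mem_centr)
  have perf: "derived ?\<Gamma> (carrier ?\<Gamma>) = carrier ?\<Gamma>"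
    using derived_consistent[OF subset_refl Ms] M(2) by simp
  have "carrier ?\<Gamma> \<noteq> {\<one>\<^bsub>?\<Gamma>\<^esub>}" using M(3) by simp
  then obtain N where N: "N \<lhd> ?\<Gamma>" and simp: "simple_group (?\<Gamma> Mod N)" using \<Gamma>.simple_quotient by blast
  let ?S = "?\<Gamma> Mod N"
  interpret S0: nonabelian_simple ?S using \<Gamma>.perfect_simple_quotient[OF perf N simp] .
  have cM: "card M = card N * card (carrier ?S)" using \<Gamma>.quotient_commuting(4)[OF N] by simp
  let ?C = "\<Sum>x\<in>M. card (centr x \<inter> M)" and ?T = "\<Sum>X\<in>carrier ?S. card (S0.centr X)"
  have C1: "card M ^ 2 \<le> 12 * ?C" using subgroup_commuting(1)[OF Ms pr] .
  have C2: "?C \<le> card N ^ 2 * ?T" using \<Gamma>.quotient_commuting(2)[OF N] by (simp add: \<Gamma>_centr)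
  have Np: "card N > 0"
    using cM subgroup.one_closed[OF Ms] finite_subset[OF MG fin] by (metis card_gt_0_iff empty_iff gr0I mult_0)
  interpret S: many_classes ?S
  proof
    have "card N ^ 2 * card (carrier ?S) ^ 2 = card M ^ 2" using cM by (simp add: power_mult_distrib)
    also have "\<dots> \<le> 12 * ?C" by (rule C1)
    also have "\<dots> \<le> 12 * (card N ^ 2 * ?T)" using C2 by (rule mult_le_mono2)
    also have "\<dots> = card N ^ 2 * (12 * ?T)" by (rule mult.left_commute)
    finally have "card N ^ 2 * card (carrier ?S) ^ 2 \<le> card N ^ 2 * (12 * ?T)" .
    then show "card (carrier ?S) ^ 2 \<le> 12 * ?T" by (rule mult_left_le_imp_le) (use Np in simp)
  qed
  \<comment> \<open>The exact value 300 for the simple quotient bounds \<open>?C\<close> from above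
    and closes the chain of inequalities.\<close>
  have "12 * ?C \<le> card M ^ 2"
    using C2 S.centr_count(2) S.order_60 cM by (simp add: power_mult_distrib)
  then have eqC: "card M ^ 2 = 12 * ?C" using C1 by linarith
  then have eqT: "?C = card N ^ 2 * ?T"
    using S.centr_count(2) S.order_60 cM by (simp add: power_mult_distrib)
  have E: "card (centr z) * card M = card (carrier G) * card (centr z \<inter> M)" if "z \<in> carrier G" for z
    using subgroup_commuting(2)[OF Ms pr eqC that] .
  \<comment> \<open>If \<open>M\<close> centralizes \<open>z\<close>, the factor
    \<open>card M\<close> cancels from \<open>E\<close>, leaving a centralizer as large as
    \<open>G\<close>.\<close>
  have central: "centr z = carrier G" if z: "z \<in> carrier G" "M \<subseteq> centr z" for z
  proof -
    have "centr z \<inter> M = M" using z(2) by blast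
    moreover have "card M > 0" using cM Np S0.card_pos by simp
    ultimately have "card (centr z) = card (carrier G)" using E[OF z(1)] by simp
    then show ?thesis using card_subset_eq[OF fin centr_carrier] by blast
  qed
  define \<pi> where "\<pi> m = N #> m" for m
  have \<pi>_\<Gamma>: "\<pi> m = N #>\<^bsub>?\<Gamma>\<^esub> m" for m by (simp add: \<pi>_def r_coset_def)
  interpret N: normal N ?\<Gamma> using N .
  have NM: "N \<subseteq> M" using N.subset by simp
  have cS: "carrier ?S = \<pi> ` M" by (auto simp: FactGroup_def RCOSETS_def \<pi>_\<Gamma>)
  have \<pi>_mult: "\<pi> m \<otimes>\<^bsub>?S\<^esub> \<pi> m' = \<pi> (m \<otimes> m')" if "m \<in> M" "m' \<in> M" for m m'
    using N.rcos_sum[of m m'] that by (simp add: FactGroup_def \<pi>_\<Gamma>)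
  have \<pi>_one: "\<pi> n = \<one>\<^bsub>?S\<^esub> \<longleftrightarrow> n \<in> N" if "n \<in> M" for n
  proof
    assume "\<pi> n = \<one>\<^bsub>?S\<^esub>"
    then have "N #>\<^bsub>?\<Gamma>\<^esub> n = N" by (simp add: \<pi>_\<Gamma> FactGroup_def)
    then show "n \<in> N" using \<Gamma>.rcos_self[OF _ N.subgroup_axioms, of n] that by simp
  next
    assume "n \<in> N"
    then have "N #>\<^bsub>?\<Gamma>\<^esub> n = N" using \<Gamma>.coset_join2[OF _ N.subgroup_axioms, of n] that by simp
    then show "\<pi> n = \<one>\<^bsub>?S\<^esub>" by (simp add: \<pi>_\<Gamma> FactGroup_def)
  qed
  have \<pi>_self: "m \<in> \<pi> m" if "m \<in> M" for m
    using \<Gamma>.rcos_self[OF _ N.subgroup_axioms, of m] that by (simp add: \<pi>_\<Gamma>)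
  have com_iff: "m \<otimes> m' = m' \<otimes> m \<longleftrightarrow> \<pi> m \<in> S0.centr (\<pi> m')" if m: "m \<in> M" "m' \<in> M" for m m'
  proof
    assume "m \<otimes> m' = m' \<otimes> m"
    then have "\<pi> m \<otimes>\<^bsub>?S\<^esub> \<pi> m' = \<pi> m' \<otimes>\<^bsub>?S\<^esub> \<pi> m"
      using \<pi>_mult[OF m] \<pi>_mult[OF m(2,1)] by metis
    moreover have "\<pi> m \<in> carrier ?S" using m cS by blast
    ultimately show "\<pi> m \<in> S0.centr (\<pi> m')" unfolding S0.mem_centr by blast
  next
    assume "\<pi> m \<in> S0.centr (\<pi> m')"
    then show "m \<otimes> m' = m' \<otimes> m"
      using \<Gamma>.quotient_commuting(3)[OF N, of m m'] m eqT by (simp add: \<pi>_\<Gamma> \<Gamma>_centr)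
  qed
  have N_com: "n \<otimes> m = m \<otimes> n" if n: "n \<in> N" and m: "m \<in> M" for n m
  proof -
    have nM: "n \<in> M" using n NM by blast
    have "\<pi> n = \<one>\<^bsub>?S\<^esub>" using \<pi>_one[OF nM] n by blast
    moreover have "\<pi> m \<in> carrier ?S" using m by (simp add: cS)
    ultimately have "\<pi> n \<in> S0.centr (\<pi> m)"
      by (metis S0.mem_centr S0.l_one S0.r_one S0.one_closed)
    then show ?thesis using com_iff[OF nM m] by blast
  qed
  \<comment> \<open>Together with \<open>N_com\<close> this identifies \<open>N\<close> as the
    centre of \<open>M\<close>. So \<open>N\<close>, chosen only as a normal subgroup of
    \<open>M\<close>, is invariant under all of \<open>G\<close>.\<close>
  have N_char: "n \<in> N" if n: "n \<in> M" "\<And>m. m \<in> M \<Longrightarrow> m \<otimes> n = n \<otimes> m" for n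
  proof -
    have "\<pi> m \<in> S0.centr (\<pi> n)" if "m \<in> M" for m using com_iff[OF that n(1)] n(2)[OF that] by blast
    then have "carrier ?S \<subseteq> S0.centr (\<pi> n)" by (auto simp: cS)
    moreover have "\<pi> n \<in> carrier ?S" using n(1) by (simp add: cS)
    ultimately have "\<pi> n = \<one>\<^bsub>?S\<^esub>" using S0.center_trivial by blast
    then show ?thesis using \<pi>_one[OF n(1)] by blast
  qed
  have conj_N: "conj g ` N = N" if g: "g \<in> carrier G" for g
  proof (rule endo_inj_surj)
    show "finite N" using NM MG fin finite_subset by metis
    show "inj_on (conj g) N" using NM MG g by (intro inj_onI) (auto simp: subset_iff)
    have "conj g n \<in> N" if n: "n \<in> N" for n
    proof (rule N_char)
      have nM: "n \<in> M" using n NM by blast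
      show "conj g n \<in> M" using Mconj[OF g nM] .
      fix m assume m: "m \<in> M"
      define m' where "m' = conj (inv g) m"
      have m': "m' \<in> M" "m = conj g m'" using Mconj[OF _ m, of "inv g"] g m MG by (auto simp: m'_def)
      have G: "n \<in> carrier G" "m' \<in> carrier G" using nM m' MG by auto
      have "conj g (m' \<otimes> n) = conj g (n \<otimes> m')" using N_com[OF n m'(1)] by simp
      then show "m \<otimes> conj g n = conj g n \<otimes> m" using m'(2) g G by (simp add: conj_mult)
    qed
    then show "conj g ` N \<subseteq> N" by blast
  qed
  have \<pi>_im: "\<pi> m = (\<lambda>n. n \<otimes> m) ` N" for m by (auto simp: \<pi>_def r_coset_def)
  have \<pi>G: "\<pi> m \<subseteq> carrier G" if "m \<in> M" for m
    using that MG NM by (auto simp: \<pi>_im subset_iff)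
  have conj_\<pi>: "conj g ` \<pi> m = \<pi> (conj g m)" if g: "g \<in> carrier G" and m: "m \<in> M" for g m
  proof -
    have "conj g ` \<pi> m = (\<lambda>n. n \<otimes> conj g m) ` conj g ` N"
      unfolding \<pi>_im image_image
    proof (rule image_cong[OF refl])
      fix n assume "n \<in> N"
      then show "conj g (n \<otimes> m) = conj g n \<otimes> conj g m" using g m NM MG by (intro conj_mult) auto
    qed
    then show ?thesis using conj_N[OF g] by (simp add: \<pi>_im)
  qed
  have S_conj: "S0.conj (\<pi> b) (\<pi> m) = \<pi> (conj b m)" if b: "b \<in> M" and m: "m \<in> M" for b m
  proof -
    have bG: "b \<in> carrier G" using b MG by blast
    have "\<pi> (inv b) \<otimes>\<^bsub>?S\<^esub> \<pi> b = \<one>\<^bsub>?S\<^esub>"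
      using \<pi>_mult[of "inv b" b] \<pi>_one[of \<one>] b Mc bG subgroup.one_closed[OF Ms] N.one_closed by simp
    then have "inv\<^bsub>?S\<^esub> \<pi> b = \<pi> (inv b)"
      using b Mc by (intro S0.inv_equality) (auto simp: cS)
    moreover have "b \<otimes> m \<in> M" "inv b \<in> M" using Mc b m by blast+
    ultimately show ?thesis unfolding S0.conj_def conj_def using \<pi>_mult b m by metis
  qed
  \<comment> \<open>Conjugation by \<open>g\<close> agrees on \<open>M\<close> modulo \<open>N\<close> with conjugation by some \<open>m \<in> M\<close>; as \<open>M\<close> is
    perfect and \<open>N\<close> is central in it, they agree on \<open>M\<close>.\<close>
  have decomp: "\<exists>m\<in>M. \<exists>z\<in>carrier G. centr z = carrier G \<and> g = m \<otimes> z" if g: "g \<in> carrier G" for g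
  proof -
    have "{X \<in> carrier ?S. card (S0.centr X) = 5} \<noteq> {}"
      using S.centr_count(1) by (metis (no_types, lifting) card.empty zero_neq_numeral)
    then obtain A where A: "A \<in> carrier ?S" "card (S0.centr A) = 5" by blast
    obtain a where a: "a \<in> M" "card (S0.centr (\<pi> a)) = 5" using A unfolding cS by blast
    have aG: "a \<in> carrier G" using a MG by blast
    \<comment> \<open>\<open>M\<close> is transitive on the class of \<open>a\<close>, so some
      \<open>m1\<close> in \<open>M\<close> conjugates \<open>a\<close> as \<open>g\<close> does;
      dividing by it leaves \<open>g1\<close>, which centralizes \<open>a\<close>.\<close>
    have "cls a = (\<lambda>m. conj m a) ` M" using card_centr_subgroup(2)[OF Ms aG E[OF aG]] .
    moreover have "conj g a \<in> cls a" using g by (simp add: cls_def)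
    ultimately obtain m1 where m1: "m1 \<in> M" "conj g a = conj m1 a" by auto
    have m1G: "m1 \<in> carrier G" using m1 MG by blast
    define g1 where "g1 = inv m1 \<otimes> g"
    have g1G: "g1 \<in> carrier G" using g m1G by (simp add: g1_def)
    have "conj g1 a = conj (inv m1) (conj g a)" using g m1G aG by (simp add: g1_def conj_conj)
    then have g1a: "conj g1 a = a" using m1 m1G aG by simp
    \<comment> \<open>Conjugation by \<open>g1\<close> induces an automorphism of \<open>?S\<close>
      that fixes the element \<open>\<pi> a\<close> with centralizer of order 5, so it is
      inner.\<close>
    obtain B where B: "B \<in> carrier ?S" "\<And>X. X \<in> carrier ?S \<Longrightarrow> conj g1 ` X = S0.conj B X"
    proof (rule S.automorphism_inner[of "\<lambda>X. conj g1 ` X" "\<pi> a"])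
      show "conj g1 ` X \<in> carrier ?S" if "X \<in> carrier ?S" for X
        using that conj_\<pi>[OF g1G] Mconj[OF g1G] by (auto simp: cS)
      show "inj_on (\<lambda>X. conj g1 ` X) (carrier ?S)"
      proof (rule inj_onI)
        fix X Y assume XY: "X \<in> carrier ?S" "Y \<in> carrier ?S" "conj g1 ` X = conj g1 ` Y"
        have "X \<subseteq> carrier G" "Y \<subseteq> carrier G" using XY \<pi>G by (auto simp: cS)
        moreover have "inj_on (conj g1) (carrier G)" using g1G by (auto intro: inj_onI)
        ultimately show "X = Y" using XY(3) inj_on_image_eq_iff by metis
      qed
      show "conj g1 ` (X \<otimes>\<^bsub>?S\<^esub> Y) = conj g1 ` X \<otimes>\<^bsub>?S\<^esub> conj g1 ` Y" if XY: "X \<in> carrier ?S" "Y \<in> carrier ?S" for X Y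
      proof -
        obtain m m' where m: "m \<in> M" "m' \<in> M" "X = \<pi> m" "Y = \<pi> m'" using XY by (auto simp: cS)
        have G: "m \<in> carrier G" "m' \<in> carrier G" using m MG by auto
        have "conj g1 ` (X \<otimes>\<^bsub>?S\<^esub> Y) = \<pi> (conj g1 m \<otimes> conj g1 m')"
          using conj_\<pi>[OF g1G Mc(1)[OF m(1,2)]] conj_mult[OF g1G G] \<pi>_mult[OF m(1,2)] m(3,4) by metis
        also have "\<dots> = conj g1 ` X \<otimes>\<^bsub>?S\<^esub> conj g1 ` Y"
          using \<pi>_mult[OF Mconj[OF g1G m(1)] Mconj[OF g1G m(2)]] conj_\<pi>[OF g1G m(1)] conj_\<pi>[OF g1G m(2)] m(3,4)
          by metis
        finally show ?thesis .
      qed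
      show "\<pi> a \<in> carrier ?S" using a by (simp add: cS)
      show "card (S0.centr (\<pi> a)) = 5" by (rule a(2))
      show "conj g1 ` \<pi> a = \<pi> a" using conj_\<pi>[OF g1G a(1)] g1a by simp
    qed blast
    then obtain b where b: "b \<in> M" "B = \<pi> b" by (auto simp: cS)
    have bG: "b \<in> carrier G" using b MG by blast
    define g2 where "g2 = inv b \<otimes> g1"
    have g2G: "g2 \<in> carrier G" using bG g1G by (simp add: g2_def)
    have shift: "\<exists>n\<in>N. conj g2 m = n \<otimes> m" if m: "m \<in> M" for m
    proof -
      have mG: "m \<in> carrier G" using m MG by blast
      have "\<pi> (conj g1 m) = \<pi> (conj b m)"
        using B(2)[of "\<pi> m"] conj_\<pi>[OF g1G m] S_conj[OF b(1) m] b m by (simp add: cS)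
      then have "conj (inv b) ` \<pi> (conj g1 m) = conj (inv b) ` \<pi> (conj b m)" by simp
      then have "\<pi> (conj (inv b) (conj g1 m)) = \<pi> (conj (inv b) (conj b m))"
        using conj_\<pi> bG m g1G Mconj by simp
      then have "\<pi> (conj g2 m) = \<pi> m" using bG g1G mG by (simp add: g2_def conj_conj)
      then have "conj g2 m \<in> \<pi> m" using \<pi>_self[OF Mconj[OF g2G m]] by simp
      then show ?thesis by (auto simp: \<pi>_im)
    qed
    \<comment> \<open>A commutator does not change when its entries are multiplied by elements
      central in \<open>M\<close>.\<close>
    have "derived_set G M \<subseteq> centr g2"
    proof
      fix c assume "c \<in> derived_set G M"
      then obtain h1 h2 where h: "h1 \<in> M" "h2 \<in> M" "c = h1 \<otimes> h2 \<otimes> inv h1 \<otimes> inv h2" by blast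
      obtain n1 n2 where n: "n1 \<in> N" "n2 \<in> N" "conj g2 h1 = n1 \<otimes> h1" "conj g2 h2 = n2 \<otimes> h2"
        using shift h by blast
      have G: "h1 \<in> carrier G" "h2 \<in> carrier G" "n1 \<in> carrier G" "n2 \<in> carrier G"
        using h n NM MG by auto
      have nM: "n1 \<in> M" "n2 \<in> M" using n NM by auto
      have triv: "conj n m = m" if "n \<in> N" "m \<in> M" for n m
        using N_com[OF that] conj_eq_iff that NM MG by (simp add: subset_iff)
      have ce: "c = conj h1 h2 \<otimes> inv h2" using h(3) by (simp add: conj_def)
      have cM: "c \<in> M" unfolding ce using h G Mconj Mc by simp
      have cG: "c \<in> carrier G" using cM MG by blast
      have "conj g2 (conj h1 h2) = conj (n1 \<otimes> h1) (n2 \<otimes> h2)"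
        unfolding n(3)[symmetric] n(4)[symmetric] using G g2G
        by (simp add: conj_def[of h1] conj_def[of "conj g2 h1"] conj_mult conj_inv)
      also have "\<dots> = conj n1 (conj h1 (n2 \<otimes> h2))" using G by (simp add: conj_conj)
      also have "\<dots> = conj h1 (n2 \<otimes> h2)" using triv[OF n(1)] Mconj[OF G(1)] Mc nM h by simp
      also have "\<dots> = n2 \<otimes> conj h1 h2"
        using G N_com[OF n(2) h(1)] by (simp add: conj_mult conj_eq_iff)
      finally have "conj g2 c = n2 \<otimes> conj h1 h2 \<otimes> inv (n2 \<otimes> h2)"
        unfolding ce using G g2G n(4) by (simp add: conj_mult conj_inv)
      also have "\<dots> = conj n2 c" unfolding ce using G by (simp add: conj_def[of n2] m_assoc inv_mult_group)
      also have "\<dots> = c" using triv[OF n(2) cM] .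
      finally show "c \<in> centr g2" using g2G cG by (auto simp: mem_centr conj_eq_iff)
    qed
    then have "M \<subseteq> centr g2"
      using generate_subgroup_incl[OF _ centr_subgroup[OF g2G]] M(2) unfolding derived_def by blast
    then have "centr g2 = carrier G" using central[OF g2G] by blast
    moreover have "b \<otimes> g2 = g1" "m1 \<otimes> g1 = g"
      using g m1G bG g1G by (simp_all add: g2_def g1_def m_assoc[symmetric])
    then have "g = (m1 \<otimes> b) \<otimes> g2" using m1G bG g2G by (simp add: m_assoc)
    ultimately show ?thesis using g2G Mc[OF m1(1) b(1)] by blast
  qed
  \<comment> \<open>If the factor in \<open>M\<close> lay in \<open>N\<close>, it would be
    centralized by \<open>M\<close>, hence central in \<open>G\<close>, and so would be
    \<open>v\<close>.\<close>
  have dec: "\<exists>m\<in>M. \<pi> m \<noteq> \<one>\<^bsub>?S\<^esub> \<and> (\<exists>z\<in>carrier G. centr z = carrier G \<and> v = m \<otimes> z)"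
    if v: "v \<in> carrier G" "centr v \<noteq> carrier G" for v
  proof -
    obtain m z where mz: "m \<in> M" "z \<in> carrier G" "centr z = carrier G" "v = m \<otimes> z" using decomp[OF v(1)] by blast
    have mG: "m \<in> carrier G" using mz MG by blast
    have "\<pi> m \<noteq> \<one>\<^bsub>?S\<^esub>"
    proof
      assume "\<pi> m = \<one>\<^bsub>?S\<^esub>"
      then have "m \<in> N" using \<pi>_one[OF mz(1)] by blast
      then have "M \<subseteq> centr m" using N_com MG by (auto simp: mem_centr)
      then have cm: "centr m = carrier G" by (rule central[OF mG])
      have "u \<in> centr v" if u: "u \<in> carrier G" for u
      proof -
        have "conj u m = m" "conj u z = z" using u cm mz(2,3) mG mem_centr_conj by blast+
        then show ?thesis using u mG mz by (simp add: mem_centr_conj conj_mult)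
      qed
      then show False using v(2) centr_carrier by blast
    qed
    then show ?thesis using mz by blast
  qed
  have prod_com: "(m \<otimes> z) \<otimes> (m' \<otimes> z') = (m' \<otimes> z') \<otimes> (m \<otimes> z) \<longleftrightarrow> m \<otimes> m' = m' \<otimes> m"
    if m: "m \<in> M" "m' \<in> M" and z: "z \<in> carrier G" "z' \<in> carrier G" "centr z = carrier G" "centr z' = carrier G"
    for m m' z z'
  proof -
    have G: "m \<in> carrier G" "m' \<in> carrier G" using m MG by auto
    have zc: "u \<otimes> z = z \<otimes> u" "u \<otimes> z' = z' \<otimes> u" if "u \<in> carrier G" for u
      using that z by (auto simp: mem_centr set_eq_iff)
    have "(m \<otimes> z) \<otimes> (m' \<otimes> z') = (m \<otimes> m') \<otimes> (z \<otimes> z')"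
      using G z zc(1)[OF G(2)] by (metis m_assoc m_closed)
    moreover have "(m' \<otimes> z') \<otimes> (m \<otimes> z) = (m' \<otimes> m) \<otimes> (z \<otimes> z')"
      using G z zc(2)[OF G(1)] zc(1)[OF z(2)] by (metis m_assoc m_closed)
    ultimately show ?thesis using G z(1,2) by (metis m_closed right_cancel)
  qed
  obtain mx zx where X: "mx \<in> M" "\<pi> mx \<noteq> \<one>\<^bsub>?S\<^esub>" "zx \<in> carrier G" "centr zx = carrier G" "x = mx \<otimes> zx"
    using dec[OF xyw(1,2)] by blast
  obtain my zy where Y: "my \<in> M" "\<pi> my \<noteq> \<one>\<^bsub>?S\<^esub>" "zy \<in> carrier G" "centr zy = carrier G" "y = my \<otimes> zy"
    using dec[OF xyw(3,4)] by blast
  obtain mw zw where W: "mw \<in> M" "\<pi> mw \<noteq> \<one>\<^bsub>?S\<^esub>" "zw \<in> carrier G" "centr zw = carrier G" "w = mw \<otimes> zw"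
    using dec[OF xyw(5,6)] by blast
  have "mx \<otimes> my = my \<otimes> mx" using com(1) prod_com X Y by blast
  then have 1: "\<pi> mx \<in> S0.centr (\<pi> my)" using com_iff X Y by blast
  have "mw \<otimes> my = my \<otimes> mw" using com(2) prod_com W Y by metis
  then have 2: "\<pi> mw \<in> S0.centr (\<pi> my)" using com_iff W Y by blast
  have "S0.centr (\<pi> mx) = S0.centr (\<pi> my)"
    using S.centr_eq[OF _ Y(2) 1 X(2)] Y(1) by (simp add: cS)
  then have "\<pi> mw \<in> S0.centr (\<pi> mx)" using 2 by simp
  then have "mw \<otimes> mx = mx \<otimes> mw" using com_iff W X by blast
  then show ?thesis using prod_com X W by metis
qed

end

section \<open>Laplacian spectrum of a complete multipartite graph\<close>

text \<open>For an eigenvector \<open>v\<close>, the sum \<open>T i\<close> of its entries over a part of size \<open>c i\<close> and the sum \<open>T'\<close>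
  of all entries satisfy \<open>(n - k) * T i = c i * T'\<close> and \<open>k * T' = 0\<close>.\<close>

lemma complete_multipartite_L_integral:
  assumes pg: "pair_graph X" and arcs: "parcs X = {(x, y). x \<in> pverts X \<and> y \<in> pverts X \<and> \<not> r x y}"
    and refl: "\<And>x. x \<in> pverts X \<Longrightarrow> r x x"
    and sym: "\<And>x y. x \<in> pverts X \<Longrightarrow> y \<in> pverts X \<Longrightarrow> r x y \<Longrightarrow> r y x"
    and trans: "\<And>x y z. x \<in> pverts X \<Longrightarrow> y \<in> pverts X \<Longrightarrow> z \<in> pverts X \<Longrightarrow> r x y \<Longrightarrow> r y z \<Longrightarrow> r x z"
  shows "L_integral X"
  unfolding L_integral_def
proof (intro conjI pg allI impI)
  fix vs :: "'a list" and k :: complex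
  assume vs: "distinct vs \<and> set vs = pverts X" and ev: "eigenvalue (laplacian_mat X vs) k"
  define n where "n = length vs"
  define R where "R i = {j. j < n \<and> r (vs ! i) (vs ! j)}" for i
  define c where "c i = card (R i)" for i
  have inV: "vs ! i \<in> pverts X" if "i < n" for i using that vs nth_mem[of i vs] unfolding n_def by blast
  have Rn: "R i \<subseteq> {..<n}" for i by (auto simp: R_def)
  have fR [simp]: "finite (R i)" for i using Rn finite_subset by blast
  have R_sym: "j \<in> R i \<longleftrightarrow> i \<in> R j" if "i < n" "j < n" for i j using that sym inV by (auto simp: R_def)
  have R_eq: "R j = R i" if "i < n" "j \<in> R i" for i j
  proof -
    have j: "j < n" "r (vs ! i) (vs ! j)" using that by (auto simp: R_def)
    have "r (vs ! j) (vs ! l) \<longleftrightarrow> r (vs ! i) (vs ! l)" if "l < n" for l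
      using sym trans inV[OF \<open>i < n\<close>] inV[OF j(1)] inV[OF that] j(2) by metis
    then show ?thesis by (auto simp: R_def)
  qed
  have deg: "out_degree X (vs ! i) = n - c i" if i: "i < n" for i
  proof -
    have "out_arcs X (vs ! i) = (\<lambda>j. (vs ! i, vs ! j)) ` ({..<n} - R i)"
    proof
      show "out_arcs X (vs ! i) \<subseteq> (\<lambda>j. (vs ! i, vs ! j)) ` ({..<n} - R i)"
      proof
        fix e assume "e \<in> out_arcs X (vs ! i)"
        then have e: "fst e = vs ! i" "snd e \<in> pverts X" "\<not> r (vs ! i) (snd e)"
          using arcs by (auto simp: out_arcs_def)
        obtain j where j: "j < n" "snd e = vs ! j" using e(2) vs by (metis in_set_conv_nth n_def)
        then have "e = (vs ! i, vs ! j)" "j \<in> {..<n} - R i" using e by (auto simp: R_def prod_eq_iff)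
        then show "e \<in> (\<lambda>j. (vs ! i, vs ! j)) ` ({..<n} - R i)" by blast
      qed
      show "(\<lambda>j. (vs ! i, vs ! j)) ` ({..<n} - R i) \<subseteq> out_arcs X (vs ! i)"
        using arcs inV i by (auto simp: out_arcs_def R_def)
    qed
    moreover have "inj_on (\<lambda>j. (vs ! i, vs ! j)) ({..<n} - R i)"
      using vs by (auto intro!: inj_onI simp: nth_eq_iff_index_eq n_def)
    ultimately have "out_degree X (vs ! i) = card ({..<n} - R i)"
      by (simp add: out_degree_def card_image)
    then show ?thesis using card_Diff_subset[OF fR Rn] by (simp add: c_def)
  qed
  have c_le: "c i \<le> n" for i using card_mono[OF finite_lessThan Rn] by (simp add: c_def)
  obtain v where v: "v \<in> carrier_vec n" "v \<noteq> 0\<^sub>v n" "laplacian_mat X vs *\<^sub>v v = k \<cdot>\<^sub>v v"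
    using ev by (auto simp: eigenvalue_def eigenvector_def laplacian_mat_def degree_mat_def adjacency_mat_def n_def)
  define T' where "T' = (\<Sum>j<n. v $ j)"
  define T where "T i = (\<Sum>j\<in>R i. v $ j)" for i
  \<comment> \<open>The neighbours of a vertex are the vertices outside its part \<open>R i\<close>,
    so the adjacency matrix contributes \<open>T' - T i\<close>.\<close>
  have row: "(of_nat n - of_nat (c i)) * v $ i - (T' - T i) = k * v $ i" if i: "i < n" for i
  proof -
    have dv: "dim_vec v = n" using v(1) by auto
    have "k * v $ i = (laplacian_mat X vs *\<^sub>v v) $ i" using v i dv by simp
    also have "\<dots> = (\<Sum>j<n. laplacian_mat X vs $$ (i, j) * v $ j)"
      using i dv by (simp add: laplacian_mat_def degree_mat_def adjacency_mat_def n_def scalar_prod_def lessThan_atLeast0)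
    also have "\<dots> = (\<Sum>j<n. (if i = j then of_nat (n - c i) * v $ j else 0) - (if j \<in> {..<n} - R i then v $ j else 0))"
    proof (rule sum.cong[OF HOL.refl])
      fix j assume j: "j \<in> {..<n}"
      have "(vs ! i, vs ! j) \<in> parcs X \<longleftrightarrow> j \<in> {..<n} - R i" using arcs inV i j by (auto simp: R_def)
      then show "laplacian_mat X vs $$ (i, j) * v $ j =
        (if i = j then of_nat (n - c i) * v $ j else 0) - (if j \<in> {..<n} - R i then v $ j else 0)"
        using i j deg[OF i]
        by (cases "i = j") (simp_all add: laplacian_mat_def degree_mat_def adjacency_mat_def n_def left_diff_distrib)
    qed
    also have "\<dots> = of_nat (n - c i) * v $ i - (\<Sum>j\<in>{..<n} - R i. v $ j)"
    proof -
      have "(\<Sum>j<n. if j \<in> {..<n} - R i then v $ j else 0) = (\<Sum>j\<in>{..<n} - R i. v $ j)"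
        by (rule sum.mono_neutral_cong_right) auto
      then show ?thesis using i by (simp add: sum_subtractf)
    qed
    also have "(\<Sum>j\<in>{..<n} - R i. v $ j) = T' - T i"
      using sum_diff[OF finite_lessThan Rn, of "\<lambda>j. v $ j"] by (simp add: T'_def T_def)
    finally show ?thesis using c_le by (simp add: of_nat_diff)
  qed
  have block: "(of_nat n - k) * T i = of_nat (c i) * T'" if i: "i < n" for i
  proof -
    have "k * T i = (\<Sum>j\<in>R i. k * v $ j)" by (simp add: T_def sum_distrib_left)
    also have "\<dots> = (\<Sum>j\<in>R i. (of_nat n - of_nat (c i)) * v $ j - (T' - T i))"
    proof (rule sum.cong[OF HOL.refl])
      fix j assume j: "j \<in> R i"
      then have "j < n" by (simp add: R_def)
      moreover have "c j = c i" "T j = T i" using R_eq[OF i j] by (simp_all add: c_def T_def)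
      ultimately show "k * v $ j = (of_nat n - of_nat (c i)) * v $ j - (T' - T i)" using row[of j] by simp
    qed
    also have "\<dots> = (of_nat n - of_nat (c i)) * T i - of_nat (c i) * (T' - T i)"
      by (simp add: sum_subtractf T_def c_def sum_distrib_left)
    finally show ?thesis by (simp add: algebra_simps)
  qed
  \<comment> \<open>The entry \<open>v $ j\<close> is counted once for every member of the part of
    \<open>j\<close>.\<close>
  have "(\<Sum>i<n. T i) = (\<Sum>i<n. \<Sum>j<n. if j \<in> R i then v $ j else 0)"
    unfolding T_def by (intro sum.cong HOL.refl sum.mono_neutral_cong_left) (use Rn in auto)
  also have "\<dots> = (\<Sum>j<n. \<Sum>i<n. if j \<in> R i then v $ j else 0)" by (rule sum.swap)
  also have "\<dots> = (\<Sum>j<n. of_nat (c j) * v $ j)"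
  proof (rule sum.cong[OF HOL.refl])
    fix j assume j: "j \<in> {..<n}"
    have "(\<Sum>i<n. if j \<in> R i then v $ j else 0) = (\<Sum>i\<in>R j. v $ j)"
      by (rule sum.mono_neutral_cong_right) (use Rn R_sym j in auto)
    then show "(\<Sum>i<n. if j \<in> R i then v $ j else 0) = of_nat (c j) * v $ j" by (simp add: c_def)
  qed
  finally have sT: "(\<Sum>i<n. T i) = (\<Sum>j<n. of_nat (c j) * v $ j)" .
  \<comment> \<open>Adding all rows annihilates the left side, as the columns of a Laplacian sum to
    zero.\<close>
  have "k * T' = (\<Sum>i<n. (of_nat n - of_nat (c i)) * v $ i - (T' - T i))"
    using row by (simp add: T'_def sum_distrib_left)
  also have "\<dots> = 0"
    by (simp add: sum_subtractf left_diff_distrib sT T'_def sum_distrib_left)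
  finally have kT: "k * T' = 0" .
  show "k \<in> \<int>"
  proof (cases "k = 0 \<or> k = of_nat n")
    case True
    then show ?thesis by auto
  next
    case False
    then have "T' = 0" using kT by simp
    then have T0: "T i = 0" if "i < n" for i using block[OF that] False by auto
    obtain i where i: "i < n" "v $ i \<noteq> 0" using v(1,2) by (metis carrier_vecD eq_vecI index_zero_vec(1,2))
    then have "(of_nat n - of_nat (c i)) * v $ i = k * v $ i" using row[OF i(1)] T0[OF i(1)] \<open>T' = 0\<close> by simp
    then have "k = of_nat n - of_nat (c i)" using i(2) by simp
    then show ?thesis by simp
  qed
qed

theorem proposition5p7:
  fixes G :: "('a, 'b) monoid_scheme"
  assumes "group G"
    and "finite (carrier G)"
    and "\<not> solvable G"
    and "commuting_probability G = 1 / 12"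
  shows "L_integral (non_commuting_graph G)"
proof -
  interpret finite_group G using assms(1,2) by (simp add: finite_group_def finite_group_axioms_def)
  have cen: "group_center G = {x \<in> carrier G. centr x = carrier G}"
  proof -
    have "centr x = carrier G \<longleftrightarrow> (\<forall>g\<in>carrier G. x \<otimes>\<^bsub>G\<^esub> g = g \<otimes>\<^bsub>G\<^esub> x)" for x
    proof -
      have "centr x = carrier G \<longleftrightarrow> (\<forall>g\<in>carrier G. g \<in> centr x)" using centr_carrier by blast
      then show ?thesis by (simp add: mem_centr eq_commute)
    qed
    then show ?thesis by (simp add: group_center_def)
  qed
  have "{(x, y). x \<in> carrier G \<and> y \<in> carrier G \<and> x \<otimes>\<^bsub>G\<^esub> y = y \<otimes>\<^bsub>G\<^esub> x} = (SIGMA x:carrier G. centr x)"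
    by (auto simp: mem_centr)
  then have "commuting_probability G = real (\<Sum>x\<in>carrier G. card (centr x)) / real (card (carrier G)) ^ 2"
    using fin by (simp add: commuting_probability_def card_SigmaI)
  then have "real (12 * (\<Sum>x\<in>carrier G. card (centr x))) = real (card (carrier G) ^ 2)"
    using assms(4) card_pos by (simp add: field_simps)
  then have pr: "12 * (\<Sum>x\<in>carrier G. card (centr x)) = card (carrier G) ^ 2" by (simp only: of_nat_eq_iff)
  show ?thesis
  proof (rule complete_multipartite_L_integral[where r = "\<lambda>x y. x \<otimes>\<^bsub>G\<^esub> y = y \<otimes>\<^bsub>G\<^esub> x"])
    show "pair_graph (non_commuting_graph G)" by (rule pair_graph_non_commuting_graph[OF assms(2)])
    fix x y z assume "x \<in> pverts (non_commuting_graph G)" "y \<in> pverts (non_commuting_graph G)"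
      "z \<in> pverts (non_commuting_graph G)" "x \<otimes>\<^bsub>G\<^esub> y = y \<otimes>\<^bsub>G\<^esub> x" "y \<otimes>\<^bsub>G\<^esub> z = z \<otimes>\<^bsub>G\<^esub> y"
    then show "x \<otimes>\<^bsub>G\<^esub> z = z \<otimes>\<^bsub>G\<^esub> x"
      using commuting_transitive[OF assms(3) pr, of x y z] by (auto simp: non_commuting_graph_def cen)
  qed (auto simp: non_commuting_graph_def)
qed

end
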